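(* Let $0<\beta<1$ and let $B\subseteq\mathbb Z$ be such that $|B\cap[-n,n]|\sim c\,n^{\beta}$ as $n\to\infty$ for some constant $c>0$. Then there exists a probability space on which one can construct the random walk $\{\mathbf C(N)=(C_1(N),C_2(N));\ N=0,1,2,\ldots\}$ on $\mathbb C^2(B)$ together with two independent standard Wiener processes $\{W_1(t);\,t\ge 0\}$ and $\{W_2(t);\,t\ge 0\}$ so that, for any $\varepsilon>0$, as $N\to\infty$, $$\left|C_1(N)-W_1\left(D_2(V_N)\right)\right|=O\left(N^{1/8+\beta/8+\varepsilon}\right)\quad\text{a.s.}$$ and $$\left|C_2(N)-W_2(N)\right|=O\left(N^{1/4+\beta/4+\varepsilon}\right)\quad\text{a.s.}$$
   Context: The random walk $\mathbf C(N)=(C_1(N),C_2(N))$, $N=0,1,2,\ldots$, on $\mathbb C^2(B)$ is the Markov chain on $\mathbb Z^2$ started at $\mathbf C(0)=(0,0)$ with transition probabilities as follows. If $y\in B$, then from $(x,y)$ the walk moves to each of $(x+1,y),(x-1,y),(x,y+1),(x,y-1)$ with probability $1/4$. If $y\notin B$, then from $(x,y)$ it moves to each of $(x,y+1),(x,y-1)$ with probability $1/2$. $V_N=\#\{k:1\le k\le N,\ C_2(k)\ne C_2(k-1)\}$ is the number of vertical steps among the first $N$ steps. $S_2(\cdot)$ is the vertical walk: $S_2(0)=0$ and $S_2(n)$ is the value of $C_2$ immediately after the $n$-th vertical step of $\mathbf C$, so that $C_2(N)=S_2(V_N)$; $S_2$ is a simple symmetric random walk on $\mathbb Z$. Its local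 time is $\xi_2(j,n)=\#\{k:0<k\le n,\ S_2(k)=j\}$, $j\in\mathbb Z$, and $$D_2(V_N)=\sum_{j\in B}\xi_2(j,V_N)$$ is the occupation time of $B$ by $S_2$ during its first $V_N$ steps. *)

theory Defs
  imports "HOL-Probability.Probability" "HOL-Library.Landau_Symbols"
begin

definition (in prob_space) wiener_process :: "(real \<Rightarrow> 'a \<Rightarrow> real) \<Rightarrow> bool" where
  "wiener_process W \<longleftrightarrow>
     (\<forall>t\<ge>0. random_variable borel (W t)) \<and>
     (AE \<omega> in M. W 0 \<omega> = 0) \<and>
     (\<forall>s t. 0 \<le> s \<longrightarrow> s < t \<longrightarrow>
        distributed M lborel (\<lambda>\<omega>. W t \<omega> - W s \<omega>) (normal_density 0 (sqrt (t - s)))) \<and>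
     (\<forall>(n::nat) t. 0 \<le> t 0 \<longrightarrow> (\<forall>i<n. t i < t (Suc i)) \<longrightarrow>
        indep_vars (\<lambda>_. borel) (\<lambda>i \<omega>. W (t (Suc i)) \<omega> - W (t i) \<omega>) {..<n}) \<and>
     (AE \<omega> in M. continuous_on {0..} (\<lambda>t. W t \<omega>))"

text \<open>Independence of the two processes as random elements of the path space over the
  time set \<open>[0, \<infinity>)\<close>, not merely of the pairs of values at fixed times.\<close>

definition (in prob_space) indep_processes ::
    "(real \<Rightarrow> 'a \<Rightarrow> real) \<Rightarrow> (real \<Rightarrow> 'a \<Rightarrow> real) \<Rightarrow> bool" where
  "indep_processes X Y \<longleftrightarrow>
     indep_var (\<Pi>\<^sub>M t\<in>{0..}. borel) (\<lambda>\<omega>. \<lambda>t\<in>{0..}. X t \<omega>)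
               (\<Pi>\<^sub>M t\<in>{0..}. borel) (\<lambda>\<omega>. \<lambda>t\<in>{0..}. Y t \<omega>)"

definition comb_nbrs :: "int set \<Rightarrow> int \<times> int \<Rightarrow> (int \<times> int) set" where
  "comb_nbrs B = (\<lambda>(x, y).
     if y \<in> B then {(x + 1, y), (x - 1, y), (x, y + 1), (x, y - 1)}
     else {(x, y + 1), (x, y - 1)})"

definition comb_step :: "int set \<Rightarrow> int \<times> int \<Rightarrow> (int \<times> int) pmf" where
  "comb_step B z = pmf_of_set (comb_nbrs B z)"

definition (in prob_space) comb_walk :: "int set \<Rightarrow> (nat \<Rightarrow> 'a \<Rightarrow> int \<times> int) \<Rightarrow> bool" where
  "comb_walk B C \<longleftrightarrow>
     (\<forall>N. random_variable (count_space UNIV) (C N)) \<and>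
     (\<forall>\<omega>\<in>space M. C 0 \<omega> = (0, 0)) \<and>
     (\<forall>N z z'. \<P>(\<omega> in M. \<forall>k\<le>N. C k \<omega> = z k) > 0 \<longrightarrow>
        \<P>(\<omega> in M. C (Suc N) \<omega> = z' \<bar> \<forall>k\<le>N. C k \<omega> = z k) = pmf (comb_step B (z N)) z')"

text \<open>The functionals below are defined for a single trajectory \<open>c\<close> of the walk.\<close>

definition vert_steps :: "(nat \<Rightarrow> int \<times> int) \<Rightarrow> nat \<Rightarrow> nat" where
  "vert_steps c N = card {k. 1 \<le> k \<and> k \<le> N \<and> snd (c k) \<noteq> snd (c (k - 1))}"

text \<open>The \<open>n\<close>-th vertical step takes place at the first time at which \<open>n\<close> vertical steps
  have been made. For a trajectory with fewer than \<open>n\<close> vertical steps the value at \<open>n\<close> is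
  arbitrary; the values at \<open>n \<le> vert_steps c N\<close> are always meaningful.\<close>

definition vert_walk :: "(nat \<Rightarrow> int \<times> int) \<Rightarrow> nat \<Rightarrow> int" where
  "vert_walk c n = (if n = 0 then 0 else snd (c (LEAST N. vert_steps c N = n)))"

definition vert_local_time :: "(nat \<Rightarrow> int \<times> int) \<Rightarrow> int \<Rightarrow> nat \<Rightarrow> nat" where
  "vert_local_time c j n = card {k. 0 < k \<and> k \<le> n \<and> vert_walk c k = j}"

text \<open>An unordered infinite sum, because \<open>B\<close> may be infinite (where \<open>sum\<close> would return 0);
  only finitely many terms are nonzero.\<close>

definition vert_occupation :: "int set \<Rightarrow> (nat \<Rightarrow> int \<times> int) \<Rightarrow> nat \<Rightarrow> nat" where
  "vert_occupation B c n = (\<Sum>\<^sub>\<infinity>j\<in>B. vert_local_time c j n)"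

lemma vert_occupation_eq_card:
  "vert_occupation B c n = card {k. 0 < k \<and> k \<le> n \<and> vert_walk c k \<in> B}"
proof -
  define K where "K j = {k. 0 < k \<and> k \<le> n \<and> vert_walk c k = j}" for j
  define F where "F = B \<inter> vert_walk c ` {0<..n}"
  have fin: "finite F" by (simp add: F_def)
  have finK: "finite (K j)" for j by (simp add: K_def)
  have "vert_occupation B c n = (\<Sum>\<^sub>\<infinity>j\<in>F. vert_local_time c j n)"
    unfolding vert_occupation_def
    by (rule infsum_cong_neutral) (auto simp: F_def vert_local_time_def)
  also have "\<dots> = (\<Sum>j\<in>F. card (K j))"
    using fin by (simp add: K_def vert_local_time_def)
  also have "\<dots> = card (\<Union>j\<in>F. K j)"
    using fin finK by (subst card_UN_disjoint) (auto simp: K_def)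
  also have "(\<Union>j\<in>F. K j) = {k. 0 < k \<and> k \<le> n \<and> vert_walk c k \<in> B}"
    by (auto simp: K_def F_def)
  finally show ?thesis .
qed

lemma snd_eq_vert_walk:
  assumes "snd (c 0) = 0"
  shows "snd (c N) = vert_walk c (vert_steps c N)"
proof -
  let ?V = "vert_steps c"
  let ?S = "\<lambda>N. {k. 1 \<le> k \<and> k \<le> N \<and> snd (c k) \<noteq> snd (c (k - 1))}"
  have step: "?V (Suc N) = (if snd (c (Suc N)) \<noteq> snd (c N) then Suc (?V N) else ?V N)" for N
  proof -
    have "?S (Suc N) = (if snd (c (Suc N)) \<noteq> snd (c N) then insert (Suc N) (?S N) else ?S N)"
      by (auto simp: le_Suc_eq)
    then show ?thesis by (simp add: vert_steps_def)
  qed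
  have const: "?V (M + d) = ?V M \<Longrightarrow> snd (c (M + d)) = snd (c M)" for M d
  proof (induction d)
    case (Suc d)
    have "?V M \<le> ?V (M + d)"
      unfolding vert_steps_def by (rule card_mono) auto
    with Suc show ?case using step[of "M + d"] by (auto split: if_splits)
  qed simp
  let ?M = "LEAST M. ?V M = ?V N"
  have "?V ?M = ?V N" by (rule LeastI) (rule refl)
  moreover have "?M \<le> N" by (rule Least_le) (rule refl)
  ultimately have eq: "snd (c N) = snd (c ?M)"
    using const[of ?M "N - ?M"] by simp
  have "?V 0 = 0" by (simp add: vert_steps_def)
  then show ?thesis
    using eq const[of 0 N] assms by (auto simp: vert_walk_def)
qed

end

theory Submission
  imports Defs "HOL-Real_Asymp.Real_Asymp"
begin

text \<open>The comb walk is driven by three independent families of fair signs: the horizontal steps, the vertical steps and, for every visit to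
\<open>B\<close>, a coin that decides between a horizontal and a vertical step. Let \<open>S1\<close>, \<open>S2\<close>, \<open>R\<close> be the simple random walks
with these steps. If among the first \<open>N\<close> steps of the comb walk \<open>h\<close> are horizontal and \<open>u\<close> are vertical steps that start on \<open>B\<close>, then
\<open>C N = (S1 h, S2 (N - h))\<close> and \<open>h - u = R (h + u)\<close>, and \<open>u\<close> differs from the occupation time \<open>D\<close> of \<open>B\<close> by the vertical
walk by at most 1. So \<open>h\<close> and \<open>D\<close> differ only by about the square root of their size. That this construction has the right transition
probabilities (\<open>comb_walk_row_path\<close>) is a matter of counting: the past of the walk is a cylinder event over the signs read so far.

Three facts are needed besides. A simple random walk moves by at most \<open>N powr e * sqrt d\<close> over a time gap
\<open>d\<close> (\<open>fair_walks_modulus\<close>, from an exponential inequality and Borel--Cantelli). The occupation time \<open>D\<close> is at most of order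
\<open>N powr (1/2 + \<beta>/2 + e)\<close> (\<open>AE_occupation_bound\<close>): the discrete Tanaka formula writes it as a
sum of \<open>card F\<close> terms of size at most about \<open>sqrt N\<close> each, up to a martingale of at most the same total size, where \<open>F\<close> is the part of \<open>B\<close> within reach and has about
\<open>N powr (\<beta>/2)\<close> points. Finally, each of \<open>S1\<close> and \<open>S2\<close> stays within \<open>n powr (1/4 + e)\<close> of a Wiener process at integer times
\<open>n\<close> (\<open>walk_near_brownian\<close>). Putting these together, \<open>S2 (N - h)\<close> differs from \<open>S2 N\<close> by about \<open>sqrt h\<close>, hence by about
\<open>N powr (1/4 + \<beta>/4)\<close>, and \<open>S1 h\<close> differs from \<open>S1 D\<close> by about \<open>D powr (1/4)\<close>, hence by about \<open>N powr (1/8 + \<beta>/8)\<close>.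
Both dominate the distance to the Wiener processes, which is only ever used at integer times.

The Wiener process is constructed from the walk, by a refinement in the spirit of Knight. Given a simple random walk, insert at random,
between its steps doubled to pairs, excursions of length 2 with coin tossing. The result is again a simple random walk
(\<open>fair_signs_refine\<close>), and at time \<open>4 * i\<close> it is twice the old walk at a binomial time with mean \<open>i\<close>.
Rescaled by 2 in space and 4 in time, the two differ at time \<open>i\<close> by about \<open>i powr (1/4)\<close>. Iterating,
the rescaled walks converge uniformly on bounded intervals, the total error is dominated by the first step, and the limit has the increments
of a Wiener process because the characteristic functions \<open>cos (u / 2 ^ m) ^ k\<close> of the increments converge to those of normal
variables (\<open>wiener_process_brownian\<close>).\<close>

section \<open>Families of fair signs\<close>

text \<open>The value of \<open>F\<close> factors through the finite tuple of the \<open>Z i\<close>, \<open>i \<in> J\<close>, which ranges over a countable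
set. Preimages are therefore countable unions of cylinders, whatever the target \<open>N\<close> is. This is how
measurability of all functionals of finitely many signs is obtained below.\<close>

lemma measurable_finite_dependence:
  fixes Z :: "'i \<Rightarrow> 'a \<Rightarrow> 'b::countable"
  assumes "finite J" and Z: "\<And>i. i \<in> J \<Longrightarrow> Z i \<in> measurable M (count_space UNIV)"
    and dep: "\<And>\<omega> \<omega>'. \<omega> \<in> space M \<Longrightarrow> \<omega>' \<in> space M \<Longrightarrow> (\<And>i. i \<in> J \<Longrightarrow> Z i \<omega> = Z i \<omega>') \<Longrightarrow> F \<omega> = F \<omega>'"
    and sp: "\<And>\<omega>. \<omega> \<in> space M \<Longrightarrow> F \<omega> \<in> space N"
  shows "F \<in> measurable M N"
proof (rule measurableI)
  fix A assume "A \<in> sets N"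
  define T where "T = (\<lambda>\<omega>. restrict (\<lambda>i. Z i \<omega>) J) ` (F -` A \<inter> space M)"
  have "countable (PiE J (\<lambda>_. UNIV :: 'b set))"
    using \<open>finite J\<close> by (intro countable_PiE) auto
  then have cT: "countable T" by (rule countable_subset[rotated]) (auto simp: T_def)
  have eq: "F -` A \<inter> space M = (\<Union>y\<in>T. {\<omega> \<in> space M. \<forall>i\<in>J. Z i \<omega> = y i})"
  proof (intro equalityI subsetI)
    fix \<omega> assume "\<omega> \<in> (\<Union>y\<in>T. {\<omega> \<in> space M. \<forall>i\<in>J. Z i \<omega> = y i})"
    then obtain \<omega>' where "\<omega>' \<in> F -` A \<inter> space M" "\<omega> \<in> space M" "\<forall>i\<in>J. Z i \<omega> = Z i \<omega>'"
      by (auto simp: T_def)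
    then show "\<omega> \<in> F -` A \<inter> space M" using dep[of \<omega> \<omega>'] by auto
  qed (auto simp: T_def)
  have "{\<omega> \<in> space M. \<forall>i\<in>J. Z i \<omega> = y i} \<in> sets M" for y
  proof -
    have "{\<omega> \<in> space M. Z i \<omega> = y i} \<in> sets M" if "i \<in> J" for i
      using measurable_sets[OF Z[OF that], of "{y i}"] by (simp add: vimage_def Int_def conj_commute)
    then show ?thesis using \<open>finite J\<close> by (rule sets.sets_Collect_finite_All)
  qed
  then show "F -` A \<inter> space M \<in> sets M"
    unfolding eq using cT by (intro sets.countable_UN') auto
qed (use sp in auto)

context prob_space begin

text \<open>Independence and uniformity are encoded together by the probabilities of finite cylinders. In this form a
family that is read off from another one adaptively can be recognised as fair by counting the signs read.\<close>

definition fair_signs :: "('i \<Rightarrow> 'a \<Rightarrow> int) \<Rightarrow> 'i set \<Rightarrow> bool" where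
  "fair_signs Z I \<longleftrightarrow>
     (\<forall>i\<in>I. random_variable (count_space UNIV) (Z i) \<and> Z i \<in> space M \<rightarrow> {-1, 1}) \<and>
     (\<forall>J y. finite J \<longrightarrow> J \<subseteq> I \<longrightarrow> y \<in> J \<rightarrow> {-1, 1} \<longrightarrow>
        \<P>(\<omega> in M. \<forall>j\<in>J. Z j \<omega> = y j) = (1/2) ^ card J)"

lemma fair_signs_measurable:
  "fair_signs Z I \<Longrightarrow> i \<in> I \<Longrightarrow> Z i \<in> measurable M (count_space UNIV)"
  by (simp add: fair_signs_def)

lemma fair_signs_range:
  "fair_signs Z I \<Longrightarrow> i \<in> I \<Longrightarrow> \<omega> \<in> space M \<Longrightarrow> Z i \<omega> \<in> {-1, 1}"
  by (auto simp: fair_signs_def)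

lemma fair_signs_cylinder:
  "fair_signs Z I \<Longrightarrow> finite J \<Longrightarrow> J \<subseteq> I \<Longrightarrow> (\<And>j. j \<in> J \<Longrightarrow> y j \<in> {-1, 1}) \<Longrightarrow>
    \<P>(\<omega> in M. \<forall>j\<in>J. Z j \<omega> = y j) = (1/2) ^ card J"
  unfolding fair_signs_def by blast

lemma fair_signs_reindex:
  assumes Z: "fair_signs Z I" and inj: "inj_on f K" and sub: "f ` K \<subseteq> I"
  shows "fair_signs (\<lambda>k. Z (f k)) K"
  unfolding fair_signs_def
proof (intro conjI ballI allI impI)
  fix k assume "k \<in> K"
  with sub have "f k \<in> I" by auto
  then show "random_variable (count_space UNIV) (Z (f k))" "Z (f k) \<in> space M \<rightarrow> {-1, 1}"
    using Z by (auto simp: fair_signs_def)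
next
  fix J and y :: "_ \<Rightarrow> int" assume J: "finite J" "J \<subseteq> K" "y \<in> J \<rightarrow> {-1, 1}"
  define y' where "y' = y \<circ> inv_into J f"
  have injJ: "inj_on f J" using inj J(2) by (rule inj_on_subset)
  have "\<P>(\<omega> in M. \<forall>j\<in>f ` J. Z j \<omega> = y' j) = (1/2) ^ card (f ` J)"
    using J sub injJ by (intro fair_signs_cylinder[OF Z]) (auto simp: y'_def)
  moreover have "(\<forall>j\<in>f ` J. Z j \<omega> = y' j) \<longleftrightarrow> (\<forall>j\<in>J. Z (f j) \<omega> = y j)" for \<omega>
    using injJ by (auto simp: y'_def)
  ultimately show "\<P>(\<omega> in M. \<forall>j\<in>J. Z (f j) \<omega> = y j) = (1/2) ^ card J"
    by (simp add: card_image injJ)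
qed

lemma fair_signs_indep:
  assumes Z: "fair_signs Z I"
  shows "indep_vars (\<lambda>_. count_space UNIV) Z I"
proof -
  define F where "F i = insert {} ((\<lambda>y. Z i -` {y} \<inter> space M) ` {-1, 1})" for i
  have ev: "F i \<subseteq> events" if "i \<in> I" for i
    using fair_signs_measurable[OF Z that] by (auto simp: F_def intro!: measurable_sets)
  have "indep_sets F I"
  proof (rule indep_setsI)
    fix A J assume J: "J \<noteq> {}" "J \<subseteq> I" "finite J" and A: "\<forall>j\<in>J. A j \<in> F j"
    show "prob (\<Inter>j\<in>J. A j) = (\<Prod>j\<in>J. prob (A j))"
    proof (cases "\<exists>j\<in>J. A j = {}")
      case True
      then obtain j where j: "j \<in> J" "A j = {}" by auto
      then have "(\<Inter>j\<in>J. A j) = {}" by auto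
      moreover have "(\<Prod>j\<in>J. prob (A j)) = 0" using j J by (intro prod_zero) (auto intro!: bexI[of _ j])
      ultimately show ?thesis by simp
    next
      case False
      have "\<forall>j\<in>J. \<exists>y. y \<in> {-1,1} \<and> A j = Z j -` {y} \<inter> space M"
      proof
        fix j assume "j \<in> J"
        with A False have "A j \<in> F j" "A j \<noteq> {}" by auto
        then show "\<exists>y. y \<in> {-1,1} \<and> A j = Z j -` {y} \<inter> space M" by (auto simp: F_def)
      qed
      from bchoice[OF this] obtain y where
        "\<forall>j\<in>J. y j \<in> {-1,1::int} \<and> A j = Z j -` {y j} \<inter> space M" ..
      then have y: "\<And>j. j \<in> J \<Longrightarrow> y j \<in> {-1,1::int}" "\<And>j. j \<in> J \<Longrightarrow> A j = Z j -` {y j} \<inter> space M"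
        by blast+
      have "(\<Inter>j\<in>J. A j) = {\<omega>\<in>space M. \<forall>j\<in>J. Z j \<omega> = y j}" using y J(1) by auto
      then have "prob (\<Inter>j\<in>J. A j) = (1/2) ^ card J"
        using fair_signs_cylinder[OF Z J(3,2) y(1)] by simp
      moreover have "prob (A j) = 1/2" if "j \<in> J" for j
      proof -
        have "A j = {\<omega>\<in>space M. \<forall>j\<in>{j}. Z j \<omega> = y j}" using y(2)[OF that] by auto
        moreover have "\<P>(\<omega> in M. \<forall>j\<in>{j}. Z j \<omega> = y j) = (1/2) ^ card {j}"
        proof (rule fair_signs_cylinder[OF Z])
          show "{j} \<subseteq> I" using that J(2) by auto
        qed (use y(1)[OF that] in auto)
        ultimately show ?thesis by simp
      qed
      then have "(\<Prod>j\<in>J. prob (A j)) = (\<Prod>j\<in>J. 1/2)" by (rule prod.cong[OF refl])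
      ultimately show ?thesis by simp
    qed
  qed (use ev in auto)
  then have "indep_sets (\<lambda>i. sigma_sets (space M) (F i)) I"
  proof (rule indep_sets_sigma)
    show "Int_stable (F i)" for i by (auto simp: Int_stable_def F_def)
  qed
  moreover have "{Z i -` A \<inter> space M |A. A \<in> sets (count_space UNIV)} \<subseteq> sigma_sets (space M) (F i)"
    if "i \<in> I" for i
  proof safe
    fix A :: "int set"
    interpret S: sigma_algebra "space M" "sigma_sets (space M) (F i)"
      by (rule sigma_algebra_sigma_sets) (auto simp: F_def)
    have "Z i -` A \<inter> space M = (\<Union>y\<in>A \<inter> {-1,1}. Z i -` {y} \<inter> space M)"
      using fair_signs_range[OF Z that] by auto
    also have "\<dots> \<in> sigma_sets (space M) (F i)"
    proof (rule S.finite_UN)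
      show "Z i -` {y} \<inter> space M \<in> sigma_sets (space M) (F i)" if "y \<in> A \<inter> {-1,1}" for y
      proof (rule sigma_sets.Basic)
        have "y \<in> {-1, 1}" using that by blast
        then show "Z i -` {y} \<inter> space M \<in> F i"
          unfolding F_def by (rule imageI[THEN insertI2])
      qed
    qed simp
    finally show "Z i -` A \<inter> space M \<in> sigma_sets (space M) (F i)" .
  qed
  ultimately show ?thesis
    unfolding indep_vars_def2 using fair_signs_measurable[OF Z]
    by (auto intro: indep_sets_mono_sets)
qed

lemma fair_signs_expectation:
  assumes Z: "fair_signs Z I" and i: "i \<in> I"
  shows "expectation (\<lambda>\<omega>. f (Z i \<omega>)) = (f 1 + f (-1)) / (2::'b::{banach,second_countable_topology,real_normed_field})"
proof -
  have A: "\<P>(\<omega> in M. Z i \<omega> = y) = 1/2" if "y \<in> {-1,1}" for y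
    using fair_signs_cylinder[OF Z, of "{i}" "\<lambda>_. y"] i that by auto
  have ev: "{\<omega>\<in>space M. Z i \<omega> = y} \<in> events" for y
    using measurable_sets[OF fair_signs_measurable[OF Z i], of "{y}"] by (simp add: vimage_def Int_def conj_commute)
  have "expectation (\<lambda>\<omega>. f (Z i \<omega>)) =
     expectation (\<lambda>\<omega>. indicat_real {\<omega>\<in>space M. Z i \<omega> = 1} \<omega> *\<^sub>R f 1 + indicat_real {\<omega>\<in>space M. Z i \<omega> = -1} \<omega> *\<^sub>R f (-1))"
    using fair_signs_range[OF Z i] by (intro Bochner_Integration.integral_cong) (auto simp: indicator_def)
  also have "\<dots> = \<P>(\<omega> in M. Z i \<omega> = 1) *\<^sub>R f 1 + \<P>(\<omega> in M. Z i \<omega> = -1) *\<^sub>R f (-1)"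
    using ev by (subst Bochner_Integration.integral_add) (auto simp: less_top[symmetric])
  also have "\<dots> = (f 1 + f (-1)) / 2"
  proof -
    have "\<P>(\<omega> in M. Z i \<omega> = 1) = 1/2" "\<P>(\<omega> in M. Z i \<omega> = -1) = 1/2"
      using A[of 1] A[of "-1"] by simp_all
    then show ?thesis by (simp only: scaleR_conv_of_real) (simp add: add_divide_distrib)
  qed
  finally show ?thesis .
qed

end

section \<open>Concentration of sums of fair signs\<close>

lemma cosh_le_exp_half_square: "cosh (x::real) \<le> exp (x\<^sup>2 / 2)"
proof -
  have le: "cosh y \<le> exp (y\<^sup>2 / 2)" if "y \<ge> 0" for y :: real
  proof -
    have sc: "sinh z \<le> z * cosh z" if "z \<ge> 0" for z :: real
    proof -
      have "0 * cosh 0 - sinh (0::real) \<le> z * cosh z - sinh z"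
        using that
        by (rule DERIV_nonneg_imp_nondecreasing)
          (auto intro!: exI derivative_eq_intros simp: )
      then show ?thesis by simp
    qed
    have "cosh y * exp (- (y\<^sup>2 / 2)) \<le> cosh 0 * exp (- (0\<^sup>2 / 2))"
    proof (rule DERIV_nonpos_imp_nonincreasing[OF that])
      fix z :: real assume "0 \<le> z" "z \<le> y"
      have "((\<lambda>z. cosh z * exp (- (z\<^sup>2 / 2))) has_real_derivative
          (sinh z - z * cosh z) * exp (- (z\<^sup>2 / 2))) (at z)"
        by (auto intro!: derivative_eq_intros simp: algebra_simps)
      moreover have "(sinh z - z * cosh z) * exp (- (z\<^sup>2 / 2)) \<le> 0"
        using sc[OF \<open>0 \<le> z\<close>] by (simp add: mult_le_0_iff)
      ultimately show "\<exists>d. ((\<lambda>z. cosh z * exp (- (z\<^sup>2 / 2))) has_real_derivative d) (at z) \<and> d \<le> 0"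
        by blast
    qed
    then show ?thesis by (simp add: exp_minus field_simps)
  qed
  show ?thesis using le[of x] le[of "-x"] by (cases "x \<ge> 0") auto
qed


definition walk :: "(nat \<Rightarrow> int) \<Rightarrow> nat \<Rightarrow> int" where
  "walk x n = (\<Sum>k<n. x k)"

lemma walk_0 [simp]: "walk x 0 = 0" and walk_Suc: "walk x (Suc n) = walk x n + x n"
  by (simp_all add: walk_def)

lemma walk_lipschitz:
  assumes "\<And>k. x k \<in> {-1, 1}"
  shows "\<bar>real_of_int (walk x i - walk x j)\<bar> \<le> \<bar>real i - real j\<bar>"
proof -
  have main: "\<bar>real_of_int (walk x i - walk x j)\<bar> \<le> \<bar>real i - real j\<bar>" if "j \<le> i" for i j
  proof -
    have "walk x i - walk x j = (\<Sum>k=j..<i. x k)"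
      using that by (simp add: walk_def lessThan_atLeast0 sum_diff_nat_ivl)
    moreover have "\<bar>\<Sum>k=j..<i. x k\<bar> \<le> (\<Sum>k=j..<i. 1)"
    proof (intro order_trans[OF sum_abs] sum_mono)
      show "\<bar>x k\<bar> \<le> 1" for k using assms[of k] by auto
    qed
    ultimately have "\<bar>walk x i - walk x j\<bar> \<le> int i - int j" using that by simp
    then have "\<bar>real_of_int (walk x i - walk x j)\<bar> \<le> real_of_int (int i - int j)"
      by (simp only: of_int_abs[symmetric] of_int_le_iff)
    then show ?thesis by simp
  qed
  show ?thesis
    using main[of i j] main[of j i] by (cases "j \<le> i") (auto simp: abs_minus_commute)
qed

context prob_space begin

text \<open>The sums considered here are martingale transforms: the multiplier \<open>h k\<close> looks only at the signs before
\<open>k\<close>. As a sign satisfies \<open>exp (l * h * s) = cosh (l * h) + s * sinh (l * h)\<close>, the last factor can be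
averaged out, which costs at most \<open>exp (l\<^sup>2 * b\<^sup>2 / 2)\<close> for each summand.\<close>

lemma fair_signs_mgf:
  fixes X :: "nat \<Rightarrow> 'a \<Rightarrow> int" and h :: "nat \<Rightarrow> (nat \<Rightarrow> int) \<Rightarrow> real"
  assumes X: "fair_signs X UNIV"
    and pred: "\<And>k x y. (\<And>i. i < k \<Longrightarrow> x i = y i) \<Longrightarrow> h k x = h k y"
    and bound: "\<And>k x. \<bar>h k x\<bar> \<le> b"
  defines "S n x \<equiv> \<Sum>k<n. h k x * real_of_int (x k)"
  shows "integrable M (\<lambda>\<omega>. exp (l * S n (\<lambda>i. X i \<omega>)))"
    and "expectation (\<lambda>\<omega>. exp (l * S n (\<lambda>i. X i \<omega>))) \<le> exp (l\<^sup>2 * b\<^sup>2 * n / 2)"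
proof -
  have b0: "0 \<le> b" using bound[of 0 "\<lambda>_. 0"] by linarith
  have depS: "S n x = S n y" if xy: "\<And>i. i < n \<Longrightarrow> x i = y i" for n x y
  proof -
    have "h k x * real_of_int (x k) = h k y * real_of_int (y k)" if "k < n" for k
      using pred[of k x y] xy that by simp
    then show ?thesis unfolding S_def by simp
  qed
  have meas: "(\<lambda>\<omega>. G (\<lambda>i. X i \<omega>)) \<in> borel_measurable M"
    if G: "\<And>x y. (\<And>i. i < n \<Longrightarrow> x i = y i) \<Longrightarrow> G x = G y" for G :: "_ \<Rightarrow> real" and n
  proof (rule measurable_finite_dependence[of "{..<n}" X])
    show "G (\<lambda>i. X i \<omega>) = G (\<lambda>i. X i \<omega>')" if "\<And>i. i \<in> {..<n} \<Longrightarrow> X i \<omega> = X i \<omega>'" for \<omega> \<omega>'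
      by (rule G) (rule that, simp)
  qed (use fair_signs_measurable[OF X] in auto)
  have bS: "\<bar>S n (\<lambda>i. X i \<omega>)\<bar> \<le> b * n" if "\<omega> \<in> space M" for \<omega> n
  proof -
    have "\<bar>S n (\<lambda>i. X i \<omega>)\<bar> \<le> (\<Sum>k<n. b * 1)"
      unfolding S_def
    proof (intro order_trans[OF sum_abs] sum_mono)
      fix k
      have "\<bar>real_of_int (X k \<omega>)\<bar> = 1" using fair_signs_range[OF X UNIV_I that, of k] by auto
      then show "\<bar>h k (\<lambda>i. X i \<omega>) * real_of_int (X k \<omega>)\<bar> \<le> b * 1"
        using bound[of k "\<lambda>i. X i \<omega>"] by (simp add: abs_mult)
    qed
    then show ?thesis by (simp add: mult.commute)
  qed
  have int_bounded: "integrable M (\<lambda>\<omega>. G (\<lambda>i. X i \<omega>))"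
    if G: "\<And>x y. (\<And>i. i < n \<Longrightarrow> x i = y i) \<Longrightarrow> G x = G y" and c: "\<And>\<omega>. \<omega> \<in> space M \<Longrightarrow> \<bar>G (\<lambda>i. X i \<omega>)\<bar> \<le> c"
    for G :: "_ \<Rightarrow> real" and n c
  proof (rule integrable_const_bound[of _ c])
    show "(\<lambda>\<omega>. G (\<lambda>i. X i \<omega>)) \<in> borel_measurable M" by (rule meas[of n]) (rule G)
  qed (use c in auto)
  have expb: "\<bar>exp (l * S n (\<lambda>i. X i \<omega>))\<bar> \<le> exp (\<bar>l\<bar> * (b * n))" if "\<omega> \<in> space M" for \<omega> n l
  proof -
    have "l * S n (\<lambda>i. X i \<omega>) \<le> \<bar>l\<bar> * \<bar>S n (\<lambda>i. X i \<omega>)\<bar>" by (metis abs_ge_self abs_mult)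
    also have "\<dots> \<le> \<bar>l\<bar> * (b * n)" using bS[OF that] by (intro mult_left_mono) auto
    finally show ?thesis by simp
  qed
  have hl: "\<bar>l * h n x\<bar> \<le> \<bar>l\<bar> * b" for n x l
    using bound by (simp add: abs_mult mult_left_mono)
  show int: "integrable M (\<lambda>\<omega>. exp (l * S n (\<lambda>i. X i \<omega>)))" for n
  proof (rule int_bounded[of n "\<lambda>x. exp (l * S n x)"])
    show "exp (l * S n x) = exp (l * S n y)" if "\<And>i. i < n \<Longrightarrow> x i = y i" for x y
      using depS[of n x y] that by simp
  qed (rule expb)
  show "expectation (\<lambda>\<omega>. exp (l * S n (\<lambda>i. X i \<omega>))) \<le> exp (l\<^sup>2 * b\<^sup>2 * n / 2)"
  proof (induction n)
    case 0
    then show ?case by (simp add: S_def prob_space)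
  next
    case (Suc n)
    define C where "C x = exp (l * S n x) * cosh (l * h n x)" for x
    define D where "D x = exp (l * S n x) * sinh (l * h n x)" for x
    have dC: "C x = C y" and dD: "D x = D y" if "\<And>i. i < n \<Longrightarrow> x i = y i" for x y
      using depS[of n x y] pred[of n x y] that by (simp_all add: C_def D_def)
    have cb: "\<bar>cosh (l * h n x)\<bar> \<le> cosh (\<bar>l\<bar> * b)" "\<bar>sinh (l * h n x)\<bar> \<le> cosh (\<bar>l\<bar> * b)" for x
    proof -
      have 1: "\<bar>cosh (l * h n x)\<bar> \<le> cosh (\<bar>l\<bar> * b)"
        using hl[of l n x] b0 cosh_real_nonneg_le_iff[of "\<bar>l * h n x\<bar>" "\<bar>l\<bar> * b"] by auto
      moreover have "\<bar>sinh y\<bar> \<le> \<bar>cosh y\<bar>" for y :: real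
        using sinh_square_eq[of y] by (intro abs_le_square_iff[THEN iffD2]) simp
      ultimately show "\<bar>cosh (l * h n x)\<bar> \<le> cosh (\<bar>l\<bar> * b)" "\<bar>sinh (l * h n x)\<bar> \<le> cosh (\<bar>l\<bar> * b)"
        using order_trans by blast+
    qed
    have iC: "integrable M (\<lambda>\<omega>. C (\<lambda>i. X i \<omega>))"
    proof (rule int_bounded[of n C "exp (\<bar>l\<bar> * (b * n)) * cosh (\<bar>l\<bar> * b)"])
      show "C x = C y" if "\<And>i. i < n \<Longrightarrow> x i = y i" for x y by (rule dC) (rule that)
      show "\<bar>C (\<lambda>i. X i \<omega>)\<bar> \<le> exp (\<bar>l\<bar> * (b * n)) * cosh (\<bar>l\<bar> * b)" if "\<omega> \<in> space M" for \<omega>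
        unfolding C_def abs_mult using expb[OF that, of l n] cb(1) by (intro mult_mono) auto
    qed
    have iD: "integrable M (\<lambda>\<omega>. D (\<lambda>i. X i \<omega>))"
    proof (rule int_bounded[of n D "exp (\<bar>l\<bar> * (b * n)) * cosh (\<bar>l\<bar> * b)"])
      show "D x = D y" if "\<And>i. i < n \<Longrightarrow> x i = y i" for x y by (rule dD) (rule that)
      show "\<bar>D (\<lambda>i. X i \<omega>)\<bar> \<le> exp (\<bar>l\<bar> * (b * n)) * cosh (\<bar>l\<bar> * b)" if "\<omega> \<in> space M" for \<omega>
        unfolding D_def abs_mult using expb[OF that, of l n] cb(2) by (intro mult_mono) auto
    qed
    have ind: "indep_var borel (\<lambda>\<omega>. D (\<lambda>i. X i \<omega>)) borel (\<lambda>\<omega>. real_of_int (X n \<omega>))"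
    proof -
      have "indep_var borel ((\<lambda>x. D x) \<circ> (\<lambda>\<omega>. restrict (\<lambda>i. X i \<omega>) {..<n}))
          borel ((\<lambda>x. real_of_int (x n)) \<circ> (\<lambda>\<omega>. restrict (\<lambda>i. X i \<omega>) {n}))"
      proof (rule indep_var_compose[OF indep_var_restrict[OF fair_signs_indep[OF X]]])
        show "D \<in> borel_measurable (Pi\<^sub>M {..<n} (\<lambda>_. count_space UNIV))"
        proof (rule measurable_finite_dependence[of "{..<n}" "\<lambda>i x. x i"])
          show "D x = D y" if "\<And>i. i \<in> {..<n} \<Longrightarrow> x i = y i" for x y by (rule dD) (rule that, simp)
        qed auto
      qed auto
      moreover have "D (restrict (\<lambda>i. X i \<omega>) {..<n}) = D (\<lambda>i. X i \<omega>)" for \<omega>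
        by (rule dD) auto
      ultimately show ?thesis by (simp add: o_def)
    qed
    have Xn: "integrable M (\<lambda>\<omega>. real_of_int (X n \<omega>))"
    proof (rule integrable_const_bound[of _ 1])
      show "(\<lambda>\<omega>. real_of_int (X n \<omega>)) \<in> borel_measurable M"
        using meas[of "Suc n" "\<lambda>x. real_of_int (x n)"] by simp
      show "AE \<omega> in M. norm (real_of_int (X n \<omega>)) \<le> 1"
      proof (rule AE_I2)
        show "norm (real_of_int (X n \<omega>)) \<le> 1" if "\<omega> \<in> space M" for \<omega>
          using fair_signs_range[OF X UNIV_I that, of n] by auto
      qed
    qed
    have EX: "expectation (\<lambda>\<omega>. real_of_int (X n \<omega>)) = 0"
      using fair_signs_expectation[OF X, of n real_of_int] by simp
    have eq: "exp (l * S (Suc n) (\<lambda>i. X i \<omega>)) = C (\<lambda>i. X i \<omega>) + D (\<lambda>i. X i \<omega>) * real_of_int (X n \<omega>)"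
      if "\<omega> \<in> space M" for \<omega>
    proof -
      let ?x = "\<lambda>i. X i \<omega>"
      have "exp (l * S (Suc n) ?x) = exp (l * S n ?x) * exp (l * h n ?x * X n \<omega>)"
        by (simp add: S_def algebra_simps exp_add)
      also have "exp (l * h n ?x * X n \<omega>) = cosh (l * h n ?x) + sinh (l * h n ?x) * X n \<omega>"
        using fair_signs_range[OF X _ that, of n] by (auto simp: cosh_plus_sinh cosh_minus_sinh)
      finally show ?thesis by (simp add: C_def D_def algebra_simps)
    qed
    have "expectation (\<lambda>\<omega>. exp (l * S (Suc n) (\<lambda>i. X i \<omega>))) =
        expectation (\<lambda>\<omega>. C (\<lambda>i. X i \<omega>) + D (\<lambda>i. X i \<omega>) * real_of_int (X n \<omega>))"
      by (intro Bochner_Integration.integral_cong eq) auto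
    also have "\<dots> = expectation (\<lambda>\<omega>. C (\<lambda>i. X i \<omega>))"
      using indep_var_lebesgue_integral[OF ind iD Xn] indep_var_integrable[OF ind iD Xn] iC EX
      by (subst Bochner_Integration.integral_add) auto
    also have "\<dots> \<le> expectation (\<lambda>\<omega>. exp (l\<^sup>2 * b\<^sup>2 / 2) * exp (l * S n (\<lambda>i. X i \<omega>)))"
    proof (rule integral_mono[OF iC])
      fix \<omega> assume "\<omega> \<in> space M"
      let ?x = "\<lambda>i. X i \<omega>"
      have "cosh (l * h n ?x) \<le> exp ((l * h n ?x)\<^sup>2 / 2)" by (rule cosh_le_exp_half_square)
      also have "(l * h n ?x)\<^sup>2 \<le> (\<bar>l\<bar> * b)\<^sup>2" using hl[of l n ?x] by (metis abs_ge_zero power2_abs power_mono)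
      then have "exp ((l * h n ?x)\<^sup>2 / 2) \<le> exp (l\<^sup>2 * b\<^sup>2 / 2)" by (simp add: power_mult_distrib)
      finally show "C ?x \<le> exp (l\<^sup>2 * b\<^sup>2 / 2) * exp (l * S n ?x)"
        by (simp add: C_def mult.commute)
    qed (use int in simp)
    also have "\<dots> = exp (l\<^sup>2 * b\<^sup>2 / 2) * expectation (\<lambda>\<omega>. exp (l * S n (\<lambda>i. X i \<omega>)))" by simp
    also have "\<dots> \<le> exp (l\<^sup>2 * b\<^sup>2 / 2) * exp (l\<^sup>2 * b\<^sup>2 * n / 2)" by (intro mult_left_mono Suc.IH) auto
    also have "\<dots> = exp (l\<^sup>2 * b\<^sup>2 * Suc n / 2)" by (simp add: exp_add[symmetric] algebra_simps add_divide_distrib)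
    finally show ?case .
  qed
qed

text \<open>The Azuma--Hoeffding inequality, by Markov's inequality for the exponential with the optimal parameter.
A bounded predictable multiplier is needed for the occupation time, the multiplier 1 for the walk itself.\<close>

lemma fair_signs_azuma:
  fixes X :: "nat \<Rightarrow> 'a \<Rightarrow> int" and h :: "nat \<Rightarrow> (nat \<Rightarrow> int) \<Rightarrow> real"
  assumes X: "fair_signs X UNIV"
    and pred: "\<And>k x y. (\<And>i. i < k \<Longrightarrow> x i = y i) \<Longrightarrow> h k x = h k y"
    and bound: "\<And>k x. \<bar>h k x\<bar> \<le> b" and "0 < b" "0 \<le> r"
  shows "{\<omega> \<in> space M. r * b * sqrt n < \<bar>\<Sum>k<n. h k (\<lambda>i. X i \<omega>) * real_of_int (X k \<omega>)\<bar>} \<in> events" (is "?A \<in> _")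
    and "\<P>(\<omega> in M. r * b * sqrt n < \<bar>\<Sum>k<n. h k (\<lambda>i. X i \<omega>) * real_of_int (X k \<omega>)\<bar>) \<le> 2 * exp (- (r\<^sup>2) / 2)"
proof -
  define S where "S g \<omega> = (\<Sum>k<n. g k (\<lambda>i. X i \<omega>) * real_of_int (X k \<omega>))"
    for g :: "nat \<Rightarrow> (nat \<Rightarrow> int) \<Rightarrow> real" and \<omega>
  have meas: "S g \<in> borel_measurable M" if "\<And>k x y. (\<And>i. i < k \<Longrightarrow> x i = y i) \<Longrightarrow> g k x = g k y" for g
  proof (rule measurable_finite_dependence[of "{..<n}" X])
    fix \<omega> \<omega>' assume eq: "\<And>i. i \<in> {..<n} \<Longrightarrow> X i \<omega> = X i \<omega>'"
    have "g k (\<lambda>i. X i \<omega>) * real_of_int (X k \<omega>) = g k (\<lambda>i. X i \<omega>') * real_of_int (X k \<omega>')" if "k < n" for k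
      using \<open>\<And>k x y. (\<And>i. i < k \<Longrightarrow> x i = y i) \<Longrightarrow> g k x = g k y\<close>[of k "\<lambda>i. X i \<omega>" "\<lambda>i. X i \<omega>'"] eq that by simp
    then show "S g \<omega> = S g \<omega>'" unfolding S_def by simp
  qed (use fair_signs_measurable[OF X] in auto)
  have mh: "S h \<in> borel_measurable M" by (rule meas) (rule pred)
  have mh': "S (\<lambda>k x. - h k x) \<in> borel_measurable M"
  proof (rule meas)
    show "- h k x = - h k y" if "\<And>i. i < k \<Longrightarrow> x i = y i" for k x y using pred[of k x y] that by simp
  qed
  show ev: "?A \<in> events"
    using mh unfolding S_def by measurable
  show "prob ?A \<le> 2 * exp (- (r\<^sup>2) / 2)"
  proof (cases "n = 0")
    case False
    have tail: "\<P>(\<omega> in M. r * b * sqrt n \<le> S g \<omega>) \<le> exp (- (r\<^sup>2) / 2)"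
      if pred: "\<And>k x y. (\<And>i. i < k \<Longrightarrow> x i = y i) \<Longrightarrow> g k x = g k y" and bound: "\<And>k x. \<bar>g k x\<bar> \<le> b" for g
    proof (cases "r = 0")
      case False
      with \<open>0 \<le> r\<close> have "0 < r" by simp
      \<comment> \<open>this \<open>l\<close> minimises \<open>l\<^sup>2 * b\<^sup>2 * n / 2 - l * r * b * sqrt n\<close>\<close>
      define l where "l = r / (b * sqrt n)"
      have "0 < l" using \<open>0 < r\<close> \<open>0 < b\<close> \<open>n \<noteq> 0\<close> by (simp add: l_def)
      have mS[measurable]: "S g \<in> borel_measurable M" by (rule meas) (rule pred)
      have "\<P>(\<omega> in M. r * b * sqrt n \<le> S g \<omega>) = \<P>(\<omega> in M. exp (l * (r * b * sqrt n)) \<le> exp (l * S g \<omega>))"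
        using \<open>0 < l\<close> by (simp add: mult.assoc)
      also have "\<dots> \<le> expectation (\<lambda>\<omega>. exp (l * S g \<omega>)) / exp (l * (r * b * sqrt n))"
        using fair_signs_mgf(1)[where h=g, OF X pred bound, of l n]
        by (intro integral_Markov_inequality_measure[where A="{}"]) (auto simp: S_def)
      also have "\<dots> \<le> exp (l\<^sup>2 * b\<^sup>2 * n / 2) / exp (l * (r * b * sqrt n))"
        using fair_signs_mgf(2)[where h=g, OF X pred bound, of l n]
        by (intro divide_right_mono) (auto simp: S_def)
      also have "\<dots> = exp (l\<^sup>2 * b\<^sup>2 * n / 2 - l * (r * b * sqrt n))" by (simp add: exp_diff)
      also have "l\<^sup>2 * b\<^sup>2 * n / 2 - l * (r * b * sqrt n) = - (r\<^sup>2) / 2"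
        using \<open>0 < b\<close> \<open>n \<noteq> 0\<close> by (simp add: l_def power_divide power_mult_distrib) (simp add: power2_eq_square)
      finally show ?thesis .
    qed simp
    have "?A \<subseteq> {\<omega>\<in>space M. r * b * sqrt n \<le> S h \<omega>} \<union> {\<omega>\<in>space M. r * b * sqrt n \<le> S (\<lambda>k x. - h k x) \<omega>}"
      by (auto simp: S_def sum_negf)
    moreover have "{\<omega>\<in>space M. r * b * sqrt n \<le> S h \<omega>} \<in> events"
      "{\<omega>\<in>space M. r * b * sqrt n \<le> S (\<lambda>k x. - h k x) \<omega>} \<in> events"
      using mh mh' by (auto simp: borel_measurable_iff_ge)
    ultimately have "prob ?A \<le> \<P>(\<omega> in M. r * b * sqrt n \<le> S h \<omega>) + \<P>(\<omega> in M. r * b * sqrt n \<le> S (\<lambda>k x. - h k x) \<omega>)"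
      by (intro order_trans[OF finite_measure_mono measure_Un_le]) auto
    also have "\<dots> \<le> exp (- (r\<^sup>2) / 2) + exp (- (r\<^sup>2) / 2)"
    proof (rule add_mono)
      show "\<P>(\<omega> in M. r * b * sqrt n \<le> S h \<omega>) \<le> exp (- (r\<^sup>2) / 2)"
        by (rule tail[OF pred bound])
      show "\<P>(\<omega> in M. r * b * sqrt n \<le> S (\<lambda>k x. - h k x) \<omega>) \<le> exp (- (r\<^sup>2) / 2)"
      proof (rule tail)
        show "- h k x = - h k y" if "\<And>i. i < k \<Longrightarrow> x i = y i" for k x y
          using pred[of k x y] that by simp
        show "\<bar>- h k x\<bar> \<le> b" for k x using bound by simp
      qed
    qed
    finally show ?thesis by simp
  qed simp
qed

text \<open>Borel--Cantelli for stretched exponential tails. The polynomial number of exceptional events is chosen so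
that the triples of a refinement level and two times, all at most \<open>n\<close>, are covered.\<close>

lemma AE_eventually_avoid:
  fixes T :: "nat \<Rightarrow> 'b set"
  assumes "0 < e" and T: "\<And>n. finite (T n)" "\<And>n. card (T n) \<le> (n + 1) ^ 3"
    and ev: "\<And>n a. a \<in> T n \<Longrightarrow> {\<omega> \<in> space M. bad n a \<omega>} \<in> events"
    and pr: "\<And>n a. a \<in> T n \<Longrightarrow> \<P>(\<omega> in M. bad n a \<omega>) \<le> 2 * exp (- ((real n powr e)\<^sup>2) / 2)"
  shows "AE \<omega> in M. \<forall>\<^sub>F n in sequentially. \<forall>a\<in>T n. \<not> bad n a \<omega>"
proof -
  define A where "A n = (\<Union>a\<in>T n. {\<omega> \<in> space M. bad n a \<omega>})" for n
  define q where "q n = (real n + 1) ^ 3 * (2 * exp (- ((real n powr e)\<^sup>2) / 2))" for n :: nat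
  have Aev: "A n \<in> events" for n unfolding A_def using T ev by auto
  have "prob (A n) \<le> q n" for n
  proof -
    have "prob (A n) \<le> (\<Sum>a\<in>T n. \<P>(\<omega> in M. bad n a \<omega>))"
      unfolding A_def using T ev by (intro finite_measure_subadditive_finite) auto
    also have "\<dots> \<le> real (card (T n)) * (2 * exp (- ((real n powr e)\<^sup>2) / 2))"
      using pr by (intro sum_bounded_above) auto
    also have "\<dots> \<le> real ((n + 1) ^ 3) * (2 * exp (- ((real n powr e)\<^sup>2) / 2))"
      using T(2)[of n] by (intro mult_right_mono of_nat_mono) auto
    finally show ?thesis by (simp add: q_def add.commute)
  qed
  moreover have "summable q"
  proof (rule summable_comparison_test_ev)
    have "\<forall>\<^sub>F n in sequentially. q n \<le> 1 / real n ^ 2"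
      unfolding q_def using \<open>0 < e\<close> by real_asymp
    then show "\<forall>\<^sub>F n in sequentially. norm (q n) \<le> 1 / real n ^ 2"
      by eventually_elim (simp add: q_def)
    show "summable (\<lambda>n. 1 / real n ^ 2)"
      using inverse_power_summable[of 2, where 'a=real] by (simp add: divide_inverse)
  qed
  ultimately have "summable (\<lambda>n. prob (A n))"
    by (intro summable_comparison_test[of "\<lambda>n. prob (A n)" q]) (auto intro!: exI[of _ 0])
  then have "AE \<omega> in M. \<forall>\<^sub>F n in sequentially. \<omega> \<in> space M - A n"
    by (intro borel_cantelli_AE1 Aev) (auto simp: less_top[symmetric])
  then show ?thesis
    by eventually_elim (auto elim!: eventually_mono simp: A_def)
qed

lemma fair_walk_increment:
  assumes X: "fair_signs X (UNIV :: nat set)" and "0 \<le> r"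
  shows "{\<omega> \<in> space M. r * sqrt \<bar>real i - real j\<bar> < \<bar>real_of_int (walk (\<lambda>k. X k \<omega>) i - walk (\<lambda>k. X k \<omega>) j)\<bar>} \<in> events \<and>
    \<P>(\<omega> in M. r * sqrt \<bar>real i - real j\<bar> < \<bar>real_of_int (walk (\<lambda>k. X k \<omega>) i - walk (\<lambda>k. X k \<omega>) j)\<bar>)
      \<le> 2 * exp (- (r\<^sup>2) / 2)" (is "?P i j")
proof -
  have main: "?P i j" if "j \<le> i" for i j
  proof -
    have X': "fair_signs (\<lambda>k. X (j + k)) UNIV"
      by (rule fair_signs_reindex[OF X]) (auto simp: inj_on_def)
    have "walk x i - walk x j = (\<Sum>k<i-j. x (j + k))" for x
      using \<open>j \<le> i\<close> sum.atLeastLessThan_shift_0[of x j i]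
      by (simp add: walk_def lessThan_atLeast0 sum_diff_nat_ivl add.commute)
    moreover have "real (i - j) = \<bar>real i - real j\<bar>" using \<open>j \<le> i\<close> by simp
    ultimately show ?thesis
      using fair_signs_azuma[OF X', where h="\<lambda>_ _. 1" and b=1 and r=r and n="i-j", OF refl _ _ \<open>0 \<le> r\<close>]
      by simp
  qed
  show ?thesis
  proof (cases "j \<le> i")
    case False
    then have "?P j i" by (intro main) simp
    then show ?thesis by (simp add: abs_minus_commute)
  qed (rule main)
qed

text \<open>Almost surely, simple random walks have modulus of continuity \<open>sqrt d\<close> over time gaps \<open>d\<close>, up to a factor
\<open>N powr e\<close>. Uniformity in the index \<open>m \<le> N\<close> and in the two times comes from a union bound, which is affordable because the
tails decay faster than any power.\<close>

lemma fair_walks_modulus: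
  assumes Y: "\<And>m::nat. fair_signs (Y m) (UNIV :: nat set)" and "0 < e"
  shows "AE \<omega> in M. \<exists>K\<ge>1. \<forall>N\<ge>1. \<forall>m\<le>N. \<forall>i\<le>N. \<forall>j\<le>N.
    \<bar>real_of_int (walk (\<lambda>k. Y m k \<omega>) i) - real_of_int (walk (\<lambda>k. Y m k \<omega>) j)\<bar>
      \<le> K * real N powr e * sqrt \<bar>real i - real j\<bar>"
proof -
  define T where "T n = {..n} \<times> {..n} \<times> {..n::nat}" for n
  let ?d = "\<lambda>m i j \<omega>. \<bar>real_of_int (walk (\<lambda>k. Y m k \<omega>) i - walk (\<lambda>k. Y m k \<omega>) j)\<bar>"
  define bad where "bad n a \<omega> \<longleftrightarrow> real n powr e * sqrt \<bar>real (fst (snd a)) - real (snd (snd a))\<bar> < ?d (fst a) (fst (snd a)) (snd (snd a)) \<omega>"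
    for n :: nat and a \<omega>
  have "AE \<omega> in M. \<forall>\<^sub>F n in sequentially. \<forall>a\<in>T n. \<not> bad n a \<omega>"
  proof (rule AE_eventually_avoid[OF \<open>0 < e\<close>])
    fix n a assume "a \<in> T n"
    show "{\<omega> \<in> space M. bad n a \<omega>} \<in> events"
      unfolding bad_def by (rule conjunct1[OF fair_walk_increment[OF Y]]) simp
    show "\<P>(\<omega> in M. bad n a \<omega>) \<le> 2 * exp (- ((real n powr e)\<^sup>2) / 2)"
      unfolding bad_def by (rule conjunct2[OF fair_walk_increment[OF Y]]) simp
  qed (auto simp: T_def card_cartesian_product power3_eq_cube)
  then show ?thesis
  proof (rule AE_mp, intro AE_I2 impI)
    fix \<omega> assume \<omega>: "\<omega> \<in> space M"
    assume "\<forall>\<^sub>F n in sequentially. \<forall>a\<in>T n. \<not> bad n a \<omega>"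
    then obtain N0 where N0': "\<And>n a. n \<ge> N0 \<Longrightarrow> a \<in> T n \<Longrightarrow> \<not> bad n a \<omega>"
      by (auto simp: eventually_sequentially)
    have N0: "?d m i j \<omega> \<le> real n powr e * sqrt \<bar>real i - real j\<bar>"
      if "n \<ge> N0" "m \<le> n" "i \<le> n" "j \<le> n" for n m i j
      using N0'[of n "(m, i, j)"] that by (simp add: T_def bad_def)
    have triv: "?d m i j \<omega> \<le> \<bar>real i - real j\<bar>" for m i j
      by (rule walk_lipschitz) (rule fair_signs_range[OF Y UNIV_I \<omega>])
    \<comment> \<open>below \<open>N0\<close> the Lipschitz bound suffices, since \<open>d \<le> sqrt N0 * sqrt d\<close> for \<open>d \<le> N0\<close>\<close>
    define K where "K = max 1 (sqrt N0)"
    have "\<bar>real_of_int (walk (\<lambda>k. Y m k \<omega>) i) - real_of_int (walk (\<lambda>k. Y m k \<omega>) j)\<bar>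
        \<le> K * real N powr e * sqrt \<bar>real i - real j\<bar>" if "N \<ge> 1" "m \<le> N" "i \<le> N" "j \<le> N" for N m i j
    proof -
      have "1 \<le> K" by (simp add: K_def)
      have "1 \<le> real N powr e" using that \<open>0 < e\<close> by (simp add: ge_one_powr_ge_zero)
      have "?d m i j \<omega> \<le> K * real N powr e * sqrt \<bar>real i - real j\<bar>"
      proof (cases "N \<ge> N0")
        case True
        have "?d m i j \<omega> \<le> 1 * (real N powr e * sqrt \<bar>real i - real j\<bar>)" using N0[OF True that(2-)] by simp
        also have "\<dots> \<le> K * (real N powr e * sqrt \<bar>real i - real j\<bar>)"
          using \<open>1 \<le> K\<close> by (intro mult_right_mono) auto
        finally show ?thesis by (simp add: mult.assoc)
      next
        case False
        have "?d m i j \<omega> \<le> sqrt \<bar>real i - real j\<bar> * sqrt \<bar>real i - real j\<bar>" using triv by simp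
        also have "\<dots> \<le> sqrt N0 * sqrt \<bar>real i - real j\<bar>"
          using False that by (intro mult_right_mono) auto
        also have "\<dots> \<le> (K * real N powr e) * sqrt \<bar>real i - real j\<bar>"
        proof (intro mult_right_mono)
          have "sqrt N0 \<le> K * 1" by (simp add: K_def)
          also have "\<dots> \<le> K * real N powr e" using \<open>1 \<le> K\<close> \<open>1 \<le> real N powr e\<close> by (intro mult_left_mono) auto
          finally show "sqrt N0 \<le> K * real N powr e" .
        qed auto
        finally show ?thesis .
      qed
      then show ?thesis by simp
    qed
    then show "\<exists>K\<ge>1. \<forall>N\<ge>1. \<forall>m\<le>N. \<forall>i\<le>N. \<forall>j\<le>N.
      \<bar>real_of_int (walk (\<lambda>k. Y m k \<omega>) i) - real_of_int (walk (\<lambda>k. Y m k \<omega>) j)\<bar>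
      \<le> K * real N powr e * sqrt \<bar>real i - real j\<bar>"
      by (intro exI[of _ K]) (auto simp: K_def)
  qed
qed

end

section \<open>Refining a simple random walk\<close>

definition successes :: "(nat \<Rightarrow> int) \<Rightarrow> nat \<Rightarrow> nat" where
  "successes e j = card {i. i < j \<and> e i = 1}"

text \<open>A walk \<open>x\<close> is refined by inserting pairs of opposite steps. The pair number \<open>j\<close> of the new walk is
\<open>(s, s * e j)\<close>: if \<open>e j = 1\<close> it repeats the next unused step of \<open>x\<close> twice, otherwise it is an excursion whose
first step is \<open>f j\<close>. At even times the new walk is thus twice the old walk, run with the clock
\<open>successes e\<close> (\<open>walk_refine\<close>), and this clock has speed 1/2 on average.\<close>

definition refine :: "(nat \<Rightarrow> int) \<Rightarrow> (nat \<Rightarrow> int) \<Rightarrow> (nat \<Rightarrow> int) \<Rightarrow> nat \<Rightarrow> int" where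
  "refine x e f k = (let j = k div 2; s = (if e j = 1 then x (successes e j) else f j)
     in if even k then s else s * e j)"

lemma successes_0 [simp]: "successes e 0 = 0"
  by (simp add: successes_def)

lemma successes_Suc: "successes e (Suc j) = successes e j + (if e j = 1 then 1 else 0)"
proof -
  have "{i. i < Suc j \<and> e i = 1} = (if e j = 1 then insert j {i. i < j \<and> e i = 1} else {i. i < j \<and> e i = 1})"
    by (auto simp: less_Suc_eq)
  then show ?thesis by (simp add: successes_def)
qed

lemma successes_le: "successes e j \<le> j"
  by (induction j) (auto simp: successes_Suc)

lemma successes_mono: "i \<le> j \<Longrightarrow> successes e i \<le> successes e j"
  unfolding successes_def by (rule card_mono) auto

lemma successes_cong: "(\<And>i. i < j \<Longrightarrow> e i = e' i) \<Longrightarrow> successes e j = successes e' j"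
  unfolding successes_def by (rule arg_cong[of _ _ card]) auto

lemma inj_on_successes: "inj_on (successes e) {j. e j = 1}"
proof (rule linorder_inj_onI)
  fix i j assume "i < j" "i \<in> {j. e j = 1}"
  then have "successes e i < successes e (Suc i)" by (simp add: successes_Suc)
  also have "\<dots> \<le> successes e j" using \<open>i < j\<close> by (intro successes_mono) simp
  finally show "successes e i \<noteq> successes e j" by simp
qed auto

lemma walk_successes:
  assumes "\<And>j. e j \<in> {-1, 1}"
  shows "walk e j = 2 * int (successes e j) - int j"
proof (induction j)
  case (Suc j)
  then show ?case using assms[of j] by (auto simp: walk_Suc successes_Suc)
qed simp

lemma walk_refine:
  assumes "\<And>j. e j \<in> {-1, 1}"
  shows "walk (refine x e f) (2 * j) = 2 * walk x (successes e j)"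
proof (induction j)
  case (Suc j)
  have "walk (refine x e f) (2 * Suc j) = walk (refine x e f) (2 * j) + (refine x e f (2 * j) + refine x e f (2 * j + 1))"
    by (simp add: walk_Suc)
  also have "refine x e f (2 * j) + refine x e f (2 * j + 1) = (if e j = 1 then 2 * x (successes e j) else 0)"
    using assms[of j] by (auto simp: refine_def)
  finally show ?case using Suc by (simp add: successes_Suc walk_Suc)
qed simp

lemma refine_cong:
  assumes "\<And>i. i \<le> k \<Longrightarrow> x i = x' i \<and> e i = e' i \<and> f i = f' i"
  shows "refine x e f k = refine x' e' f' k"
proof -
  have s: "successes e (k div 2) = successes e' (k div 2)" using assms by (intro successes_cong) auto
  have "successes e (k div 2) \<le> k" by (rule order_trans[OF successes_le]) simp
  with s show ?thesis using assms[of "k div 2"] assms[of "successes e (k div 2)"] by (simp add: refine_def Let_def)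
qed

lemma refine_sign:
  assumes "\<And>i. x i \<in> {-1, 1} \<and> e i \<in> {-1, 1} \<and> f i \<in> {-1, 1}"
  shows "refine x e f k \<in> {-1, 1}"
  using assms[of "k div 2"] assms[of "successes e (k div 2)"] by (auto simp: refine_def Let_def)

text \<open>A prescribed beginning \<open>y\<close> of the refined walk determines the coins \<open>d\<close>, and with them which entries of
\<open>x\<close> and \<open>f\<close> have been read. So the event is a condition on distinct individual signs.\<close>

lemma refine_eq_iff:
  assumes sgn: "\<And>i. i < n \<Longrightarrow> y (2 * i) \<in> {-1, 1} \<and> y (2 * i + 1) \<in> {-1, 1::int}"
    and e: "\<And>i. e i \<in> {-1, 1}" and f: "\<And>i. f i \<in> {-1, 1}" and x: "\<And>i. x i \<in> {-1, 1}"
  defines "d \<equiv> \<lambda>i. y (2 * i) * y (2 * i + 1)"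
  shows "(\<forall>k<2*n. refine x e f k = y k) \<longleftrightarrow>
    (\<forall>j<n. e j = d j) \<and> (\<forall>j<n. (if d j = 1 then x (successes d j) else f j) = y (2 * j))"
proof -
  define s where "s e j = (if e j = 1 then x (successes e j) else f j)" for e j
  have s01: "s e j \<in> {-1, 1}" for j using f[of j] x[of "successes e j"] by (auto simp: s_def)
  have "(\<forall>k<2*n. refine x e f k = y k) \<longleftrightarrow> (\<forall>j<n. refine x e f (2 * j) = y (2 * j) \<and> refine x e f (2 * j + 1) = y (2 * j + 1))"
  proof safe
    fix k assume "\<forall>j<n. refine x e f (2 * j) = y (2 * j) \<and> refine x e f (2 * j + 1) = y (2 * j + 1)" "k < 2 * n"
    then show "refine x e f k = y k"
      by (cases "even k") (auto elim!: evenE oddE)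
  qed auto
  also have "\<dots> \<longleftrightarrow> (\<forall>j<n. s e j = y (2 * j) \<and> s e j * e j = y (2 * j + 1))"
    by (simp add: refine_def s_def Let_def)
  also have "\<dots> \<longleftrightarrow> (\<forall>j<n. e j = d j \<and> s e j = y (2 * j))"
  proof (intro all_cong1 imp_cong refl)
    fix j assume "j < n"
    then show "(s e j = y (2 * j) \<and> s e j * e j = y (2 * j + 1)) = (e j = d j \<and> s e j = y (2 * j))"
      using s01[of j] e[of j] sgn[of j] by (auto simp: d_def)
  qed
  also have "\<dots> \<longleftrightarrow> (\<forall>j<n. e j = d j) \<and> (\<forall>j<n. s d j = y (2 * j))"
  proof -
    have "s e j = s d j" if "\<forall>j<n. e j = d j" "j < n" for j
    proof -
      have "successes e j = successes d j" using that by (intro successes_cong) auto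
      then show ?thesis using that by (simp add: s_def)
    qed
    then show ?thesis by auto
  qed
  finally show ?thesis by (simp add: s_def)
qed

text \<open>The even rows \<open>2 * m + 2\<close> supply the excursions and the odd rows \<open>2 * m + 1\<close> the coins of the refinement
step \<open>m\<close>; row 0 is the walk to be refined.\<close>

fun level :: "(nat \<times> nat \<Rightarrow> int) \<Rightarrow> nat \<Rightarrow> nat \<Rightarrow> int" where
  "level z 0 = (\<lambda>k. z (0, k))"
| "level z (Suc m) = refine (level z m) (\<lambda>k. z (2 * m + 1, k)) (\<lambda>k. z (2 * m + 2, k))"

lemma level_cong:
  "(\<And>r i. r \<le> 2 * m \<Longrightarrow> i \<le> k \<Longrightarrow> z (r, i) = z' (r, i)) \<Longrightarrow> level z m k = level z' m k"
proof (induction m arbitrary: k)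
  case (Suc m)
  show ?case unfolding level.simps
  proof (rule refine_cong, intro conjI)
    fix i assume "i \<le> k"
    then show "level z m i = level z' m i" using Suc.prems by (intro Suc.IH) auto
    show "z (2 * m + 1, i) = z' (2 * m + 1, i)" "z (2 * m + 2, i) = z' (2 * m + 2, i)"
      using Suc.prems \<open>i \<le> k\<close> by auto
  qed
qed simp

lemma level_sign: "(\<And>p. z p \<in> {-1, 1}) \<Longrightarrow> level z m k \<in> {-1, 1}"
proof (induction m arbitrary: k)
  case (Suc m)
  show ?case unfolding level.simps
    by (intro refine_sign conjI Suc.IH Suc.prems)
qed simp

context prob_space begin

text \<open>A cylinder is the disjoint union of its two extensions by one more sign, so it is enough to know the
probabilities for arbitrarily large finite index sets. For a refined walk this means that only complete pairs of steps
need to be considered.\<close>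

lemma fair_signsI_cofinal:
  assumes rv: "\<And>i. i \<in> I \<Longrightarrow> random_variable (count_space UNIV) (Z i)"
    and rng: "\<And>i \<omega>. i \<in> I \<Longrightarrow> \<omega> \<in> space M \<Longrightarrow> Z i \<omega> \<in> {-1, 1::int}"
    and cof: "\<And>J. finite J \<Longrightarrow> J \<subseteq> I \<Longrightarrow> \<exists>J'. finite J' \<and> J \<subseteq> J' \<and> J' \<subseteq> I \<and>
      (\<forall>y. y \<in> J' \<rightarrow> {-1, 1} \<longrightarrow> \<P>(\<omega> in M. \<forall>j\<in>J'. Z j \<omega> = y j) = (1/2) ^ card J')"
  shows "fair_signs Z I"
proof -
  define P where "P J \<longleftrightarrow> (\<forall>y. y \<in> J \<rightarrow> {-1, 1} \<longrightarrow> \<P>(\<omega> in M. \<forall>j\<in>J. Z j \<omega> = y j) = (1/2) ^ card J)" for J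
  have ev: "{\<omega>\<in>space M. \<forall>j\<in>J. Z j \<omega> = y j} \<in> events" if "finite J" "J \<subseteq> I" for J y
  proof -
    have "{\<omega> \<in> space M. Z i \<omega> = y i} \<in> events" if "i \<in> I" for i
      using measurable_sets[OF rv[OF that], of "{y i}"] by (simp add: vimage_def Int_def conj_commute)
    then show ?thesis using that by (intro sets.sets_Collect_finite_All) auto
  qed
  have shrink: "P J" if "P (insert i J)" "finite J" "insert i J \<subseteq> I" "i \<notin> J" for i J
    unfolding P_def
  proof (intro allI impI)
    fix y :: "_ \<Rightarrow> int" assume y: "y \<in> J \<rightarrow> {-1, 1}"
    define E where "E s = {\<omega>\<in>space M. \<forall>j\<in>insert i J. Z j \<omega> = (y(i := s)) j}" for s
    have pE: "prob (E s) = (1/2) ^ Suc (card J)" if "s \<in> {-1, 1}" for s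
    proof -
      have "y(i := s) \<in> insert i J \<rightarrow> {-1, 1}" using y that by (auto simp: Pi_iff)
      with \<open>P (insert i J)\<close> have "prob (E s) = (1/2) ^ card (insert i J)"
        unfolding P_def E_def by blast
      then show ?thesis using \<open>finite J\<close> \<open>i \<notin> J\<close> by simp
    qed
    have evE: "E s \<in> events" for s unfolding E_def using that by (intro ev) auto
    have "{\<omega>\<in>space M. \<forall>j\<in>J. Z j \<omega> = y j} = E (-1) \<union> E 1"
      using rng[of i] that by (auto simp: E_def)
    also have "prob (E (-1) \<union> E 1) = prob (E (-1)) + prob (E 1)"
      by (rule finite_measure_Union[OF evE evE]) (auto simp: E_def)
    also have "\<dots> = (1/2) ^ card J" by (simp add: pE)
    finally show "\<P>(\<omega> in M. \<forall>j\<in>J. Z j \<omega> = y j) = (1/2) ^ card J" .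
  qed
  have "P J" if "finite J" "J \<subseteq> I" for J
  proof -
    from cof[OF that] obtain J' where J': "finite J'" "J \<subseteq> J'" "J' \<subseteq> I" "P J'" by (auto simp: P_def)
    have "P J" if "finite D" "finite J" "J \<inter> D = {}" "J \<union> D \<subseteq> I" "P (J \<union> D)" for D J
      using that
    proof (induction D rule: finite_induct)
      case (insert d D)
      have "P (J \<union> D)"
      proof (rule shrink)
        show "P (insert d (J \<union> D))" using insert.prems(4) by simp
        show "d \<notin> J \<union> D" "finite (J \<union> D)" "insert d (J \<union> D) \<subseteq> I"
          using insert.prems(1-3) insert.hyps by blast+
      qed
      moreover have "J \<inter> D = {}" "J \<union> D \<subseteq> I" using insert.prems(2,3) by blast+
      ultimately show ?case using insert.prems(1) insert.IH by blast
    qed (simp only: Un_empty_right)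
    from this[of "J' - J" J] show ?thesis using J' that by (simp add: Un_absorb1)
  qed
  then show ?thesis
    using rv rng unfolding fair_signs_def P_def by auto
qed

text \<open>Every step pair of the refined walk reads one coin and one further sign that has not been read before. An
initial segment of length \<open>2 * n\<close> is therefore a cylinder over \<open>2 * n\<close> distinct signs of \<open>Y\<close>. The rows
in \<open>R\<close> are carried along because the next refinements need coins that are independent of the new walk.\<close>

lemma fair_signs_refine:
  fixes Y :: "nat \<times> nat \<Rightarrow> 'a \<Rightarrow> int"
  assumes Y: "fair_signs Y (insert 0 (insert a (insert b R)) \<times> UNIV)"
    and ab: "a \<noteq> 0" "b \<noteq> 0" "a \<noteq> b" "0 \<notin> R" "a \<notin> R" "b \<notin> R"
  shows "fair_signs (\<lambda>(r, k) \<omega>. if r = 0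
      then refine (\<lambda>i. Y (0, i) \<omega>) (\<lambda>i. Y (a, i) \<omega>) (\<lambda>i. Y (b, i) \<omega>) k else Y (r, k) \<omega>)
    (insert 0 R \<times> UNIV)" (is "fair_signs ?Z ?I")
proof (rule fair_signsI_cofinal)
  let ?x = "\<lambda>\<omega> i. Y (0, i) \<omega>" and ?e = "\<lambda>\<omega> i. Y (a, i) \<omega>" and ?f = "\<lambda>\<omega> i. Y (b, i) \<omega>"
  note rngY = fair_signs_range[OF Y]
  fix p assume p: "p \<in> ?I"
  obtain r k where rk: "p = (r, k)" by (cases p)
  show "?Z p \<omega> \<in> {-1, 1}" if "\<omega> \<in> space M" for \<omega>
  proof (cases "r = 0")
    case True
    have "refine (?x \<omega>) (?e \<omega>) (?f \<omega>) k \<in> {-1, 1}"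
      by (rule refine_sign, intro conjI; rule rngY[OF _ that]) auto
    then show ?thesis using True by (simp add: rk)
  next
    case False
    then show ?thesis using rngY[OF _ that, of p] p by (simp add: rk)
  qed
  show "random_variable (count_space UNIV) (?Z p)"
  proof (cases "r = 0")
    case True
    have "(\<lambda>\<omega>. refine (?x \<omega>) (?e \<omega>) (?f \<omega>) k) \<in> measurable M (count_space UNIV)"
    proof (rule measurable_finite_dependence[of "{0, a, b} \<times> {..k}" Y])
      show "Y i \<in> measurable M (count_space UNIV)" if "i \<in> {0, a, b} \<times> {..k}" for i
        using that by (intro fair_signs_measurable[OF Y]) auto
      show "refine (?x \<omega>) (?e \<omega>) (?f \<omega>) k = refine (?x \<omega>') (?e \<omega>') (?f \<omega>') k"
        if "\<And>i. i \<in> {0, a, b} \<times> {..k} \<Longrightarrow> Y i \<omega> = Y i \<omega>'" for \<omega> \<omega>'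
        by (rule refine_cong, intro conjI; rule that) auto
    qed auto
    then show ?thesis using True by (simp add: rk)
  next
    case False
    then show ?thesis using fair_signs_measurable[OF Y, of p] p by (simp add: rk)
  qed
next
  let ?x = "\<lambda>\<omega> i. Y (0, i) \<omega>" and ?e = "\<lambda>\<omega> i. Y (a, i) \<omega>" and ?f = "\<lambda>\<omega> i. Y (b, i) \<omega>"
  note rngY = fair_signs_range[OF Y]
  fix J assume J: "finite J" "J \<subseteq> ?I"
  define n where "n = Suc (Max (insert 0 (snd ` J)))"
  have n: "k < n" if "(r, k) \<in> J" for r k
  proof -
    have "k \<in> insert 0 (snd ` J)" using that by force
    then show ?thesis using J(1) by (simp add: n_def less_Suc_eq_le del: insert_iff)
  qed
  define J1 where "J1 = J \<inter> R \<times> UNIV"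
  define J' where "J' = {0} \<times> {..<2*n} \<union> J1"
  have "finite J1" using J by (simp add: J1_def)
  have disj: "{0::nat} \<times> {..<2*n} \<inter> J1 = {}" "{0, a} \<times> {..<n} \<inter> J1 = {}" using ab by (auto simp: J1_def)
  have "\<P>(\<omega> in M. \<forall>p\<in>J'. ?Z p \<omega> = y p) = (1/2) ^ card J'" if y: "y \<in> J' \<rightarrow> {-1, 1}" for y
  proof -
    define d where "d i = y (0, 2 * i) * y (0, 2 * i + 1)" for i
    \<comment> \<open>the sign that supplies the first step of pair \<open>j\<close>, given the coins \<open>d\<close>\<close>
    define g where "g = (\<lambda>(r, j). if r = 0 then (if d j = 1 then (0, successes d j) else (b, j)) else (r, j))"
    define t where "t = (\<lambda>(r, j). if r = 0 then y (0, 2 * j) else if r = a then d j else y (r, j))"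
    define K where "K = {0, a} \<times> {..<n} \<union> J1"
    have ysgn: "y (0, 2 * i) \<in> {-1, 1} \<and> y (0, 2 * i + 1) \<in> {-1, 1}" if "i < n" for i
      using y that by (auto simp: Pi_iff J'_def)
    have inj: "inj_on g K"
    proof (rule inj_onI)
      fix p q assume pq: "p \<in> K" "q \<in> K" "g p = g q"
      obtain r j r' j' where [simp]: "p = (r, j)" "q = (r', j')" by (cases p, cases q)
      have "r \<noteq> b" "r' \<noteq> b" using pq ab by (auto simp: K_def J1_def)
      then have rr: "r = 0 \<longleftrightarrow> r' = 0" using pq(3) ab by (auto simp: g_def split: if_splits)
      show "p = q"
      proof (cases "r = 0 \<and> d j = 1 \<and> d j' = 1")
        case True
        then have "successes d j = successes d j'" using pq(3) rr by (auto simp: g_def)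
        then have "j = j'" using inj_onD[OF inj_on_successes[of d]] True by blast
        then show ?thesis using True rr by simp
      next
        case False
        then show ?thesis using pq(3) rr ab by (auto simp: g_def split: if_splits)
      qed
    qed
    have gK: "g ` K \<subseteq> insert 0 (insert a (insert b R)) \<times> UNIV"
      by (auto simp: g_def K_def J1_def split: if_splits)
    have Yg: "fair_signs (\<lambda>p. Y (g p)) K" by (rule fair_signs_reindex[OF Y inj gK])
    have finK: "finite K" using \<open>finite J1\<close> by (simp add: K_def)
    have "\<P>(\<omega> in M. \<forall>p\<in>K. Y (g p) \<omega> = t p) = (1/2) ^ card K"
    proof (rule fair_signs_cylinder[OF Yg finK order_refl])
      fix p assume "p \<in> K"
      then consider j where "p = (0, j)" "j < n" | j where "p = (a, j)" "j < n" | "p \<in> J1" by (auto simp: K_def)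
      then show "t p \<in> {-1, 1}"
      proof cases
        case 1 then show ?thesis using ysgn by (auto simp: t_def)
      next
        case 2 then show ?thesis using ysgn[of j] ab by (auto simp: t_def d_def)
      next
        case 3
        then have "y p \<in> {-1, 1}" using y by (auto simp: J'_def)
        moreover have "t p = y p" using 3 ab by (auto simp: t_def J1_def)
        ultimately show ?thesis by simp
      qed
    qed
    also have "card K = card J'"
    proof -
      have "card K = 2 * n + card J1"
        unfolding K_def using disj \<open>finite J1\<close> ab by (subst card_Un_disjoint) (auto simp: card_cartesian_product)
      moreover have "card J' = 2 * n + card J1"
        unfolding J'_def using disj \<open>finite J1\<close> by (subst card_Un_disjoint) (auto simp: card_cartesian_product)
      ultimately show ?thesis by simp
    qed
    also have "{\<omega> \<in> space M. \<forall>p\<in>K. Y (g p) \<omega> = t p} = {\<omega> \<in> space M. \<forall>p\<in>J'. ?Z p \<omega> = y p}"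
    proof (intro Collect_cong conj_cong refl)
      fix \<omega> assume \<omega>: "\<omega> \<in> space M"
      have "(\<forall>p\<in>J'. ?Z p \<omega> = y p) \<longleftrightarrow>
          (\<forall>k<2*n. refine (?x \<omega>) (?e \<omega>) (?f \<omega>) k = y (0, k)) \<and> (\<forall>p\<in>J1. Y p \<omega> = y p)"
      proof -
        have "?Z p \<omega> = Y p \<omega>" if "p \<in> J1" for p
          using that ab by (cases p) (auto simp: J1_def)
        then show ?thesis unfolding J'_def ball_Un by auto
      qed
      also have "(\<forall>k<2*n. refine (?x \<omega>) (?e \<omega>) (?f \<omega>) k = y (0, k)) \<longleftrightarrow>
          (\<forall>j<n. ?e \<omega> j = d j) \<and> (\<forall>j<n. (if d j = 1 then ?x \<omega> (successes d j) else ?f \<omega> j) = y (0, 2 * j))"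
        unfolding d_def
      proof (rule refine_eq_iff)
        show "y (0, 2 * i) \<in> {- 1, 1} \<and> y (0, 2 * i + 1) \<in> {- 1, 1}" if "i < n" for i by (rule ysgn[OF that])
      qed (rule rngY[OF _ \<omega>], simp)+
      also have "(\<dots>) \<and> (\<forall>p\<in>J1. Y p \<omega> = y p) \<longleftrightarrow> (\<forall>p\<in>K. Y (g p) \<omega> = t p)"
      proof -
        have "(\<forall>p\<in>K. Y (g p) \<omega> = t p) \<longleftrightarrow> (\<forall>j<n. Y (g (0, j)) \<omega> = t (0, j)) \<and>
            (\<forall>j<n. Y (g (a, j)) \<omega> = t (a, j)) \<and> (\<forall>p\<in>J1. Y (g p) \<omega> = t p)"
          by (auto simp: K_def)
        moreover have "Y (g p) \<omega> = t p \<longleftrightarrow> Y p \<omega> = y p" if pJ: "p \<in> J1" for p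
        proof -
          obtain r k where p: "p = (r, k)" "r \<in> R" using pJ by (auto simp: J1_def)
          then have "r \<noteq> 0" "r \<noteq> a" using ab by metis+
          then show ?thesis by (simp add: g_def t_def p)
        qed
        moreover have "Y (g (0, j)) \<omega> = (if d j = 1 then ?x \<omega> (successes d j) else ?f \<omega> j)" for j
          by (simp add: g_def)
        moreover have "t (0, j) = y (0, 2 * j)" "g (a, j) = (a, j)" "t (a, j) = d j" for j
          using ab by (simp_all add: t_def g_def)
        ultimately show ?thesis by auto
      qed
      finally show "(\<forall>p\<in>K. Y (g p) \<omega> = t p) = (\<forall>p\<in>J'. ?Z p \<omega> = y p)" ..
    qed
    finally show ?thesis .
  qed
  moreover have "finite J'" "J' \<subseteq> ?I" using \<open>finite J1\<close> by (auto simp: J'_def J1_def)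
  moreover have "J \<subseteq> J'"
  proof
    fix p assume "p \<in> J"
    then show "p \<in> J'" using n[of "fst p" "snd p"] J by (cases p) (auto simp: J'_def J1_def)
  qed
  ultimately show "\<exists>J'. finite J' \<and> J \<subseteq> J' \<and> J' \<subseteq> ?I \<and>
      (\<forall>y. y \<in> J' \<rightarrow> {-1, 1} \<longrightarrow> \<P>(\<omega> in M. \<forall>p\<in>J'. ?Z p \<omega> = y p) = (1/2) ^ card J')"
    by blast
qed

lemma fair_signs_level:
  fixes Z :: "nat \<times> nat \<Rightarrow> 'a \<Rightarrow> int"
  assumes Z: "fair_signs Z UNIV"
  shows "fair_signs (\<lambda>k \<omega>. level (\<lambda>p. Z p \<omega>) m k) UNIV"
proof -
  define Y where "Y m = (\<lambda>(r, k) \<omega>. if r = 0 then level (\<lambda>p. Z p \<omega>) m k else Z (r, k) \<omega>)" for m :: nat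
  have "fair_signs (Y m) (insert 0 {2*m+1..} \<times> UNIV)"
  proof (induction m)
    case 0
    have "Y 0 = Z" by (auto simp: Y_def fun_eq_iff)
    moreover have "insert 0 {1..} = (UNIV :: nat set)" by auto
    ultimately show ?case using Z by simp
  next
    case (Suc m)
    have set: "{2*m+1..} = insert (2*m+1) (insert (2*m+2) {2 * Suc m + 1..})" by auto
    from Suc have "fair_signs (Y m) (insert 0 (insert (2*m+1) (insert (2*m+2) {2 * Suc m + 1..})) \<times> UNIV)"
      unfolding set .
    note fair_signs_refine[OF this]
    moreover have "(\<lambda>(r, k) \<omega>. if r = 0
      then refine (\<lambda>i. Y m (0, i) \<omega>) (\<lambda>i. Y m (2*m+1, i) \<omega>) (\<lambda>i. Y m (2*m+2, i) \<omega>) k else Y m (r, k) \<omega>) = Y (Suc m)"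
      by (auto simp: Y_def fun_eq_iff)
    ultimately show ?case by simp
  qed
  then have "fair_signs (\<lambda>k. Y m (0, k)) UNIV"
    by (rule fair_signs_reindex) (auto simp: inj_on_def)
  then show ?thesis by (simp add: Y_def)
qed

end

section \<open>The limit of the refined walks\<close>

lemma geometric_Cauchy_limit:
  fixes x :: "nat \<Rightarrow> real"
  assumes step: "\<And>m. \<bar>x (Suc m) - x m\<bar> \<le> c * q ^ m" and q: "0 \<le> q" "q < 1"
  shows "convergent x" and "\<bar>x m - lim x\<bar> \<le> c / (1 - q) * q ^ m"
proof -
  have sq: "summable (\<lambda>m. c * q ^ m)" using q by (intro summable_mult summable_geometric) simp
  have s: "summable (\<lambda>m. x (Suc m) - x m)"
    using step by (intro summable_comparison_test[OF _ sq]) auto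
  then have "(\<lambda>m. (\<Sum>i<m. x (Suc i) - x i) + x 0) \<longlonglongrightarrow> (\<Sum>i. x (Suc i) - x i) + x 0"
    by (intro tendsto_intros summable_LIMSEQ)
  then have l: "x \<longlonglongrightarrow> (\<Sum>i. x (Suc i) - x i) + x 0" by (simp add: sum_lessThan_telescope)
  then show "convergent x" by (auto simp: convergent_def)
  have "\<bar>x (m + k) - x m\<bar> \<le> c / (1 - q) * q ^ m" for k
  proof -
    have "x (m + k) - x m = (\<Sum>i<k. x (Suc (m + i)) - x (m + i))"
      by (induction k) auto
    then have "\<bar>x (m + k) - x m\<bar> \<le> (\<Sum>i<k. c * q ^ (m + i))"
      using step by (auto intro!: order_trans[OF sum_abs] sum_mono)
    also have "\<dots> = c * q ^ m * (\<Sum>i<k. q ^ i)" by (simp add: sum_distrib_left power_add mult.assoc)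
    also have "\<dots> \<le> c * q ^ m * (1 / (1 - q))"
    proof (rule mult_left_mono)
      show "(\<Sum>i<k. q ^ i) \<le> 1 / (1 - q)"
        using q sum_le_suminf[OF summable_geometric, of q "{..<k}"] by (simp add: suminf_geometric)
      show "0 \<le> c * q ^ m" using step[of m] by linarith
    qed
    finally show ?thesis by simp
  qed
  moreover have "(\<lambda>k. \<bar>x (m + k) - x m\<bar>) \<longlonglongrightarrow> \<bar>lim x - x m\<bar>"
    using LIMSEQ_ignore_initial_segment[OF l, of m] limI[OF l] by (auto intro!: tendsto_intros simp: add.commute)
  ultimately have "\<bar>lim x - x m\<bar> \<le> c / (1 - q) * q ^ m"
    by (intro tendsto_upperbound) (auto intro: always_eventually)
  then show "\<bar>x m - lim x\<bar> \<le> c / (1 - q) * q ^ m" by (simp add: abs_minus_commute)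
qed

text \<open>Level \<open>m\<close> has steps of size \<open>1 / 2 ^ m\<close> at times that are multiples of \<open>1 / 4 ^ m\<close>.\<close>

definition walk_approx :: "(nat \<times> nat \<Rightarrow> int) \<Rightarrow> nat \<Rightarrow> real \<Rightarrow> real" where
  "walk_approx z m t = real_of_int (walk (level z m) (nat \<lfloor>4 ^ m * t\<rfloor>)) / 2 ^ m"

text \<open>The limit is taken with the total function \<open>lim\<close>, which makes every value of the process measurable; the limit exists
almost surely.\<close>

definition brownian :: "(nat \<times> nat \<Rightarrow> int) \<Rightarrow> real \<Rightarrow> real" where
  "brownian z t = lim (\<lambda>m. walk_approx z m t)"

lemma brownian_0 [simp]: "brownian z 0 = 0"
  by (simp add: brownian_def walk_approx_def)

text \<open>The restriction \<open>m \<le> N\<close> is harmless for the refined walks: over the time interval \<open>[0, n]\<close>, level \<open>m\<close> makes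
\<open>4 ^ m * n\<close> steps, which is more than \<open>m\<close>.\<close>

definition modulus_bound :: "real \<Rightarrow> real \<Rightarrow> (nat \<Rightarrow> nat \<Rightarrow> int) \<Rightarrow> bool" where
  "modulus_bound e K Y \<longleftrightarrow> (\<forall>N\<ge>1. \<forall>m\<le>N. \<forall>i\<le>N. \<forall>j\<le>N.
    \<bar>real_of_int (walk (Y m) i) - real_of_int (walk (Y m) j)\<bar> \<le> K * real N powr e * sqrt \<bar>real i - real j\<bar>)"

lemma modulus_boundD:
  "modulus_bound e K Y \<Longrightarrow> 1 \<le> N \<Longrightarrow> m \<le> N \<Longrightarrow> i \<le> N \<Longrightarrow> j \<le> N \<Longrightarrow>
    \<bar>real_of_int (walk (Y m) i) - real_of_int (walk (Y m) j)\<bar> \<le> K * real N powr e * sqrt \<bar>real i - real j\<bar>"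
  by (auto simp: modulus_bound_def)

text \<open>The number of successes among \<open>2 * i\<close> coins differs from \<open>i\<close> by at most about \<open>sqrt i\<close>. The finer walk at time \<open>4 * i\<close> is
twice the coarser one at this number of successes, and over a time gap \<open>sqrt i\<close> the coarser walk moves by about \<open>i powr (1/4)\<close>.
With \<open>i\<close> of order \<open>4 ^ m * n\<close> and steps of size \<open>1 / 2 ^ m\<close>, the two approximations differ by about \<open>n powr (1/4) / 2 powr (m/2)\<close>. The
surplus \<open>3/2 * e\<close> in the exponent, at most \<open>1/8\<close>, turns the geometric factor into \<open>2 powr (-1/4)\<close>.\<close>

lemma walk_approx_step:
  assumes z: "\<And>p. z p \<in> {-1, 1}" and e: "0 < e" "e \<le> 1/12" and "1 \<le> K"
    and L: "modulus_bound e K (level z)" and E: "modulus_bound e K (\<lambda>m k. z (2 * m + 1, k))"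
    and t: "0 \<le> t" "t \<le> real n" and "1 \<le> n"
  shows "\<bar>walk_approx z (Suc m) t - walk_approx z m t\<bar> \<le>
    ((3 + 2 * K\<^sup>2) * real n powr (1/4 + 3/2 * e)) * (2 powr (-1/4)) ^ m"
proof -
  define i where "i = nat \<lfloor>4 ^ m * t\<rfloor>"
  define i' where "i' = nat \<lfloor>4 ^ Suc m * t\<rfloor>"
  define N where "N = 4 ^ Suc m * n"
  define \<alpha> where "\<alpha> = 1/4 + 3/2 * e"
  define r where "r = real n powr \<alpha>"
  define X where "X = level z m"
  define Y where "Y = level z (Suc m)"
  define c where "c k = z (2 * m + 1, k)" for k
  define s where "s = successes c (2 * i)"
  have "1 \<le> r" unfolding r_def \<alpha>_def using \<open>1 \<le> n\<close> e by (intro ge_one_powr_ge_zero) auto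
  have tf: "0 \<le> \<lfloor>4 ^ m * t\<rfloor>" using t by simp
  have ii: "4 * i \<le> i'" "i' \<le> 4 * i + 3"
  proof -
    have "4 * \<lfloor>4 ^ m * t\<rfloor> \<le> \<lfloor>4 ^ Suc m * t\<rfloor>" "\<lfloor>4 ^ Suc m * t\<rfloor> < 4 * \<lfloor>4 ^ m * t\<rfloor> + 4"
      by (simp_all add: le_floor_iff floor_less_iff) linarith+
    then show "4 * i \<le> i'" "i' \<le> 4 * i + 3" using tf by (auto simp: i_def i'_def)
  qed
  have "i \<le> 4 ^ m * n"
  proof -
    have "4 ^ m * t \<le> 4 ^ m * real n" using t by (intro mult_left_mono) auto
    then have "\<lfloor>4 ^ m * t\<rfloor> \<le> \<lfloor>real (4 ^ m * n)\<rfloor>" by (intro floor_mono) simp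
    also have "\<dots> = int (4 ^ m * n)" by (rule floor_of_nat)
    finally show ?thesis by (simp add: i_def nat_le_iff)
  qed
  moreover have "N = 4 * (4 ^ m * n)" by (simp add: N_def)
  ultimately have N: "2 * i \<le> N" "i \<le> N" by linarith+
  have "s \<le> N" using successes_le[of c "2 * i"] N by (simp add: s_def)
  have "m < 4 ^ m" by (rule less_exp[THEN less_le_trans]) (rule power_mono, auto)
  then have "m \<le> N" "1 \<le> N" using \<open>1 \<le> n\<close> by (auto simp: N_def intro!: Suc_leI order_trans[OF less_imp_le[OF \<open>m < 4 ^ m\<close>]])
  define \<nu> where "\<nu> = real N"
  have "1 \<le> \<nu>" using \<open>1 \<le> N\<close> by (simp add: \<nu>_def)
  \<comment> \<open>\<open>s\<close> steps of the coarser walk have been used in the first \<open>2 * i\<close> pairs\<close>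
  have two: "walk Y (4 * i) = 2 * walk X s"
  proof -
    have "Y = refine X c (\<lambda>k. z (2 * m + 2, k))" by (simp add: Y_def X_def c_def[abs_def])
    then show ?thesis using walk_refine[of c X "\<lambda>k. z (2 * m + 2, k)" "2 * i"] z by (simp add: c_def s_def)
  qed
  have dev: "\<bar>real s - real i\<bar> \<le> (K * \<nu> powr (e + 1/2))"
  proof -
    have "walk c (2 * i) = 2 * int s - 2 * int i"
      using walk_successes[of c "2 * i"] z by (simp add: c_def s_def)
    then have "real_of_int (walk c (2 * i)) = 2 * (real s - real i)" by simp
    then have "2 * \<bar>real s - real i\<bar> = \<bar>real_of_int (walk c (2 * i)) - real_of_int (walk c 0)\<bar>"
      by (simp only: walk_0 of_int_0 diff_zero abs_mult abs_numeral)
    also have "\<dots> \<le> K * \<nu> powr e * sqrt \<bar>real (2 * i) - real 0\<bar>"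
      unfolding \<nu>_def using modulus_boundD[OF E \<open>1 \<le> N\<close> \<open>m \<le> N\<close> N(1), of 0] by (simp add: c_def[abs_def])
    also have "\<dots> \<le> K * \<nu> powr e * sqrt \<nu>"
      using N \<open>1 \<le> K\<close> by (intro mult_left_mono) (auto simp: \<nu>_def)
    also have "\<dots> = K * \<nu> powr (e + 1/2)"
      using \<open>1 \<le> \<nu>\<close> by (simp add: powr_add powr_half_sqrt)
    finally have "2 * \<bar>real s - real i\<bar> \<le> K * \<nu> powr (e + 1/2)" .
    then show ?thesis by (rule order_trans[rotated]) simp
  qed
  have "\<bar>real_of_int (walk X s) - real_of_int (walk X i)\<bar> \<le> K * \<nu> powr e * sqrt \<bar>real s - real i\<bar>"
    unfolding \<nu>_def X_def by (rule modulus_boundD[OF L \<open>1 \<le> N\<close> \<open>m \<le> N\<close> \<open>s \<le> N\<close> N(2)])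
  also have "\<dots> \<le> K * \<nu> powr e * sqrt (K * \<nu> powr (e + 1/2))"
    using dev \<open>1 \<le> K\<close> by (intro mult_left_mono) auto
  also have "sqrt (K * \<nu> powr (e + 1/2)) = sqrt K * \<nu> powr (e/2 + 1/4)"
    using \<open>1 \<le> K\<close> \<open>1 \<le> \<nu>\<close>
    by (simp add: real_sqrt_mult powr_half_sqrt[symmetric] powr_powr add_divide_distrib)
  also have "sqrt K \<le> K" using \<open>1 \<le> K\<close> by (simp add: real_le_lsqrt self_le_power)
  then have "K * \<nu> powr e * (sqrt K * \<nu> powr (e/2 + 1/4)) \<le> K * \<nu> powr e * (K * \<nu> powr (e/2 + 1/4))"
    using \<open>1 \<le> K\<close> by (intro mult_left_mono mult_right_mono) auto
  also have "\<dots> = K\<^sup>2 * \<nu> powr \<alpha>"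
    by (simp add: \<alpha>_def power2_eq_square powr_add[symmetric] field_simps)
  finally have main: "\<bar>real_of_int (walk X s) - real_of_int (walk X i)\<bar> \<le> K\<^sup>2 * \<nu> powr \<alpha>" .
  have lip: "\<bar>real_of_int (walk Y i') - real_of_int (walk Y (4 * i))\<bar> \<le> 3"
    using walk_lipschitz[of Y i' "4 * i"] level_sign[of z "Suc m"] z ii unfolding Y_def by fastforce
  have \<nu>: "\<nu> powr \<alpha> \<le> 2 * (2 powr (3/4)) ^ m * r"
  proof -
    have "(4 ^ Suc m) powr \<alpha> \<le> (4 ^ Suc m) powr (3/8 :: real)"
      using e one_le_power[of "4::real" "Suc m"] by (intro powr_mono) (auto simp: \<alpha>_def)
    also have "(4 ^ Suc m) powr (3/8 :: real) = 2 powr (3/4 * Suc m)"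
    proof -
      have "(4::real) ^ Suc m = 2 powr (2 * real (Suc m))"
        by (simp add: powr_realpow[symmetric] powr_powr[symmetric] power_mult del: power_Suc of_nat_Suc)
      then have "(4 ^ Suc m) powr (3/8 :: real) = 2 powr (2 * real (Suc m) * (3/8))" by (simp only: powr_powr)
      also have "2 * real (Suc m) * (3/8) = 3/4 * Suc m" by simp
      finally show ?thesis .
    qed
    also have "\<dots> = 2 powr (3/4) * (2 powr (3/4)) ^ m"
      by (simp add: powr_power powr_add[symmetric] algebra_simps add_divide_distrib)
    also have "2 powr (3/4) * (2 powr (3/4)) ^ m \<le> 2 powr 1 * ((2::real) powr (3/4)) ^ m"
      by (intro mult_right_mono powr_mono) auto
    finally have "(4 ^ Suc m) powr \<alpha> * r \<le> 2 * (2 powr (3/4)) ^ m * r"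
      using \<open>1 \<le> r\<close> by (intro mult_right_mono) auto
    then show ?thesis unfolding \<nu>_def N_def r_def by (simp add: powr_mult)
  qed
  have "walk_approx z (Suc m) t - walk_approx z m t = real_of_int (walk Y i') / 2 ^ Suc m - real_of_int (walk X i) / 2 ^ m"
    by (simp add: walk_approx_def i_def i'_def X_def Y_def)
  also have "\<dots> = ((real_of_int (walk Y i') - real_of_int (walk Y (4 * i))) / 2 + (real_of_int (walk X s) - real_of_int (walk X i))) / 2 ^ m"
    using two by (simp add: field_simps)
  also have "\<bar>\<dots>\<bar> \<le> (3 / 2 + K\<^sup>2 * \<nu> powr \<alpha>) / 2 ^ m"
  proof -
    have "\<bar>u / 2 + v\<bar> \<le> 3 / 2 + w" if "\<bar>u\<bar> \<le> 3" "\<bar>v\<bar> \<le> w" for u v w :: real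
      using that by linarith
    from this[OF lip main] show ?thesis unfolding abs_divide by (simp add: divide_right_mono)
  qed
  also have "\<dots> \<le> (3 * (2 powr (3/4)) ^ m * r + K\<^sup>2 * (2 * (2 powr (3/4)) ^ m * r)) / 2 ^ m"
  proof (intro divide_right_mono add_mono mult_left_mono \<nu>)
    have "1 \<le> (2 powr (3/4) :: real) ^ m" by (intro one_le_power ge_one_powr_ge_zero) auto
    then have "1 * 1 \<le> (2 powr (3/4)) ^ m * r" using \<open>1 \<le> r\<close> by (intro mult_mono) auto
    then have "3 / 2 \<le> 3 * ((2 powr (3/4)) ^ m * r)" by linarith
    then show "3 / 2 \<le> 3 * (2 powr (3/4)) ^ m * r" by (simp only: mult.assoc)
  qed auto
  also have "\<dots> = ((3 + 2 * K\<^sup>2) * r) * (2 powr (3/4) / 2) ^ m"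
    by (simp add: power_divide algebra_simps add_divide_distrib)
  also have "(2 powr (3/4) / 2 :: real) = 2 powr (-1/4)"
    using powr_diff[of "2::real" "3/4" 1] by simp
  finally show ?thesis by (simp add: r_def \<alpha>_def)
qed

lemma walk_approx_brownian:
  assumes z: "\<And>p. z p \<in> {-1, 1}" and e: "0 < e" "e \<le> 1/12" and K: "1 \<le> K"
    and L: "modulus_bound e K (level z)" and E: "modulus_bound e K (\<lambda>m k. z (2 * m + 1, k))"
  obtains A where "0 \<le> A" "\<And>m n t. 1 \<le> n \<Longrightarrow> 0 \<le> t \<Longrightarrow> t \<le> real n \<Longrightarrow>
      (\<lambda>m. walk_approx z m t) \<longlonglongrightarrow> brownian z t \<and>
      \<bar>walk_approx z m t - brownian z t\<bar> \<le> A * real n powr (1/4 + 3/2 * e) * (2 powr (-1/4)) ^ m"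
proof
  define q where "q = (2::real) powr (-1/4)"
  have q: "0 \<le> q" "q < 1"
    using powr_less_mono[of "-1/4" 0 "2::real"] by (auto simp: q_def)
  define A where "A = (3 + 2 * K\<^sup>2) / (1 - q)"
  show "0 \<le> A" using q by (simp add: A_def)
  fix m n t assume n: "1 \<le> n" and t: "0 \<le> t" "t \<le> real n"
  have step: "\<bar>walk_approx z (Suc m) t - walk_approx z m t\<bar> \<le> ((3 + 2 * K\<^sup>2) * real n powr (1/4 + 3/2 * e)) * q ^ m" for m
    unfolding q_def by (rule walk_approx_step[OF z e K L E t n])
  show "(\<lambda>m. walk_approx z m t) \<longlonglongrightarrow> brownian z t \<and>
      \<bar>walk_approx z m t - brownian z t\<bar> \<le> A * real n powr (1/4 + 3/2 * e) * (2 powr (-1/4)) ^ m"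
    unfolding brownian_def
    using geometric_Cauchy_limit(1)[OF step q] geometric_Cauchy_limit(2)[OF step q, of m]
    by (simp add: A_def q_def convergent_LIMSEQ_iff)
qed

text \<open>Summing the geometric bounds over all levels leaves an error of the order of the first one. Up to the
small power, this is the rate that the Skorokhod embedding gives.\<close>

lemma walk_near_brownian:
  assumes "\<And>p. z p \<in> {-1, 1}" and "0 < e" "e \<le> 1/12" and "1 \<le> K"
    and "modulus_bound e K (level z)" and "modulus_bound e K (\<lambda>m k. z (2 * m + 1, k))"
  obtains A where "0 \<le> A" "\<And>n. \<bar>real_of_int (walk (\<lambda>k. z (0, k)) n) - brownian z (real n)\<bar> \<le> A * real n powr (1/4 + 3/2 * e)"
proof -
  obtain A where A: "0 \<le> A" "\<And>m n t. 1 \<le> n \<Longrightarrow> 0 \<le> t \<Longrightarrow> t \<le> real n \<Longrightarrow>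
      (\<lambda>m. walk_approx z m t) \<longlonglongrightarrow> brownian z t \<and>
      \<bar>walk_approx z m t - brownian z t\<bar> \<le> A * real n powr (1/4 + 3/2 * e) * (2 powr (-1/4)) ^ m"
    using walk_approx_brownian[OF assms] by blast
  show thesis
  proof (rule that[OF A(1)])
    fix n
    show "\<bar>real_of_int (walk (\<lambda>k. z (0, k)) n) - brownian z (real n)\<bar> \<le> A * real n powr (1/4 + 3/2 * e)"
      using A(2)[of n "real n" 0] by (cases "n = 0") (auto simp: walk_approx_def)
  qed
qed

text \<open>The convergence is uniform on bounded intervals, and the approximations jump only by \<open>1 / 2 ^ m\<close> when the time changes by less
than \<open>1 / 4 ^ m\<close>.\<close>

lemma continuous_brownian:
  assumes z: "\<And>p. z p \<in> {-1, 1}" and "0 < e" "e \<le> 1/12" and "1 \<le> K"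
    and "modulus_bound e K (level z)" and "modulus_bound e K (\<lambda>m k. z (2 * m + 1, k))"
  shows "continuous_on {0..} (brownian z)"
proof -
  obtain A where A: "0 \<le> A" "\<And>m n t. 1 \<le> n \<Longrightarrow> 0 \<le> t \<Longrightarrow> t \<le> real n \<Longrightarrow>
      (\<lambda>m. walk_approx z m t) \<longlonglongrightarrow> brownian z t \<and>
      \<bar>walk_approx z m t - brownian z t\<bar> \<le> A * real n powr (1/4 + 3/2 * e) * (2 powr (-1/4)) ^ m"
    using walk_approx_brownian[OF assms] by blast
  show ?thesis
    unfolding continuous_on_iff
  proof (intro ballI allI impI)
    fix t d :: real assume t: "t \<in> {0..}" and "0 < d"
    define n where "n = Suc (nat \<lceil>t\<rceil>)"
    have "t + 1 \<le> real n" "1 \<le> n" unfolding n_def using t real_nat_ceiling_ge[of t] by auto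
    define c where "c = A * real n powr (1/4 + 3/2 * e)"
    have q: "norm ((2::real) powr (-1/4)) < 1" "norm (1/2 :: real) < 1"
      using powr_less_mono[of "-1/4" 0 "2::real"] by auto
    have "(\<lambda>m. 2 * (c * (2 powr (-1/4)) ^ m) + (1/2) ^ m) \<longlonglongrightarrow> 2 * (c * 0) + 0"
      by (intro tendsto_add tendsto_mult tendsto_const LIMSEQ_power_zero q)
    then have "\<forall>\<^sub>F m in sequentially. 2 * (c * (2 powr (-1/4)) ^ m) + (1/2) ^ m < d"
      by (rule order_tendstoD) (use \<open>0 < d\<close> in simp)
    then obtain m where m: "2 * (c * (2 powr (-1/4)) ^ m) + (1/2) ^ m < d"
      by (auto simp: eventually_sequentially)
    show "\<exists>\<delta>>0. \<forall>s\<in>{0..}. dist s t < \<delta> \<longrightarrow> dist (brownian z s) (brownian z t) < d"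
    proof (intro exI[of _ "1 / 4 ^ m"] conjI ballI impI)
      fix s :: real assume s: "s \<in> {0..}" "dist s t < 1 / 4 ^ m"
      have "(1::real) / 4 ^ m \<le> 1" by simp
      moreover have "s - t < 1 / 4 ^ m" using s(2) by (simp add: dist_real_def)
      ultimately have "s \<le> real n" using \<open>t + 1 \<le> real n\<close> by linarith
      define i where "i = nat \<lfloor>4 ^ m * s\<rfloor>"
      define j where "j = nat \<lfloor>4 ^ m * t\<rfloor>"
      have "\<bar>4 ^ m * s - 4 ^ m * t\<bar> = \<bar>s - t\<bar> * 4 ^ m"
      proof -
        have "4 ^ m * s - 4 ^ m * t = (s - t) * 4 ^ m" by (simp add: algebra_simps)
        then show ?thesis by (simp only: abs_mult) simp
      qed
      also have "\<dots> < 1" using s(2) by (simp add: dist_real_def pos_less_divide_eq)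
      finally have "\<bar>4 ^ m * s - 4 ^ m * t\<bar> < 1" .
      then have "real_of_int (\<lfloor>4 ^ m * s\<rfloor> - \<lfloor>4 ^ m * t\<rfloor>) < of_int 2" "real_of_int (\<lfloor>4 ^ m * t\<rfloor> - \<lfloor>4 ^ m * s\<rfloor>) < of_int 2"
        using floor_correct[of "4 ^ m * s"] floor_correct[of "4 ^ m * t"]
        unfolding of_int_diff of_int_numeral abs_less_iff by linarith+
      then have "\<bar>int i - int j\<bar> \<le> 1" using s t unfolding i_def j_def of_int_less_iff by simp
      then have "\<bar>real i - real j\<bar> \<le> 1" by linarith
      moreover have "\<bar>real_of_int (walk (level z m) i - walk (level z m) j)\<bar> \<le> \<bar>real i - real j\<bar>"
        by (rule walk_lipschitz) (rule level_sign[OF z])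
      ultimately have "\<bar>walk_approx z m s - walk_approx z m t\<bar> \<le> (1/2) ^ m"
        by (simp add: walk_approx_def i_def j_def power_one_over abs_divide divide_le_cancel flip: diff_divide_distrib)
      moreover have "\<bar>walk_approx z m s - brownian z s\<bar> \<le> c * (2 powr (-1/4)) ^ m"
        "\<bar>walk_approx z m t - brownian z t\<bar> \<le> c * (2 powr (-1/4)) ^ m"
        unfolding c_def using A(2)[OF \<open>1 \<le> n\<close>] s t \<open>s \<le> real n\<close> \<open>t + 1 \<le> real n\<close> by auto
      ultimately show "dist (brownian z s) (brownian z t) < d" using m unfolding dist_real_def by linarith
    qed simp
  qed
qed

section \<open>The limit is a Wiener process\<close>

lemma measurable_walk_approx:
  "(\<lambda>z. walk_approx z m t) \<in> borel_measurable (Pi\<^sub>M UNIV (\<lambda>_. count_space UNIV))"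
proof (rule measurable_finite_dependence[of "{..2 * m} \<times> {..nat \<lfloor>4 ^ m * t\<rfloor>}" "\<lambda>p z. z p"])
  fix z z' :: "nat \<times> nat \<Rightarrow> int"
  assume eq: "\<And>p. p \<in> {..2 * m} \<times> {..nat \<lfloor>4 ^ m * t\<rfloor>} \<Longrightarrow> z p = z' p"
  have "level z m k = level z' m k" if "k < nat \<lfloor>4 ^ m * t\<rfloor>" for k
    using that by (intro level_cong eq) auto
  then show "walk_approx z m t = walk_approx z' m t"
    by (simp add: walk_approx_def walk_def)
qed auto

lemma measurable_brownian:
  "(\<lambda>z. brownian z t) \<in> borel_measurable (Pi\<^sub>M UNIV (\<lambda>_. count_space UNIV))"
  unfolding brownian_def by (intro borel_measurable_lim_metric measurable_walk_approx)

lemma tendsto_nat_floor_power4: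
  assumes "0 \<le> t"
  shows "(\<lambda>m. real (nat \<lfloor>4 ^ m * t\<rfloor>) / 4 ^ m) \<longlonglongrightarrow> t"
proof (rule tendsto_sandwich[of "\<lambda>m. t - 1 / 4 ^ m" _ _ "\<lambda>m. t"])
  have nf: "real (nat \<lfloor>4 ^ m * t\<rfloor>) = of_int \<lfloor>4 ^ m * t\<rfloor>" for m
    using assms by simp
  show "\<forall>\<^sub>F m in sequentially. t - 1 / 4 ^ m \<le> real (nat \<lfloor>4 ^ m * t\<rfloor>) / 4 ^ m"
  proof (rule always_eventually, rule allI)
    fix m
    have "(4 ^ m * t - 1) / 4 ^ m \<le> real (nat \<lfloor>4 ^ m * t\<rfloor>) / 4 ^ m"
      unfolding nf by (intro divide_right_mono) (linarith, simp)
    then show "t - 1 / 4 ^ m \<le> real (nat \<lfloor>4 ^ m * t\<rfloor>) / 4 ^ m" by (simp add: diff_divide_distrib)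
  qed
  show "\<forall>\<^sub>F m in sequentially. real (nat \<lfloor>4 ^ m * t\<rfloor>) / 4 ^ m \<le> t"
    unfolding nf by (intro always_eventually allI) (simp add: pos_divide_le_eq mult.commute)
  show "(\<lambda>m. t - 1 / 4 ^ m) \<longlonglongrightarrow> t" by real_asymp
qed simp

text \<open>The characteristic function of an increment of level \<open>m\<close> is a power of \<open>cos (u / 2 ^ m)\<close>; its limit is
that of a normal variable with variance \<open>t - s\<close>.\<close>

lemma tendsto_cos_power:
  fixes s t u :: real
  assumes "0 \<le> s" "s \<le> t"
  shows "(\<lambda>m. cos (u / 2 ^ m) ^ (nat \<lfloor>4 ^ m * t\<rfloor> - nat \<lfloor>4 ^ m * s\<rfloor>)) \<longlonglongrightarrow> exp (- (u\<^sup>2 * (t - s)) / 2)"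
proof -
  define N where "N m = nat \<lfloor>4 ^ m * t\<rfloor> - nat \<lfloor>4 ^ m * s\<rfloor>" for m
  have rN: "real (N m) = real (nat \<lfloor>4 ^ m * t\<rfloor>) - real (nat \<lfloor>4 ^ m * s\<rfloor>)" for m
  proof -
    have "\<lfloor>4 ^ m * s\<rfloor> \<le> \<lfloor>4 ^ m * t\<rfloor>" using assms by (intro floor_mono) simp
    then show ?thesis by (simp add: N_def of_nat_diff nat_mono)
  qed
  have "(\<lambda>m. real (N m) / 4 ^ m) \<longlonglongrightarrow> t - s"
    unfolding rN diff_divide_distrib using assms by (intro tendsto_diff tendsto_nat_floor_power4) auto
  moreover have "(\<lambda>m. 4 ^ m * ln (cos (u / 2 ^ m))) \<longlonglongrightarrow> - (u\<^sup>2) / 2"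
  proof -
    have "(\<lambda>m. 4 ^ m * ln (cos (v / 2 ^ m))) \<longlonglongrightarrow> - (v\<^sup>2) / 2" if "0 < v" for v :: real
    proof -
      have "((\<lambda>x. ln (cos (v * x)) / x\<^sup>2) \<longlongrightarrow> - (v\<^sup>2) / 2) (at_right 0)"
        using that by (real_asymp simp: power2_eq_square)
      moreover have "filterlim (\<lambda>m::nat. 1 / 2 ^ m :: real) (at_right 0) sequentially"
        by real_asymp
      ultimately have "(\<lambda>m. ln (cos (v * (1 / 2 ^ m))) / (1 / 2 ^ m)\<^sup>2) \<longlonglongrightarrow> - (v\<^sup>2) / 2"
        by (rule filterlim_compose)
      moreover have "ln (cos (v * (1 / 2 ^ m))) / (1 / 2 ^ m)\<^sup>2 = 4 ^ m * ln (cos (v / 2 ^ m))" for m :: nat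
        by (simp add: power_divide power_mult[symmetric] mult.commute[of m] power_mult)
      ultimately show ?thesis by simp
    qed
    note pos = this
    have c: "cos (\<bar>u\<bar> / 2 ^ m) = cos (u / 2 ^ m)" for m :: nat
      by (auto simp: abs_if)
    show ?thesis
    proof (cases "u = 0")
      case False
      then have "(\<lambda>m. 4 ^ m * ln (cos (\<bar>u\<bar> / 2 ^ m))) \<longlonglongrightarrow> - (\<bar>u\<bar>\<^sup>2) / 2" by (intro pos) simp
      then show ?thesis unfolding c power2_abs .
    qed simp
  qed
  ultimately have "(\<lambda>m. (real (N m) / 4 ^ m) * (4 ^ m * ln (cos (u / 2 ^ m)))) \<longlonglongrightarrow> (t - s) * (- (u\<^sup>2) / 2)"
    by (rule tendsto_mult)
  then have "(\<lambda>m. exp (real (N m) * ln (cos (u / 2 ^ m)))) \<longlonglongrightarrow> exp ((t - s) * (- (u\<^sup>2) / 2))"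
    by (intro tendsto_exp) simp
  moreover have "\<forall>\<^sub>F m in sequentially. exp (real (N m) * ln (cos (u / 2 ^ m))) = cos (u / 2 ^ m) ^ N m"
  proof -
    have "\<forall>\<^sub>F m::nat in sequentially. 0 < cos (u / 2 ^ m)" by real_asymp
    then show ?thesis by eventually_elim (simp add: exp_of_nat_mult)
  qed
  ultimately have "(\<lambda>m. cos (u / 2 ^ m) ^ N m) \<longlonglongrightarrow> exp ((t - s) * (- (u\<^sup>2) / 2))"
    by (rule Lim_transform_eventually)
  then show ?thesis by (simp add: N_def mult.commute)
qed

lemma modulus_bound_mono:
  assumes "modulus_bound e K Y" "K \<le> K'"
  shows "modulus_bound e K' Y"
  unfolding modulus_bound_def
proof (intro allI impI)
  fix N m i j :: nat assume "1 \<le> N" "m \<le> N" "i \<le> N" "j \<le> N"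
  then have "\<bar>real_of_int (walk (Y m) i) - real_of_int (walk (Y m) j)\<bar> \<le> K * real N powr e * sqrt \<bar>real i - real j\<bar>"
    by (rule modulus_boundD[OF assms(1)])
  also have "\<dots> \<le> K' * real N powr e * sqrt \<bar>real i - real j\<bar>"
    using assms(2) by (intro mult_right_mono) auto
  finally show "\<bar>real_of_int (walk (Y m) i) - real_of_int (walk (Y m) j)\<bar> \<le> K' * real N powr e * sqrt \<bar>real i - real j\<bar>" .
qed

context prob_space begin

lemma tendsto_prob_AE:
  assumes A: "\<And>m. A m \<in> events" and "B \<in> events"
    and ev: "AE \<omega> in M. \<forall>\<^sub>F m in sequentially. \<omega> \<in> A m \<longleftrightarrow> \<omega> \<in> B"
  shows "(\<lambda>m. prob (A m)) \<longlonglongrightarrow> prob B"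
proof -
  have "(\<lambda>m. \<integral>\<omega>. indicat_real (A m) \<omega> \<partial>M) \<longlonglongrightarrow> (\<integral>\<omega>. indicat_real B \<omega> \<partial>M)"
  proof (rule integral_dominated_convergence[of _ _ _ "\<lambda>_. 1"])
    show "AE \<omega> in M. (\<lambda>m. indicat_real (A m) \<omega>) \<longlonglongrightarrow> indicat_real B \<omega>"
      using ev by eventually_elim (auto intro!: tendsto_eventually elim!: eventually_mono simp: indicator_def)
  qed (use A \<open>B \<in> events\<close> in \<open>auto simp: indicator_def\<close>)
  then show ?thesis using A \<open>B \<in> events\<close> by (simp add: sets.Int_space_eq2)
qed

text \<open>Independence passes to almost sure limits without atoms: the indicator of \<open>{..a}\<close> is continuous at almost
every value of the limit, so the probabilities of finite intersections of such events converge, and these events generate.\<close>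

lemma indep_vars_AE_limit:
  fixes D :: "nat \<Rightarrow> 'i \<Rightarrow> 'a \<Rightarrow> real"
  assumes D: "\<And>m. indep_vars (\<lambda>_. borel) (D m) I"
    and E: "\<And>i. i \<in> I \<Longrightarrow> random_variable borel (E i)"
    and lim: "\<And>i. i \<in> I \<Longrightarrow> AE \<omega> in M. (\<lambda>m. D m i \<omega>) \<longlonglongrightarrow> E i \<omega>"
    and atom: "\<And>i a. i \<in> I \<Longrightarrow> AE \<omega> in M. E i \<omega> \<noteq> a"
  shows "indep_vars (\<lambda>_. borel) E I"
proof -
  have rvD: "random_variable borel (D m i)" if "i \<in> I" for m i
    using D[of m] that by (simp add: indep_vars_def)
  have conv: "(\<lambda>m. prob (\<Inter>j\<in>J. D m j -` {..a j} \<inter> space M)) \<longlonglongrightarrow> prob (\<Inter>j\<in>J. E j -` {..a j} \<inter> space M)"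
    if J: "J \<subseteq> I" "finite J" "J \<noteq> {}" for J a
  proof (rule tendsto_prob_AE)
    show "(\<Inter>j\<in>J. D m j -` {..a j} \<inter> space M) \<in> events" for m
      using J rvD by (intro sets.finite_INT) (auto intro!: measurable_sets)
    show "(\<Inter>j\<in>J. E j -` {..a j} \<inter> space M) \<in> events"
      using J E by (intro sets.finite_INT) (auto intro!: measurable_sets)
    have "AE \<omega> in M. \<forall>j\<in>J. (\<lambda>m. D m j \<omega>) \<longlonglongrightarrow> E j \<omega> \<and> E j \<omega> \<noteq> a j"
      using J lim atom by (intro AE_finite_allI AE_conjI) auto
    then show "AE \<omega> in M. \<forall>\<^sub>F m in sequentially.
      \<omega> \<in> (\<Inter>j\<in>J. D m j -` {..a j} \<inter> space M) \<longleftrightarrow> \<omega> \<in> (\<Inter>j\<in>J. E j -` {..a j} \<inter> space M)"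
    proof eventually_elim
      case (elim \<omega>)
      have "\<forall>\<^sub>F m in sequentially. \<forall>j\<in>J. D m j \<omega> \<le> a j \<longleftrightarrow> E j \<omega> \<le> a j"
      proof (rule eventually_ball_finite[OF J(2)], rule ballI)
        fix j assume "j \<in> J"
        with elim have l: "(\<lambda>m. D m j \<omega>) \<longlonglongrightarrow> E j \<omega>" "E j \<omega> \<noteq> a j" by auto
        show "\<forall>\<^sub>F m in sequentially. D m j \<omega> \<le> a j \<longleftrightarrow> E j \<omega> \<le> a j"
        proof (cases "E j \<omega> < a j")
          case True
          from order_tendstoD(2)[OF l(1) True] show ?thesis using True by (auto elim: eventually_mono)
        next
          case False
          with l(2) have "a j < E j \<omega>" by simp
          from order_tendstoD(1)[OF l(1) this] show ?thesis using False l(2) by (auto elim!: eventually_mono)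
        qed
      qed
      then show ?case by eventually_elim auto
    qed
  qed
  define F where "F i = {E i -` A \<inter> space M | A. A \<in> range (\<lambda>a::real. {..a})}" for i
  have "indep_sets F I"
  proof (rule indep_setsI)
    show "F i \<subseteq> events" if "i \<in> I" for i
      using E[OF that] by (auto simp: F_def intro!: measurable_sets)
    fix A J assume J: "J \<noteq> {}" "J \<subseteq> I" "finite J" and A: "\<forall>j\<in>J. A j \<in> F j"
    have "\<forall>j\<in>J. \<exists>a. A j = E j -` {..a} \<inter> space M" using A by (fastforce simp: F_def)
    from bchoice[OF this] obtain a where a: "\<And>j. j \<in> J \<Longrightarrow> A j = E j -` {..a j} \<inter> space M" by auto
    have "(\<lambda>m. prob (\<Inter>j\<in>J. D m j -` {..a j} \<inter> space M)) \<longlonglongrightarrow> prob (\<Inter>j\<in>J. A j)"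
      using conv[OF J(2,3,1), of a] a by (simp cong: INF_cong)
    moreover have "(\<lambda>m. \<Prod>j\<in>J. prob (D m j -` {..a j} \<inter> space M)) \<longlonglongrightarrow> (\<Prod>j\<in>J. prob (A j))"
    proof (rule tendsto_prod)
      fix j assume "j \<in> J"
      then show "(\<lambda>m. prob (D m j -` {..a j} \<inter> space M)) \<longlonglongrightarrow> prob (A j)"
        using conv[of "{j}" a] a[of j] J by auto
    qed
    moreover have "prob (\<Inter>j\<in>J. D m j -` {..a j} \<inter> space M) = (\<Prod>j\<in>J. prob (D m j -` {..a j} \<inter> space M))" for m
      by (rule indep_varsD[OF D J(1,3,2)]) auto
    ultimately show "prob (\<Inter>j\<in>J. A j) = (\<Prod>j\<in>J. prob (A j))"
      by (simp add: LIMSEQ_unique)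
  qed
  then have "indep_sets (\<lambda>i. sigma_sets (space M) (F i)) I"
  proof (rule indep_sets_sigma)
    fix i
    show "Int_stable (F i)"
    proof (rule Int_stableI)
      fix P Q assume "P \<in> F i" "Q \<in> F i"
      then obtain a b where "P = E i -` {..a} \<inter> space M" "Q = E i -` {..b} \<inter> space M" by (auto simp: F_def)
      then have "P \<inter> Q = E i -` {..min a b} \<inter> space M" by auto
      then show "P \<inter> Q \<in> F i" by (auto simp: F_def)
    qed
  qed
  moreover have "{E i -` A \<inter> space M |A. A \<in> sets borel} = sigma_sets (space M) (F i)" for i
  proof -
    have "sets (borel :: real measure) = sigma_sets UNIV (range (\<lambda>a. {..a}))"
      by (subst borel_eq_atMost) (simp add: sets_measure_of)
    then show ?thesis
      unfolding F_def using sigma_sets_vimage_commute[of "E i" "space M" UNIV "range (\<lambda>a. {..a})"] by simp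
  qed
  ultimately show ?thesis
    unfolding indep_vars_def2 using E by simp
qed

lemma fair_walk_char:
  assumes X: "fair_signs X (UNIV :: nat set)" and "finite K"
  shows "char (distr M borel (\<lambda>\<omega>. \<Sum>k\<in>K. real_of_int (X k \<omega>) / c)) u = of_real (cos (u / c) ^ card K)"
proof -
  have "indep_vars (\<lambda>_. borel) (\<lambda>k \<omega>. real_of_int (X k \<omega>) / c) K"
    by (rule indep_vars_compose2[OF indep_vars_subset[OF fair_signs_indep[OF X]], where Y="\<lambda>k x. real_of_int x / c"]) auto
  then have "char (distr M borel (\<lambda>\<omega>. \<Sum>k\<in>K. real_of_int (X k \<omega>) / c)) u
      = (\<Prod>k\<in>K. char (distr M borel (\<lambda>\<omega>. real_of_int (X k \<omega>) / c)) u)"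
    by (rule char_distr_sum)
  also have "\<dots> = (\<Prod>k\<in>K. of_real (cos (u / c)))"
  proof (rule prod.cong[OF refl])
    fix k
    have "(\<lambda>\<omega>. real_of_int (X k \<omega>) / c) \<in> borel_measurable M"
      using measurable_compose[OF fair_signs_measurable[OF X UNIV_I, of k], of "\<lambda>x. real_of_int x / c"] by simp
    then have "char (distr M borel (\<lambda>\<omega>. real_of_int (X k \<omega>) / c)) u = (CLINT \<omega>|M. iexp (u * (real_of_int (X k \<omega>) / c)))"
      by (simp add: char_def integral_distr)
    also have "\<dots> = (iexp (u * (1 / c)) + iexp (u * (-1 / c))) / 2"
      using fair_signs_expectation[OF X UNIV_I, of "\<lambda>x. iexp (u * (real_of_int x / c))" k] by simp
    also have "\<dots> = of_real (cos (u / c))"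
      using cos_of_real[of "u / c", where 'a=complex] by (simp add: cos_exp_eq)
    finally show "char (distr M borel (\<lambda>\<omega>. real_of_int (X k \<omega>) / c)) u = of_real (cos (u / c))" .
  qed
  finally show ?thesis by simp
qed

lemma AE_modulus_bounds:
  fixes Z :: "nat \<times> nat \<Rightarrow> 'a \<Rightarrow> int"
  assumes Z: "fair_signs Z UNIV" and "0 < e"
  shows "AE \<omega> in M. \<exists>K\<ge>1. modulus_bound e K (level (\<lambda>p. Z p \<omega>)) \<and> modulus_bound e K (\<lambda>m k. Z (2 * m + 1, k) \<omega>)"
proof -
  have "AE \<omega> in M. \<exists>K\<ge>1. modulus_bound e K (level (\<lambda>p. Z p \<omega>))"
    unfolding modulus_bound_def by (rule fair_walks_modulus[OF fair_signs_level[OF Z] \<open>0 < e\<close>])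
  moreover have "AE \<omega> in M. \<exists>K\<ge>1. modulus_bound e K (\<lambda>m k. Z (2 * m + 1, k) \<omega>)"
    unfolding modulus_bound_def
    by (rule fair_walks_modulus[OF fair_signs_reindex[OF Z] \<open>0 < e\<close>]) (auto simp: inj_on_def)
  ultimately show ?thesis
  proof eventually_elim
    case (elim \<omega>)
    then obtain K K' where K: "1 \<le> K" "modulus_bound e K (level (\<lambda>p. Z p \<omega>))"
        "1 \<le> K'" "modulus_bound e K' (\<lambda>m k. Z (2 * m + 1, k) \<omega>)"
      by blast
    show ?case
    proof (intro exI[of _ "max K K'"] conjI)
      show "modulus_bound e (max K K') (level (\<lambda>p. Z p \<omega>))" by (rule modulus_bound_mono[OF K(2)]) simp
      show "modulus_bound e (max K K') (\<lambda>m k. Z (2 * m + 1, k) \<omega>)" by (rule modulus_bound_mono[OF K(4)]) simp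
    qed (use K in simp)
  qed
qed

lemma AE_walk_approx_tendsto:
  fixes Z :: "nat \<times> nat \<Rightarrow> 'a \<Rightarrow> int"
  assumes Z: "fair_signs Z UNIV"
  shows "AE \<omega> in M. \<forall>t\<ge>0. (\<lambda>m. walk_approx (\<lambda>p. Z p \<omega>) m t) \<longlonglongrightarrow> brownian (\<lambda>p. Z p \<omega>) t"
    and "AE \<omega> in M. continuous_on {0..} (brownian (\<lambda>p. Z p \<omega>))"
proof -
  have e: "(0::real) < 1/12" "(1/12::real) \<le> 1/12" by simp_all
  have sgn: "AE \<omega> in M. \<forall>p. Z p \<omega> \<in> {-1, 1}"
    using fair_signs_range[OF Z UNIV_I] by (intro AE_I2) blast
  show "AE \<omega> in M. \<forall>t\<ge>0. (\<lambda>m. walk_approx (\<lambda>p. Z p \<omega>) m t) \<longlonglongrightarrow> brownian (\<lambda>p. Z p \<omega>) t"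
    using AE_modulus_bounds[OF Z e(1)] sgn
  proof eventually_elim
    case (elim \<omega>)
    then obtain K where K: "1 \<le> K" "modulus_bound (1/12) K (level (\<lambda>p. Z p \<omega>))"
      "modulus_bound (1/12) K (\<lambda>m k. Z (2 * m + 1, k) \<omega>)" by blast
    from elim(2) have sg: "\<And>p. Z p \<omega> \<in> {-1, 1}" by blast
    show ?case
    proof (intro allI impI)
      fix t :: real assume "0 \<le> t"
      have t: "1 \<le> Suc (nat \<lceil>t\<rceil>)" "t \<le> real (Suc (nat \<lceil>t\<rceil>))" using real_nat_ceiling_ge[of t] by auto
      show "(\<lambda>m. walk_approx (\<lambda>p. Z p \<omega>) m t) \<longlonglongrightarrow> brownian (\<lambda>p. Z p \<omega>) t"
        by (rule walk_approx_brownian[OF sg e K]) (use t \<open>0 \<le> t\<close> in blast)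
    qed
  qed
  show "AE \<omega> in M. continuous_on {0..} (brownian (\<lambda>p. Z p \<omega>))"
    using AE_modulus_bounds[OF Z e(1)] sgn
  proof eventually_elim
    case (elim \<omega>)
    then obtain K where K: "1 \<le> K" "modulus_bound (1/12) K (level (\<lambda>p. Z p \<omega>))"
      "modulus_bound (1/12) K (\<lambda>m k. Z (2 * m + 1, k) \<omega>)" by blast
    from elim(2) have sg: "\<And>p. Z p \<omega> \<in> {-1, 1}" by blast
    show ?case by (rule continuous_brownian[OF sg e K])
  qed
qed

text \<open>Levy's uniqueness theorem, applied to \<open>X / \<sigma>\<close> and the standard normal distribution.\<close>

lemma normal_distributed_char:
  assumes X: "random_variable borel X" and "0 < \<sigma>"
    and ch: "\<And>u. (CLINT \<omega>|M. iexp (u * X \<omega>)) = of_real (exp (- (u\<^sup>2 * \<sigma>\<^sup>2) / 2))"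
  shows "distributed M lborel X (normal_density 0 \<sigma>)"
proof -
  have mY: "(\<lambda>\<omega>. X \<omega> / \<sigma>) \<in> borel_measurable M" using X by simp
  have "distr M borel (\<lambda>\<omega>. X \<omega> / \<sigma>) = std_normal_distribution"
  proof (rule Levy_uniqueness)
    show "real_distribution (distr M borel (\<lambda>\<omega>. X \<omega> / \<sigma>))" using mY by (rule real_distribution_distr)
    show "real_distribution std_normal_distribution" by (rule real_dist_normal_dist)
    show "char (distr M borel (\<lambda>\<omega>. X \<omega> / \<sigma>)) = char std_normal_distribution"
    proof
      fix u
      have "char (distr M borel (\<lambda>\<omega>. X \<omega> / \<sigma>)) u = (CLINT \<omega>|M. iexp ((u / \<sigma>) * X \<omega>))"
        using mY by (simp add: char_def integral_distr)
      also have "\<dots> = of_real (exp (- ((u / \<sigma>)\<^sup>2 * \<sigma>\<^sup>2) / 2))" by (rule ch)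
      also have "(u / \<sigma>)\<^sup>2 * \<sigma>\<^sup>2 = u\<^sup>2" using \<open>0 < \<sigma>\<close> by (simp add: power_divide)
      finally show "char (distr M borel (\<lambda>\<omega>. X \<omega> / \<sigma>)) u = char std_normal_distribution u"
        by (simp add: char_std_normal_distribution)
    qed
  qed
  moreover have "distr M lborel (\<lambda>\<omega>. X \<omega> / \<sigma>) = distr M borel (\<lambda>\<omega>. X \<omega> / \<sigma>)"
    by (rule distr_cong) auto
  ultimately have "distributed M lborel (\<lambda>\<omega>. X \<omega> / \<sigma>) std_normal_density"
    using mY by (simp add: distributed_def)
  then show ?thesis
    using normal_standard_normal_convert[OF \<open>0 < \<sigma>\<close>, of X 0] by simp
qed

text \<open>The increments of level \<open>m\<close> over disjoint time intervals are sums over disjoint blocks of fair signs. Normality of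
the limits follows from the characteristic functions and independence from \<open>indep_vars_AE_limit\<close>.\<close>

lemma wiener_process_brownian:
  fixes Z :: "nat \<times> nat \<Rightarrow> 'a \<Rightarrow> int"
  assumes Z: "fair_signs Z UNIV"
  shows "wiener_process (\<lambda>t \<omega>. brownian (\<lambda>p. Z p \<omega>) t)"
proof -
  define z where "z \<omega> = (\<lambda>p. Z p \<omega>)" for \<omega>
  define n where "n m t = nat \<lfloor>4 ^ m * t\<rfloor>" for m :: nat and t :: real
  define X where "X m k \<omega> = level (z \<omega>) m k" for m k \<omega>
  define I where "I m s t \<omega> = (\<Sum>k\<in>{n m s..<n m t}. real_of_int (X m k \<omega>) / 2 ^ m)" for m s t \<omega>
  have X: "fair_signs (X m) UNIV" for m
    using fair_signs_level[OF Z] by (simp add: X_def[abs_def] z_def)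
  have mono_n: "n m s \<le> n m t" if "s \<le> t" for m s t
    using that by (auto simp: n_def intro!: nat_mono floor_mono)
  have I: "I m s t \<omega> = walk_approx (z \<omega>) m t - walk_approx (z \<omega>) m s" if "s \<le> t" for m s t \<omega>
  proof -
    have "walk x j - walk x i = (\<Sum>k=i..<j. x k)" if "i \<le> j" for x i j
      using that by (simp add: walk_def lessThan_atLeast0 sum_diff_nat_ivl)
    from this[OF mono_n[OF that], of "level (z \<omega>) m" m]
    have "real_of_int (walk (level (z \<omega>) m) (n m t)) - real_of_int (walk (level (z \<omega>) m) (n m s)) = (\<Sum>k=n m s..<n m t. real_of_int (X m k \<omega>))"
      unfolding X_def by (simp flip: of_int_diff of_int_sum)
    then show ?thesis
      by (simp add: I_def walk_approx_def n_def[symmetric] sum_divide_distrib[symmetric] diff_divide_distrib[symmetric])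
  qed
  have mz: "z \<in> measurable M (Pi\<^sub>M UNIV (\<lambda>_. count_space UNIV))"
  proof -
    have "(\<lambda>\<omega>. \<lambda>p\<in>UNIV. Z p \<omega>) \<in> measurable M (Pi\<^sub>M UNIV (\<lambda>_. count_space UNIV))"
      by (intro measurable_restrict fair_signs_measurable[OF Z])
    then show ?thesis by (simp add: z_def[abs_def] restrict_def)
  qed
  have mW[measurable]: "(\<lambda>\<omega>. brownian (z \<omega>) t) \<in> borel_measurable M" for t
    by (rule measurable_compose[OF mz measurable_brownian])
  have mI[measurable]: "I m s t \<in> borel_measurable M" for m s t
  proof -
    have [measurable]: "X m k \<in> measurable M (count_space UNIV)" for k by (rule fair_signs_measurable[OF X UNIV_I])
    show ?thesis unfolding I_def by measurable
  qed
  have lim: "AE \<omega> in M. (\<lambda>m. I m s t \<omega>) \<longlonglongrightarrow> brownian (z \<omega>) t - brownian (z \<omega>) s" if "0 \<le> s" "s \<le> t" for s t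
    using AE_walk_approx_tendsto(1)[OF Z]
  proof eventually_elim
    case (elim \<omega>)
    then show ?case using that unfolding I[OF that(2)] z_def by (intro tendsto_diff) auto
  qed
  have incr: "distributed M lborel (\<lambda>\<omega>. brownian (z \<omega>) t - brownian (z \<omega>) s) (normal_density 0 (sqrt (t - s)))"
    if "0 \<le> s" "s < t" for s t
  proof (rule normal_distributed_char)
    fix u
    have "(\<lambda>m. CLINT \<omega>|M. iexp (u * I m s t \<omega>)) \<longlonglongrightarrow> (CLINT \<omega>|M. iexp (u * (brownian (z \<omega>) t - brownian (z \<omega>) s)))"
    proof (rule integral_dominated_convergence[of _ _ _ "\<lambda>_. 1"])
      show "AE \<omega> in M. (\<lambda>m. iexp (u * I m s t \<omega>)) \<longlonglongrightarrow> iexp (u * (brownian (z \<omega>) t - brownian (z \<omega>) s))"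
        using lim[OF that(1) less_imp_le[OF that(2)]]
        by eventually_elim (intro tendsto_exp tendsto_mult tendsto_const tendsto_of_real)
    qed auto
    moreover have "(CLINT \<omega>|M. iexp (u * I m s t \<omega>)) = of_real (cos (u / 2 ^ m) ^ (n m t - n m s))" for m
    proof -
      have "(CLINT \<omega>|M. iexp (u * I m s t \<omega>)) = char (distr M borel (I m s t)) u"
        by (simp add: char_def integral_distr)
      also have "\<dots> = of_real (cos (u / 2 ^ m) ^ card {n m s..<n m t})"
        unfolding I_def by (rule fair_walk_char[OF X]) simp
      finally show ?thesis by simp
    qed
    moreover have "(\<lambda>m. complex_of_real (cos (u / 2 ^ m) ^ (n m t - n m s))) \<longlonglongrightarrow> of_real (exp (- (u\<^sup>2 * (t - s)) / 2))"
      unfolding n_def using that by (intro tendsto_of_real tendsto_cos_power) auto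
    ultimately show "(CLINT \<omega>|M. iexp (u * (brownian (z \<omega>) t - brownian (z \<omega>) s))) = of_real (exp (- (u\<^sup>2 * (sqrt (t - s))\<^sup>2) / 2))"
      using that by (simp add: LIMSEQ_unique)
  qed (use that in auto)
  have indep: "indep_vars (\<lambda>_. borel) (\<lambda>i \<omega>. brownian (z \<omega>) (t (Suc i)) - brownian (z \<omega>) (t i)) {..<N}"
    if t: "0 \<le> t 0" "\<forall>i<N. t i < t (Suc i)" for N :: nat and t :: "nat \<Rightarrow> real"
  proof (rule indep_vars_AE_limit[where D="\<lambda>m i. I m (t i) (t (Suc i))"])
    have mono_t: "t i \<le> t j" if "i \<le> j" "j \<le> N" for i j
      using that
    proof (induction j rule: dec_induct)
      case (step k)
      then have "t i \<le> t k" "t k < t (Suc k)" using t(2) by auto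
      then show ?case by simp
    qed simp
    have pos: "0 \<le> t i" if "i \<le> N" for i using mono_t[of 0 i] t(1) that by simp
    fix m
    define K where "K i = {n m (t i)..<n m (t (Suc i))}" for i
    have "disjoint_family_on K {..<N}"
      unfolding disjoint_family_on_def
    proof (intro ballI impI)
      have main: "K i \<inter> K j = {}" if "i < j" "j < N" for i j
      proof -
        have "n m (t (Suc i)) \<le> n m (t j)" using that by (intro mono_n mono_t) auto
        then show ?thesis by (auto simp: K_def)
      qed
      fix i j assume "i \<in> {..<N}" "j \<in> {..<N}" "i \<noteq> j"
      then show "K i \<inter> K j = {}" using main[of i j] main[of j i] by (cases "i < j") auto
    qed
    then have "indep_vars (\<lambda>i. Pi\<^sub>M (K i) (\<lambda>_. count_space UNIV)) (\<lambda>i \<omega>. restrict (\<lambda>k. X m k \<omega>) (K i)) {..<N}"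
      by (intro indep_vars_restrict[OF fair_signs_indep[OF X]]) auto
    then have "indep_vars (\<lambda>_. borel) (\<lambda>i \<omega>. \<Sum>k\<in>K i. real_of_int (restrict (\<lambda>k. X m k \<omega>) (K i) k) / 2 ^ m) {..<N}"
    proof (rule indep_vars_compose2[where Y="\<lambda>i x. \<Sum>k\<in>K i. real_of_int (x k) / 2 ^ m"])
      fix i
      have "(\<lambda>x. real_of_int (x k) / 2 ^ m) \<in> borel_measurable (Pi\<^sub>M (K i) (\<lambda>_. count_space UNIV))" if "k \<in> K i" for k
        by (rule measurable_compose[OF measurable_component_singleton[OF that]]) simp
      then show "(\<lambda>x. \<Sum>k\<in>K i. real_of_int (x k) / 2 ^ m) \<in> borel_measurable (Pi\<^sub>M (K i) (\<lambda>_. count_space UNIV))"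
        by (rule borel_measurable_sum)
    qed
    moreover have "(\<Sum>k\<in>K i. real_of_int (restrict (\<lambda>k. X m k \<omega>) (K i) k) / 2 ^ m) = I m (t i) (t (Suc i)) \<omega>" for i \<omega>
      unfolding I_def K_def[symmetric] by (intro sum.cong) auto
    ultimately show "indep_vars (\<lambda>_. borel) (\<lambda>i. I m (t i) (t (Suc i))) {..<N}" by simp
    fix i assume "i \<in> {..<N}"
    then have i: "0 \<le> t i" "t i < t (Suc i)" using pos[of i] t(2) by auto
    show "random_variable borel (\<lambda>\<omega>. brownian (z \<omega>) (t (Suc i)) - brownian (z \<omega>) (t i))" by measurable
    show "AE \<omega> in M. (\<lambda>m. I m (t i) (t (Suc i)) \<omega>) \<longlonglongrightarrow> brownian (z \<omega>) (t (Suc i)) - brownian (z \<omega>) (t i)"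
      using i by (intro lim) auto
    fix a :: real
    have "AE x in lborel. x \<noteq> a" by (rule AE_lborel_singleton)
    then show "AE \<omega> in M. brownian (z \<omega>) (t (Suc i)) - brownian (z \<omega>) (t i) \<noteq> a"
      using distributed_AE2[OF incr[OF i], of "\<lambda>x. x \<noteq> a"] by auto
  qed
  have "wiener_process (\<lambda>t \<omega>. brownian (z \<omega>) t)"
    unfolding wiener_process_def
    using mW incr indep AE_walk_approx_tendsto(2)[OF Z] by (simp add: z_def)
  then show ?thesis by (simp add: z_def)
qed

end

section \<open>The walk on the comb\<close>

text \<open>The pair \<open>(h, u)\<close> counts the horizontal steps and the vertical steps that start on \<open>B\<close>. A direction coin is
tossed only on \<open>B\<close>, hence \<open>h + u\<close> coins have been used so far. Indexing the coins by visits and not by time makes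
\<open>h - u\<close> a simple random walk at time \<open>h + u\<close> (\<open>comb_counts_balance\<close>).\<close>

fun comb_counts :: "int set \<Rightarrow> (nat \<Rightarrow> int) \<Rightarrow> (nat \<Rightarrow> int) \<Rightarrow> nat \<Rightarrow> nat \<times> nat" where
  "comb_counts B y e 0 = (0, 0)"
| "comb_counts B y e (Suc n) = (let (h, u) = comb_counts B y e n in
     if walk y (n - h) \<in> B then if e (h + u) = 1 then (Suc h, u) else (h, Suc u) else (h, u))"

definition comb_path :: "int set \<Rightarrow> (nat \<Rightarrow> int) \<Rightarrow> (nat \<Rightarrow> int) \<Rightarrow> (nat \<Rightarrow> int) \<Rightarrow> nat \<Rightarrow> int \<times> int" where
  "comb_path B x y e n = (let h = fst (comb_counts B y e n) in (walk x h, walk y (n - h)))"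

lemma comb_counts_le: "fst (comb_counts B y e n) + snd (comb_counts B y e n) \<le> n"
  by (induction n) (auto simp: Let_def split: prod.split)

lemma comb_counts_balance:
  assumes "\<And>k. e k \<in> {-1, 1}"
  shows "walk e (fst (comb_counts B y e n) + snd (comb_counts B y e n))
    = int (fst (comb_counts B y e n)) - int (snd (comb_counts B y e n))"
proof (induction n)
  case (Suc n)
  obtain h u where "comb_counts B y e n = (h, u)" by (cases "comb_counts B y e n")
  then show ?case using Suc assms[of "h + u"] by (auto simp: walk_Suc)
qed simp

lemma comb_counts_vertical:
  "snd (comb_counts B y e n) = card {k. k < n - fst (comb_counts B y e n) \<and> walk y k \<in> B}"
proof (induction n)
  case (Suc n)
  obtain h u where hu: "comb_counts B y e n = (h, u)" by (cases "comb_counts B y e n")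
  have "h \<le> n" using comb_counts_le[of B y e n] hu by simp
  then have "{k. k < Suc n - h \<and> walk y k \<in> B} = (if walk y (n - h) \<in> B
      then insert (n - h) {k. k < n - h \<and> walk y k \<in> B} else {k. k < n - h \<and> walk y k \<in> B})"
    by (auto simp: Suc_diff_le less_Suc_eq)
  then show ?case using Suc hu by auto
qed simp

lemma snd_comb_path: "snd (comb_path B x y e n) = walk y (n - fst (comb_counts B y e n))"
  by (simp add: comb_path_def Let_def)

lemma vert_steps_comb_path:
  assumes "\<And>k. y k \<in> {-1, 1}"
  shows "vert_steps (comb_path B x y e) n = n - fst (comb_counts B y e n)"
proof (induction n)
  case 0
  then show ?case by (simp add: vert_steps_def)
next
  case (Suc n)
  let ?c = "comb_path B x y e"
  obtain h u where hu: "comb_counts B y e n = (h, u)" by (cases "comb_counts B y e n")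
  have "h \<le> n" using comb_counts_le[of B y e n] hu by simp
  have "{k. 1 \<le> k \<and> k \<le> Suc n \<and> snd (?c k) \<noteq> snd (?c (k - 1))} =
      (if snd (?c (Suc n)) \<noteq> snd (?c n) then insert (Suc n) {k. 1 \<le> k \<and> k \<le> n \<and> snd (?c k) \<noteq> snd (?c (k - 1))}
       else {k. 1 \<le> k \<and> k \<le> n \<and> snd (?c k) \<noteq> snd (?c (k - 1))})"
    by (auto simp: le_Suc_eq)
  then have "vert_steps ?c (Suc n) = (if snd (?c (Suc n)) \<noteq> snd (?c n) then Suc (vert_steps ?c n) else vert_steps ?c n)"
    by (simp add: vert_steps_def)
  also have "\<dots> = Suc n - fst (comb_counts B y e (Suc n))"
    using Suc hu \<open>h \<le> n\<close> assms[of "n - h"] by (auto simp: snd_comb_path walk_Suc Suc_diff_le)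
  finally show ?case .
qed

lemma vert_walk_comb_path:
  assumes y: "\<And>k. y k \<in> {-1, 1}" and k: "k \<le> vert_steps (comb_path B x y e) n"
  shows "vert_walk (comb_path B x y e) k = walk y k"
proof -
  let ?c = "comb_path B x y e"
  have "\<exists>m. vert_steps ?c m = k"
    using k
  proof (induction n)
    case 0
    then show ?case by (auto simp: vert_steps_comb_path[OF y] intro!: exI[of _ 0])
  next
    case (Suc n)
    have "vert_steps ?c (Suc n) \<le> Suc (vert_steps ?c n)"
      unfolding vert_steps_comb_path[OF y] by (auto simp: Let_def split: prod.split)
    with Suc show ?case by (cases "k = vert_steps ?c (Suc n)") auto
  qed
  then have "vert_steps ?c (LEAST m. vert_steps ?c m = k) = k" by (rule LeastI_ex)
  moreover have "snd (?c m) = walk y (vert_steps ?c m)" for m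
    by (simp add: vert_steps_comb_path[OF y] snd_comb_path)
  ultimately show ?thesis by (simp add: vert_walk_def)
qed

text \<open>The occupation time counts the visits at the times 1 to \<open>v\<close> of the vertical walk, whereas a vertical step leaves a
visit at a time 0 to \<open>v - 1\<close>; this shift accounts for the difference of at most 1.\<close>

lemma vert_occupation_comb_path:
  fixes B x y e
  assumes y: "\<And>k. y k \<in> {-1, 1}"
  defines "c \<equiv> comb_path B x y e"
  shows "\<bar>real (vert_occupation B c (vert_steps c n)) - real (snd (comb_counts B y e n))\<bar> \<le> 1"
    and "vert_occupation B c (vert_steps c n) \<le> n"
proof -
  define v where "v = vert_steps c n"
  define P where "P = {k. 0 < k \<and> k \<le> v \<and> walk y k \<in> B}"
  define Q where "Q = {k. k < v \<and> walk y k \<in> B}"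
  have v: "v = n - fst (comb_counts B y e n)" unfolding v_def c_def by (rule vert_steps_comb_path[OF y])
  have D: "vert_occupation B c (vert_steps c n) = card P"
  proof -
    have "vert_walk c k = walk y k" if "k \<le> v" for k
      using that unfolding v_def c_def by (rule vert_walk_comb_path[OF y])
    then show ?thesis unfolding vert_occupation_eq_card P_def v_def[symmetric]
      by (intro arg_cong[of _ _ card]) auto
  qed
  have U: "snd (comb_counts B y e n) = card Q" unfolding Q_def v by (rule comb_counts_vertical)
  have "finite P" "finite Q" by (auto simp: P_def Q_def)
  have "card P \<le> card (insert v Q)" by (rule card_mono) (auto simp: P_def Q_def)
  moreover have "card (insert v Q) \<le> Suc (card Q)" by (rule card_insert_le_m1) auto
  moreover have "card Q \<le> card (insert 0 P)" by (rule card_mono) (auto simp: P_def Q_def)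
  moreover have "card (insert 0 P) \<le> Suc (card P)" by (rule card_insert_le_m1) auto
  ultimately show "\<bar>real (vert_occupation B c (vert_steps c n)) - real (snd (comb_counts B y e n))\<bar> \<le> 1"
    unfolding D U by linarith
  have "card P \<le> card {1..v}" by (rule card_mono) (auto simp: P_def)
  then show "vert_occupation B c (vert_steps c n) \<le> n" unfolding D by (simp add: v)
qed

text \<open>From here on the horizontal signs, the vertical signs and the direction coins are the rows 0, 1 and 2 of one
family.\<close>

abbreviation row_counts :: "int set \<Rightarrow> (nat \<times> nat \<Rightarrow> int) \<Rightarrow> nat \<Rightarrow> nat \<times> nat" where
  "row_counts B g n \<equiv> comb_counts B (\<lambda>k. g (1, k)) (\<lambda>k. g (2, k)) n"

definition row_path :: "int set \<Rightarrow> (nat \<times> nat \<Rightarrow> int) \<Rightarrow> nat \<Rightarrow> int \<times> int" where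
  "row_path B g = comb_path B (\<lambda>k. g (0, k)) (\<lambda>k. g (1, k)) (\<lambda>k. g (2, k))"

definition signs_used :: "int set \<Rightarrow> (nat \<times> nat \<Rightarrow> int) \<Rightarrow> nat \<Rightarrow> (nat \<times> nat) set" where
  "signs_used B g n = (let (h, u) = row_counts B g n in
     {0} \<times> {..<h} \<union> {1} \<times> {..<n - h} \<union> {2} \<times> {..<h + u})"

lemma finite_signs_used: "finite (signs_used B g n)"
  by (auto simp: signs_used_def Let_def split: prod.split)

lemma signs_used_Suc:
  assumes "row_counts B g n = (h, u)"
  shows "signs_used B g (Suc n) = (if walk (\<lambda>k. g (1, k)) (n - h) \<in> B
    then if g (2, h + u) = 1 then insert (2, h + u) (insert (0, h) (signs_used B g n))
      else insert (2, h + u) (insert (1, n - h) (signs_used B g n))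
    else insert (1, n - h) (signs_used B g n))"
proof -
  have "h \<le> n" using comb_counts_le[of B "\<lambda>k. g (1, k)" "\<lambda>k. g (2, k)" n] assms by simp
  then show ?thesis
    using assms by (auto simp: signs_used_def less_Suc_eq Suc_diff_le)
qed

lemma row_path_Suc:
  assumes "row_counts B g n = (h, u)"
  shows "row_path B g (Suc n) = (if walk (\<lambda>k. g (1, k)) (n - h) \<in> B \<and> g (2, h + u) = 1
    then (fst (row_path B g n) + g (0, h), snd (row_path B g n))
    else (fst (row_path B g n), snd (row_path B g n) + g (1, n - h)))"
proof -
  have "h \<le> n" using comb_counts_le[of B "\<lambda>k. g (1, k)" "\<lambda>k. g (2, k)" n] assms by simp
  then show ?thesis
    using assms by (auto simp: row_path_def comb_path_def walk_Suc Suc_diff_le)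
qed

lemma row_counts_cong:
  assumes "\<And>j. j \<in> signs_used B g n \<Longrightarrow> g j = g' j"
  shows "row_counts B g n = row_counts B g' n" and "\<And>k. k \<le> n \<Longrightarrow> row_path B g k = row_path B g' k"
proof -
  have "row_counts B g n = row_counts B g' n \<and> (\<forall>k\<le>n. row_path B g k = row_path B g' k)"
    using assms
  proof (induction n)
    case 0
    then show ?case by (simp add: row_path_def comb_path_def)
  next
    case (Suc n)
    obtain h u where hu: "row_counts B g n = (h, u)" by (cases "row_counts B g n")
    note su = signs_used_Suc[OF hu]
    have "signs_used B g n \<subseteq> signs_used B g (Suc n)" unfolding su by auto
    then have IH: "row_counts B g n = row_counts B g' n" "\<forall>k\<le>n. row_path B g k = row_path B g' k"
      using Suc by (metis subsetD)+
    with hu have hu': "row_counts B g' n = (h, u)" by simp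
    have "snd (row_path B g n) = snd (row_path B g' n)" using IH(2) by simp
    then have w: "walk (\<lambda>k. g (1, k)) (n - h) = walk (\<lambda>k. g' (1, k)) (n - h)"
      using hu hu' by (simp add: row_path_def comb_path_def)
    have e: "g (2, h + u) = g' (2, h + u)" if "walk (\<lambda>k. g (1, k)) (n - h) \<in> B"
      using that by (intro Suc.prems) (simp add: su)
    have x: "g (0, h) = g' (0, h)" if "walk (\<lambda>k. g (1, k)) (n - h) \<in> B" "g (2, h + u) = 1"
      using that by (intro Suc.prems) (simp add: su)
    have v: "g (1, n - h) = g' (1, n - h)" if "\<not> (walk (\<lambda>k. g (1, k)) (n - h) \<in> B \<and> g (2, h + u) = 1)"
      using that by (intro Suc.prems) (auto simp: su)
    have "row_counts B g (Suc n) = row_counts B g' (Suc n)"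
      using hu hu' w e by simp
    moreover have "row_path B g (Suc n) = row_path B g' (Suc n)"
      unfolding row_path_Suc[OF hu] row_path_Suc[OF hu'] using w e x v IH(2) by auto
    ultimately show ?case using IH(2) by (auto simp: le_Suc_eq)
  qed
  then show "row_counts B g n = row_counts B g' n" "\<And>k. k \<le> n \<Longrightarrow> row_path B g k = row_path B g' k" by auto
qed

text \<open>A trajectory reveals exactly the signs that it has used: the kind of a step shows the direction coin, as vertical steps
change the second coordinate and horizontal steps do not.\<close>

lemma row_path_eq_iff:
  assumes g: "\<And>j. g j \<in> {-1, 1}" and g': "\<And>j. g' j \<in> {-1, 1}"
  shows "(\<forall>k\<le>n. row_path B g k = row_path B g' k) \<longleftrightarrow> (\<forall>j\<in>signs_used B g n. g j = g' j)"
proof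
  assume "\<forall>k\<le>n. row_path B g k = row_path B g' k"
  then show "\<forall>j\<in>signs_used B g n. g j = g' j"
  proof (induction n)
    case 0
    then show ?case by (simp add: signs_used_def)
  next
    case (Suc n)
    then have IH: "\<forall>j\<in>signs_used B g n. g j = g' j" by simp
    obtain h u where hu: "row_counts B g n = (h, u)" by (cases "row_counts B g n")
    then have hu': "row_counts B g' n = (h, u)" using row_counts_cong(1)[of B g n g'] IH by simp
    have pn: "row_path B g n = row_path B g' n" and ps: "row_path B g (Suc n) = row_path B g' (Suc n)"
      using Suc.prems by auto
    have w: "walk (\<lambda>k. g (1, k)) (n - h) = walk (\<lambda>k. g' (1, k)) (n - h)"
      using pn hu hu' by (simp add: row_path_def comb_path_def)
    have nz: "g j \<noteq> 0" "g' j \<noteq> 0" for j using g[of j] g'[of j] by auto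
    have st: "(if walk (\<lambda>k. g (1, k)) (n - h) \<in> B \<and> g (2, h + u) = 1 then (g (0, h), 0) else (0, g (1, n - h)))
      = (if walk (\<lambda>k. g (1, k)) (n - h) \<in> B \<and> g' (2, h + u) = 1 then (g' (0, h), 0) else (0, g' (1, n - h)))"
      using ps unfolding row_path_Suc[OF hu] row_path_Suc[OF hu'] pn w by (auto split: if_splits)
    show ?case
      unfolding signs_used_Suc[OF hu] using st IH nz g[of "(2, h + u)"] g'[of "(2, h + u)"]
      by (auto split: if_splits)
  qed
next
  assume "\<forall>j\<in>signs_used B g n. g j = g' j"
  then show "\<forall>k\<le>n. row_path B g k = row_path B g' k" using row_counts_cong(2)[of B g n g'] by auto
qed

lemma pmf_comb_step:
  "pmf (comb_step B (x, y)) z = (if y \<in> B then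
     (if z \<in> {(x + 1, y), (x - 1, y), (x, y + 1), (x, y - 1)} then 1/4 else 0)
     else (if z \<in> {(x, y + 1), (x, y - 1)} then 1/2 else 0))"
proof -
  have fin: "finite (comb_nbrs B (x, y))" "comb_nbrs B (x, y) \<noteq> {}" by (auto simp: comb_nbrs_def)
  have c: "card (comb_nbrs B (x, y)) = (if y \<in> B then 4 else 2)" by (simp add: comb_nbrs_def)
  show ?thesis
    unfolding comb_step_def pmf_of_set[OF fin(2,1)] c by (auto simp: comb_nbrs_def indicator_def)
qed

context prob_space begin

text \<open>By \<open>row_path_eq_iff\<close> the event that the past is \<open>z\<close> is a cylinder over the signs used so far. The next
step reads one or two fresh signs, so that conditioning on the past multiplies the probability by 1/2 or 1/4.\<close>

lemma comb_walk_row_path: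
  fixes G :: "nat \<times> nat \<Rightarrow> 'a \<Rightarrow> int"
  assumes G: "fair_signs G UNIV"
  shows "comb_walk B (\<lambda>n \<omega>. row_path B (\<lambda>j. G j \<omega>) n)"
  unfolding comb_walk_def
proof (intro conjI allI ballI impI)
  let ?g = "\<lambda>\<omega> j. G j \<omega>"
  note sgn = fair_signs_range[OF G UNIV_I]
  show "random_variable (count_space UNIV) (\<lambda>\<omega>. row_path B (?g \<omega>) N)" for N
  proof (rule measurable_finite_dependence[of "{..2} \<times> {..<N}" G])
    fix \<omega> \<omega>' assume eq: "\<And>i. i \<in> {..2} \<times> {..<N} \<Longrightarrow> G i \<omega> = G i \<omega>'"
    obtain h u where hu: "row_counts B (?g \<omega>) N = (h, u)" by (cases "row_counts B (?g \<omega>) N")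
    then have "h + u \<le> N" using comb_counts_le[of B "\<lambda>k. G (1, k) \<omega>" "\<lambda>k. G (2, k) \<omega>" N] by simp
    then have "signs_used B (?g \<omega>) N \<subseteq> {..2} \<times> {..<N}" using hu by (auto simp: signs_used_def)
    then show "row_path B (?g \<omega>) N = row_path B (?g \<omega>') N"
      by (intro row_counts_cong(2)[OF _ order_refl]) (auto intro: eq)
  qed (use fair_signs_measurable[OF G] in auto)
  show "row_path B (?g \<omega>) 0 = (0, 0)" for \<omega> by (simp add: row_path_def comb_path_def)
  fix N and z :: "nat \<Rightarrow> int \<times> int" and z'
  assume pos: "0 < \<P>(\<omega> in M. \<forall>k\<le>N. row_path B (?g \<omega>) k = z k)"
  \<comment> \<open>a trajectory with the given past, which identifies the signs used and their values\<close>
  then obtain \<omega>0 where \<omega>0: "\<omega>0 \<in> space M" "\<forall>k\<le>N. row_path B (?g \<omega>0) k = z k"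
    by (cases "{\<omega> \<in> space M. \<forall>k\<le>N. row_path B (?g \<omega>) k = z k} = {}") auto
  define g where "g = ?g \<omega>0"
  define U where "U = signs_used B g N"
  have g: "g j \<in> {-1, 1}" for j using sgn[OF \<omega>0(1)] by (simp add: g_def)
  obtain h u where hu: "row_counts B g N = (h, u)" by (cases "row_counts B g N")
  obtain a b where ab: "z N = (a, b)" by (cases "z N")
  have zN: "row_path B g N = (a, b)" using \<omega>0(2) ab by (simp add: g_def)
  then have b: "b = walk (\<lambda>k. g (1, k)) (N - h)" using hu by (simp add: row_path_def comb_path_def)
  have finU: "finite U" by (simp add: U_def finite_signs_used)
  have fresh: "(0, h) \<notin> U" "(1, N - h) \<notin> U" "(2, h + u) \<notin> U" using hu by (auto simp: U_def signs_used_def)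
  have past: "(\<forall>k\<le>N. row_path B (?g \<omega>) k = z k) \<longleftrightarrow> (\<forall>j\<in>U. G j \<omega> = g j)" if "\<omega> \<in> space M" for \<omega>
  proof -
    have "(\<forall>k\<le>N. row_path B (?g \<omega>) k = z k) \<longleftrightarrow> (\<forall>k\<le>N. row_path B g k = row_path B (?g \<omega>) k)"
      using \<omega>0(2) unfolding g_def by metis
    also have "\<dots> \<longleftrightarrow> (\<forall>j\<in>U. g j = G j \<omega>)"
      unfolding U_def by (rule row_path_eq_iff[OF g sgn[OF that]])
    also have "\<dots> \<longleftrightarrow> (\<forall>j\<in>U. G j \<omega> = g j)" by metis
    finally show ?thesis .
  qed
  have nxt: "row_path B (?g \<omega>) (Suc N) = (if b \<in> B \<and> G (2, h + u) \<omega> = 1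
      then (a + G (0, h) \<omega>, b) else (a, b + G (1, N - h) \<omega>))"
    if "\<omega> \<in> space M" "\<forall>j\<in>U. G j \<omega> = g j" for \<omega>
  proof -
    have "row_counts B (?g \<omega>) N = (h, u)" "row_path B (?g \<omega>) N = (a, b)"
      using row_counts_cong(1)[of B g N "?g \<omega>"] row_counts_cong(2)[of B g N "?g \<omega>" N] that(2) hu zN
      by (simp_all add: U_def)
    moreover from this have "b = walk (\<lambda>k. G (1, k) \<omega>) (N - h)" by (simp add: row_path_def comb_path_def)
    ultimately show ?thesis using row_path_Suc[of B "?g \<omega>" N h u] by simp
  qed
  have cyl: "\<P>(\<omega> in M. \<forall>j\<in>U \<union> L. G j \<omega> = f j) = (1/2) ^ card U * (1/2) ^ card L"
    if "finite L" "U \<inter> L = {}" "\<And>j. f j \<in> {-1, 1}" for L f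
    using fair_signs_cylinder[OF G, of "U \<union> L" f] that finU by (simp add: card_Un_disjoint power_add)
  have pU: "\<P>(\<omega> in M. \<forall>k\<le>N. row_path B (?g \<omega>) k = z k) = (1/2) ^ card U"
  proof -
    have "{\<omega> \<in> space M. \<forall>k\<le>N. row_path B (?g \<omega>) k = z k} = {\<omega> \<in> space M. \<forall>j\<in>U \<union> {}. G j \<omega> = g j}"
      using past by auto
    then show ?thesis using cyl[of "{}" g] g by simp
  qed
  have joint: "\<P>(\<omega> in M. row_path B (?g \<omega>) (Suc N) = z' \<and> (\<forall>k\<le>N. row_path B (?g \<omega>) k = z k))
      = (1/2) ^ card U * pmf (comb_step B (a, b)) z'"
  proof -
    define E where "E = {\<omega> \<in> space M. row_path B (?g \<omega>) (Suc N) = z' \<and> (\<forall>k\<le>N. row_path B (?g \<omega>) k = z k)}"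
    have E: "E = {\<omega> \<in> space M. (\<forall>j\<in>U. G j \<omega> = g j) \<and> (if b \<in> B \<and> G (2, h + u) \<omega> = 1
      then (a + G (0, h) \<omega>, b) else (a, b + G (1, N - h) \<omega>)) = z'}"
      unfolding E_def
    proof (rule Collect_cong, rule conj_cong[OF refl])
      fix \<omega> assume \<omega>: "\<omega> \<in> space M"
      show "(row_path B (?g \<omega>) (Suc N) = z' \<and> (\<forall>k\<le>N. row_path B (?g \<omega>) k = z k)) \<longleftrightarrow>
        (\<forall>j\<in>U. G j \<omega> = g j) \<and> (if b \<in> B \<and> G (2, h + u) \<omega> = 1
          then (a + G (0, h) \<omega>, b) else (a, b + G (1, N - h) \<omega>)) = z'"
        unfolding past[OF \<omega>] using nxt[OF \<omega>] by (metis (no_types))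
    qed
    have Ecyl: "E = {\<omega> \<in> space M. \<forall>j\<in>U \<union> {p, q}. G j \<omega> = (g(p := s, q := t)) j}"
      if "p \<notin> U" "q \<notin> U" "p \<noteq> q \<or> s = t"
        and "\<And>\<omega>. \<omega> \<in> space M \<Longrightarrow> (if b \<in> B \<and> G (2, h + u) \<omega> = 1
          then (a + G (0, h) \<omega>, b) else (a, b + G (1, N - h) \<omega>)) = z' \<longleftrightarrow> G p \<omega> = s \<and> G q \<omega> = t" for p q s t
      unfolding E
    proof (rule Collect_cong, rule conj_cong[OF refl])
      fix \<omega> assume \<omega>: "\<omega> \<in> space M"
      have "(\<forall>j\<in>U. G j \<omega> = (g(p := s, q := t)) j) \<longleftrightarrow> (\<forall>j\<in>U. G j \<omega> = g j)"
        using that(1,2) by auto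
      moreover have "(\<forall>j\<in>{p, q}. G j \<omega> = (g(p := s, q := t)) j) \<longleftrightarrow> G p \<omega> = s \<and> G q \<omega> = t"
        using that(3) by auto
      ultimately show "((\<forall>j\<in>U. G j \<omega> = g j) \<and> (if b \<in> B \<and> G (2, h + u) \<omega> = 1
          then (a + G (0, h) \<omega>, b) else (a, b + G (1, N - h) \<omega>)) = z') \<longleftrightarrow>
        (\<forall>j\<in>U \<union> {p, q}. G j \<omega> = (g(p := s, q := t)) j)"
        unfolding ball_Un that(4)[OF \<omega>] by simp
    qed
    \<comment> \<open>for a vertical step off \<open>B\<close> only one fresh sign is read; this is the case \<open>p = q\<close>\<close>
    have prE: "prob E = (1/2) ^ card U * (1/2) ^ card {p, q}"
      if "p \<notin> U" "q \<notin> U" "p \<noteq> q \<or> s = t" "s \<in> {-1, 1}" "t \<in> {-1, 1}"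
        and "\<And>\<omega>. \<omega> \<in> space M \<Longrightarrow> (if b \<in> B \<and> G (2, h + u) \<omega> = 1
          then (a + G (0, h) \<omega>, b) else (a, b + G (1, N - h) \<omega>)) = z' \<longleftrightarrow> G p \<omega> = s \<and> G q \<omega> = t" for p q s t
    proof -
      have "E = {\<omega> \<in> space M. \<forall>j\<in>U \<union> {p, q}. G j \<omega> = (g(p := s, q := t)) j}"
        by (rule Ecyl[OF that(1-3)]) (rule that(6))
      also have "prob \<dots> = (1/2) ^ card U * (1/2) ^ card {p, q}"
      proof (rule cyl)
        show "(g(p := s, q := t)) j \<in> {-1, 1}" for j using g[of j] that(4,5) by auto
      qed (use that(1,2) in auto)
      finally show ?thesis .
    qed
    have none: "E = {}" if "z' \<notin> comb_nbrs B (a, b)"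
    proof -
      have "(if b \<in> B \<and> G (2, h + u) \<omega> = 1 then (a + G (0, h) \<omega>, b) else (a, b + G (1, N - h) \<omega>)) \<in> comb_nbrs B (a, b)"
        if "\<omega> \<in> space M" for \<omega>
        using sgn[OF that, of "(0, h)"] sgn[OF that, of "(1, N - h)"] by (auto simp: comb_nbrs_def)
      then show ?thesis using that unfolding E by blast
    qed
    consider "z' \<notin> comb_nbrs B (a, b)"
      | s where "s \<in> {-1, 1}" "b \<notin> B" "z' = (a, b + s)"
      | s where "s \<in> {-1, 1}" "b \<in> B" "z' = (a, b + s)"
      | s where "s \<in> {-1, 1}" "b \<in> B" "z' = (a + s, b)"
    proof (cases "z' \<in> comb_nbrs B (a, b)")
      case True
      then show ?thesis
        using that(2)[of 1] that(2)[of "-1"] that(3)[of 1] that(3)[of "-1"] that(4)[of 1] that(4)[of "-1"]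
        by (auto simp: comb_nbrs_def split: if_splits)
    qed (use that(1) in blast)
    then have "prob E = (1/2) ^ card U * pmf (comb_step B (a, b)) z'"
    proof cases
      case 1
      then show ?thesis using none by (auto simp: pmf_comb_step comb_nbrs_def split: if_splits)
    next
      case 2
      then have "prob E = (1/2) ^ card U * (1/2) ^ card {(1, N - h), (1::nat, N - h)}"
        using fresh by (intro prE[of _ _ s s]) auto
      then show ?thesis using 2 by (auto simp: pmf_comb_step)
    next
      case 3
      have "prob E = (1/2) ^ card U * (1/2) ^ card {(2, h + u), (1::nat, N - h)}"
      proof (rule prE[of _ _ "-1" s])
        fix \<omega> assume "\<omega> \<in> space M"
        from sgn[OF this, of "(0, h)"] sgn[OF this, of "(2, h + u)"] 3
        show "(if b \<in> B \<and> G (2, h + u) \<omega> = 1 then (a + G (0, h) \<omega>, b) else (a, b + G (1, N - h) \<omega>)) = z' \<longleftrightarrow>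
            G (2, h + u) \<omega> = -1 \<and> G (1, N - h) \<omega> = s"
          by auto
      qed (use fresh 3 in auto)
      then show ?thesis using 3 by (auto simp: pmf_comb_step)
    next
      case 4
      have "prob E = (1/2) ^ card U * (1/2) ^ card {(2, h + u), (0::nat, h)}"
      proof (rule prE[of _ _ 1 s])
        fix \<omega> assume "\<omega> \<in> space M"
        from sgn[OF this, of "(1, N - h)"] sgn[OF this, of "(2, h + u)"] 4
        show "(if b \<in> B \<and> G (2, h + u) \<omega> = 1 then (a + G (0, h) \<omega>, b) else (a, b + G (1, N - h) \<omega>)) = z' \<longleftrightarrow>
            G (2, h + u) \<omega> = 1 \<and> G (0, h) \<omega> = s"
          by auto
      qed (use fresh 4 in auto)
      then show ?thesis using 4 by (auto simp: pmf_comb_step)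
    qed
    then show ?thesis by (simp add: E_def)
  qed
  show "\<P>(\<omega> in M. row_path B (?g \<omega>) (Suc N) = z' \<bar> \<forall>k\<le>N. row_path B (?g \<omega>) k = z k) = pmf (comb_step B (z N)) z'"
    unfolding cond_prob_def joint pU ab by simp
qed

end

section \<open>The occupation time\<close>

lemma abs_step:
  fixes a j s :: int
  assumes "s \<in> {-1, 1}"
  shows "\<bar>a + s - j\<bar> = \<bar>a - j\<bar> + (if a = j then 1 else 0) + sgn (a - j) * s"
  using assms by (auto simp: sgn_if)

text \<open>The discrete Tanaka formula, summed over the points \<open>j\<close> of \<open>F\<close>. It expresses the occupation time of \<open>F\<close> by the
position of the walk and a sum with predictable multipliers bounded by \<open>card F\<close>, which \<open>fair_signs_azuma\<close>
controls without any estimate of transition probabilities.\<close>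

lemma tanaka_occupation:
  assumes x: "\<And>k. x k \<in> {-1, 1::int}" and F: "finite F"
  shows "(\<Sum>j\<in>F. \<bar>walk x n - j\<bar>) = (\<Sum>j\<in>F. \<bar>j\<bar>) + int (card {k. k < n \<and> walk x k \<in> F})
    + (\<Sum>k<n. (\<Sum>j\<in>F. sgn (walk x k - j)) * x k)"
proof (induction n)
  case (Suc n)
  have "{k. k < Suc n \<and> walk x k \<in> F} = (if walk x n \<in> F
      then insert n {k. k < n \<and> walk x k \<in> F} else {k. k < n \<and> walk x k \<in> F})"
    by (auto simp: less_Suc_eq)
  then have c: "int (card {k. k < Suc n \<and> walk x k \<in> F}) = int (card {k. k < n \<and> walk x k \<in> F}) + (if walk x n \<in> F then 1 else 0)"
    by simp
  have "(\<Sum>j\<in>F. \<bar>walk x (Suc n) - j\<bar>) = (\<Sum>j\<in>F. \<bar>walk x n - j\<bar> + (if walk x n = j then 1 else 0) + sgn (walk x n - j) * x n)"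
    unfolding walk_Suc using abs_step[OF x] by (intro sum.cong) auto
  also have "\<dots> = (\<Sum>j\<in>F. \<bar>walk x n - j\<bar>) + (if walk x n \<in> F then 1 else 0) + (\<Sum>j\<in>F. sgn (walk x n - j)) * x n"
    using F by (simp add: sum.distrib sum_distrib_right sum.delta')
  finally show ?case unfolding c Suc.IH by simp
qed simp

lemma occupation_le:
  assumes x: "\<And>k. x k \<in> {-1, 1::int}" and F: "finite F"
  shows "real (card {k. k < n \<and> walk x k \<in> F}) \<le> real (card F) * \<bar>real_of_int (walk x n)\<bar>
    + \<bar>\<Sum>k<n. real_of_int (\<Sum>j\<in>F. sgn (walk x k - j)) * real_of_int (x k)\<bar>"
proof -
  have "(\<Sum>j\<in>F. \<bar>walk x n - j\<bar>) - (\<Sum>j\<in>F. \<bar>j\<bar>) \<le> int (card F) * \<bar>walk x n\<bar>"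
  proof -
    have "(\<Sum>j\<in>F. \<bar>walk x n - j\<bar> - \<bar>j\<bar>) \<le> (\<Sum>j\<in>F. \<bar>walk x n\<bar>)" by (intro sum_mono) auto
    then show ?thesis by (simp add: sum_subtractf)
  qed
  then have "int (card {k. k < n \<and> walk x k \<in> F}) \<le> int (card F) * \<bar>walk x n\<bar>
      + \<bar>\<Sum>k<n. (\<Sum>j\<in>F. sgn (walk x k - j)) * x k\<bar>"
    using tanaka_occupation[of x F n, OF x F] by linarith
  then have "real_of_int (int (card {k. k < n \<and> walk x k \<in> F})) \<le> real_of_int (int (card F) * \<bar>walk x n\<bar>
      + \<bar>\<Sum>k<n. (\<Sum>j\<in>F. sgn (walk x k - j)) * x k\<bar>)"
    by (simp only: of_int_le_iff)
  then show ?thesis by simp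
qed

lemma bigo_powr_uniform:
  fixes f :: "nat \<Rightarrow> real"
  assumes f: "f \<in> O(\<lambda>n. real n powr a)" and "0 \<le> a"
  obtains K where "1 \<le> K" "\<And>n. 1 \<le> n \<Longrightarrow> \<bar>f n\<bar> \<le> K * real n powr a"
proof -
  from f obtain c where "0 < c" and ev: "\<forall>\<^sub>F n in at_top. norm (f n) \<le> c * norm (real n powr a)"
    by (rule landau_o.bigE)
  then obtain N where N: "\<And>n. N \<le> n \<Longrightarrow> \<bar>f n\<bar> \<le> c * real n powr a" by (auto simp: eventually_sequentially)
  define K where "K = 1 + c + (\<Sum>n<N. \<bar>f n\<bar>)"
  have S0: "0 \<le> (\<Sum>n<N. \<bar>f n\<bar>)" by (rule sum_nonneg) simp
  show thesis
  proof
    show "1 \<le> K" using \<open>0 < c\<close> S0 by (simp add: K_def)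
    fix n :: nat assume n: "1 \<le> n"
    have p: "1 \<le> real n powr a" using n \<open>0 \<le> a\<close> by (simp add: ge_one_powr_ge_zero)
    show "\<bar>f n\<bar> \<le> K * real n powr a"
    proof (cases "N \<le> n")
      case True
      have "\<bar>f n\<bar> \<le> c * real n powr a" by (rule N[OF True])
      also have "\<dots> \<le> K * real n powr a" using S0 by (intro mult_right_mono) (auto simp: K_def)
      finally show ?thesis .
    next
      case False
      then have "\<bar>f n\<bar> \<le> (\<Sum>n<N. \<bar>f n\<bar>)" by (intro member_le_sum) auto
      also have "\<dots> \<le> K * 1" using \<open>0 < c\<close> by (simp add: K_def)
      also have "\<dots> \<le> K * real n powr a" using p S0 \<open>0 < c\<close> by (intro mult_left_mono) (auto simp: K_def)
      finally show ?thesis .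
    qed
  qed
qed

text \<open>The window has half-width \<open>n powr (1/2 + 2 * e)\<close>, with \<open>2 * e\<close> in place of \<open>e\<close> to absorb the random constant
in the bound for the walk: eventually the walk stays in the window up to time \<open>n\<close>.\<close>

lemma density_window:
  fixes B :: "int set" and c \<beta> e :: real
  assumes \<beta>: "0 < \<beta>" "\<beta> < 1" and "0 < e"
    and B: "(\<lambda>n::nat. real (card (B \<inter> {- int n..int n}))) \<sim>[at_top] (\<lambda>n. c * real n powr \<beta>)"
  obtains C where "1 \<le> C" "\<And>n. 1 \<le> n \<Longrightarrow>
    real (card (B \<inter> {- int (nat \<lceil>real n powr (1/2 + 2 * e)\<rceil>)..int (nat \<lceil>real n powr (1/2 + 2 * e)\<rceil>)})) + 1
      \<le> C * real n powr (\<beta> / 2 + 2 * e)"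
proof -
  have "(\<lambda>n::nat. real (card (B \<inter> {- int n..int n}))) \<in> O(\<lambda>n. c * real n powr \<beta>)"
    using B by (rule asymp_equiv_imp_bigo)
  also have "(\<lambda>n. c * real n powr \<beta>) \<in> O(\<lambda>n. real n powr \<beta>)" by simp
  finally have "(\<lambda>n::nat. real (card (B \<inter> {- int n..int n}))) \<in> O(\<lambda>n. real n powr \<beta>)" .
  from bigo_powr_uniform[OF this less_imp_le[OF \<beta>(1)]]
  obtain C where C: "1 \<le> C" "\<And>n. 1 \<le> n \<Longrightarrow> \<bar>real (card (B \<inter> {- int n..int n}))\<bar> \<le> C * real n powr \<beta>"
    by blast
  show thesis
  proof
    show "1 \<le> 2 * C + 1" using C(1) by simp
    fix n :: nat assume n: "1 \<le> n"
    define r where "r = real n powr (1/2 + 2 * e)"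
    define L where "L = nat \<lceil>r\<rceil>"
    have r: "1 \<le> r" using n \<open>0 < e\<close> by (simp add: r_def ge_one_powr_ge_zero)
    then have L: "1 \<le> L" "real L \<le> 2 * r" unfolding L_def by linarith+
    have "real (card (B \<inter> {- int L..int L})) \<le> C * real L powr \<beta>" using C(2)[OF L(1)] by simp
    also have "\<dots> \<le> C * (2 * r) powr \<beta>"
      using L C(1) \<beta> by (intro mult_left_mono powr_mono2) auto
    also have "(2 * r) powr \<beta> = 2 powr \<beta> * r powr \<beta>" using r by (simp add: powr_mult)
    also have "r powr \<beta> = real n powr ((1/2 + 2 * e) * \<beta>)" by (simp add: r_def powr_powr)
    also have "C * (2 powr \<beta> * real n powr ((1/2 + 2 * e) * \<beta>)) \<le> C * (2 powr 1 * real n powr (\<beta> / 2 + 2 * e))"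
    proof (intro mult_left_mono mult_mono powr_mono)
      have "e * \<beta> \<le> e * 1" using \<open>0 < e\<close> \<beta> by (intro mult_left_mono) auto
      then show "(1/2 + 2 * e) * \<beta> \<le> \<beta> / 2 + 2 * e" by (simp add: algebra_simps)
    qed (use \<beta> n C(1) in auto)
    finally have "real (card (B \<inter> {- int L..int L})) \<le> 2 * C * real n powr (\<beta> / 2 + 2 * e)" by simp
    moreover have "1 \<le> real n powr (\<beta> / 2 + 2 * e)" using n \<beta> \<open>0 < e\<close> by (intro ge_one_powr_ge_zero) auto
    ultimately have "real (card (B \<inter> {- int L..int L})) + 1 \<le> (2 * C + 1) * real n powr (\<beta> / 2 + 2 * e)"
      by (simp add: distrib_right)
    then show "real (card (B \<inter> {- int (nat \<lceil>real n powr (1/2 + 2 * e)\<rceil>)..int (nat \<lceil>real n powr (1/2 + 2 * e)\<rceil>)})) + 1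
      \<le> (2 * C + 1) * real n powr (\<beta> / 2 + 2 * e)"
      by (simp add: L_def r_def)
  qed
qed

context prob_space begin

lemma AE_occupation_bound:
  fixes X :: "nat \<Rightarrow> 'a \<Rightarrow> int" and B :: "int set" and c \<beta> e :: real
  assumes X: "fair_signs X UNIV" and \<beta>: "0 < \<beta>" "\<beta> < 1" and "0 < e"
    and B: "(\<lambda>n::nat. real (card (B \<inter> {- int n..int n}))) \<sim>[at_top] (\<lambda>n. c * real n powr \<beta>)"
  shows "AE \<omega> in M. \<exists>K\<ge>1. \<forall>n\<ge>1. real (card {k. k < n \<and> walk (\<lambda>k. X k \<omega>) k \<in> B}) \<le> K * real n powr (1/2 + \<beta>/2 + 3 * e)"
proof -
  define L where "L n = nat \<lceil>real n powr (1/2 + 2 * e)\<rceil>" for n :: nat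
  define F where "F n = B \<inter> {- int (L n)..int (L n)}" for n
  have finF: "finite (F n)" for n by (simp add: F_def)
  obtain C where C: "1 \<le> C" "\<And>n. 1 \<le> n \<Longrightarrow> real (card (F n)) + 1 \<le> C * real n powr (\<beta> / 2 + 2 * e)"
    using density_window[OF \<beta> \<open>0 < e\<close> B] unfolding F_def L_def by blast
  define h where "h n k x = real_of_int (\<Sum>j\<in>F n. sgn (walk x k - j))" for n k and x :: "nat \<Rightarrow> int"
  define S where "S n \<omega> = (\<Sum>k<n. h n k (\<lambda>i. X i \<omega>) * real_of_int (X k \<omega>))" for n \<omega>
  have hpred: "h n k x = h n k y" if "\<And>i. i < k \<Longrightarrow> x i = y i" for n k x y
  proof -
    have "walk x k = walk y k" unfolding walk_def using that by (intro sum.cong) auto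
    then show ?thesis by (simp add: h_def)
  qed
  have hb: "\<bar>h n k x\<bar> \<le> real (card (F n)) + 1" for n k x
  proof -
    have "\<bar>\<Sum>j\<in>F n. sgn (walk x k - j)\<bar> \<le> (\<Sum>j\<in>F n. 1)"
      by (rule order_trans[OF sum_abs], rule sum_mono) (simp add: abs_sgn_eq)
    then have "real_of_int \<bar>\<Sum>j\<in>F n. sgn (walk x k - j)\<bar> \<le> real_of_int (int (card (F n)))"
      by (subst of_int_le_iff) simp
    then show ?thesis by (simp add: h_def)
  qed
  have "AE \<omega> in M. \<forall>\<^sub>F n in sequentially. \<forall>a\<in>{()}. \<not> real n powr e * (real (card (F n)) + 1) * sqrt n < \<bar>S n \<omega>\<bar>"
  proof (rule AE_eventually_avoid[OF \<open>0 < e\<close>])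
    fix n
    have az: "{\<omega> \<in> space M. real n powr e * (real (card (F n)) + 1) * sqrt n < \<bar>S n \<omega>\<bar>} \<in> events \<and>
      \<P>(\<omega> in M. real n powr e * (real (card (F n)) + 1) * sqrt n < \<bar>S n \<omega>\<bar>) \<le> 2 * exp (- ((real n powr e)\<^sup>2) / 2)"
      unfolding S_def
      by (intro conjI fair_signs_azuma[where h="h n", OF X hpred hb]) auto
    then show "{\<omega> \<in> space M. real n powr e * (real (card (F n)) + 1) * sqrt n < \<bar>S n \<omega>\<bar>} \<in> events"
      "\<P>(\<omega> in M. real n powr e * (real (card (F n)) + 1) * sqrt n < \<bar>S n \<omega>\<bar>) \<le> 2 * exp (- ((real n powr e)\<^sup>2) / 2)"
      by blast+
  qed auto
  moreover have "AE \<omega> in M. \<exists>K\<ge>1. modulus_bound e K (\<lambda>_ k. X k \<omega>)"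
    unfolding modulus_bound_def using fair_walks_modulus[of "\<lambda>_. X", OF X \<open>0 < e\<close>] .
  moreover have "AE \<omega> in M. \<forall>k. X k \<omega> \<in> {-1, 1}"
    using fair_signs_range[OF X UNIV_I] by (intro AE_I2) blast
  ultimately show ?thesis
  proof eventually_elim
    case (elim \<omega>)
    let ?x = "\<lambda>k. X k \<omega>"
    have sgn: "?x k \<in> {-1, 1}" for k using elim(3) by blast
    from elim(2) obtain K where K: "1 \<le> K" "modulus_bound e K (\<lambda>_. ?x)" by blast
    have wb: "\<bar>real_of_int (walk ?x k)\<bar> \<le> K * real n powr (e + 1/2)" if "1 \<le> n" "k \<le> n" for n k
    proof -
      have "\<bar>real_of_int (walk ?x k) - real_of_int (walk ?x 0)\<bar> \<le> K * real n powr e * sqrt \<bar>real k - real 0\<bar>"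
        using that by (intro modulus_boundD[OF K(2), of n 0]) auto
      also have "\<dots> \<le> K * real n powr e * sqrt n"
        using that K by (intro mult_left_mono) auto
      finally show ?thesis using that by (simp add: powr_add powr_half_sqrt)
    qed
    \<comment> \<open>the deterministic window eventually absorbs the random constant \<open>K\<close>\<close>
    have "\<forall>\<^sub>F n in sequentially. K * real n powr (e + 1/2) \<le> real n powr (1/2 + 2 * e)"
      using \<open>0 < e\<close> by real_asymp
    then have "\<forall>\<^sub>F n in sequentially. real (card {k. k < n \<and> walk ?x k \<in> B})
        \<le> (K + 1) * C * real n powr (1/2 + \<beta>/2 + 3 * e)"
      using elim(1) eventually_ge_at_top[of 1]
    proof eventually_elim
      case (elim n)
      have "walk ?x k \<in> F n" if "k < n" "walk ?x k \<in> B" for k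
      proof -
        have "\<bar>real_of_int (walk ?x k)\<bar> \<le> real n powr (1/2 + 2 * e)"
          using wb[of n k] elim(1,3) that by simp
        also have "\<dots> \<le> real (L n)" unfolding L_def by (rule real_nat_ceiling_ge)
        finally have "\<bar>walk ?x k\<bar> \<le> int (L n)" by linarith
        then show ?thesis using that by (auto simp: F_def)
      qed
      then have "{k. k < n \<and> walk ?x k \<in> B} = {k. k < n \<and> walk ?x k \<in> F n}" by (auto simp: F_def)
      then have "real (card {k. k < n \<and> walk ?x k \<in> B}) \<le> real (card (F n)) * \<bar>real_of_int (walk ?x n)\<bar> + \<bar>S n \<omega>\<bar>"
        using occupation_le[of ?x "F n" n, OF sgn finF] by (simp add: S_def h_def)
      also have "\<dots> \<le> (real (card (F n)) + 1) * (K * real n powr (e + 1/2)) + real n powr e * (real (card (F n)) + 1) * sqrt n"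
        using wb[of n n] elim(2,3) by (intro add_mono mult_mono) auto
      also have "\<dots> = (K + 1) * ((real (card (F n)) + 1) * real n powr (e + 1/2))"
        using elim(3) by (simp add: powr_add powr_half_sqrt algebra_simps)
      also have "\<dots> \<le> (K + 1) * ((C * real n powr (\<beta> / 2 + 2 * e)) * real n powr (e + 1/2))"
        using C(2)[OF elim(3)] K(1) by (intro mult_left_mono mult_right_mono) auto
      also have "\<dots> = (K + 1) * C * real n powr (1/2 + \<beta>/2 + 3 * e)"
        by (simp add: powr_add[symmetric] algebra_simps)
      finally show ?case .
    qed
    then have "(\<lambda>n. real (card {k. k < n \<and> walk ?x k \<in> B})) \<in> O(\<lambda>n. real n powr (1/2 + \<beta>/2 + 3 * e))"
      by (intro bigoI[of _ "(K + 1) * C"]) (auto elim!: eventually_mono)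
    then obtain K' where "1 \<le> K'" "\<And>n. 1 \<le> n \<Longrightarrow> \<bar>real (card {k. k < n \<and> walk ?x k \<in> B})\<bar> \<le> K' * real n powr (1/2 + \<beta>/2 + 3 * e)"
      by (rule bigo_powr_uniform) (use \<beta> \<open>0 < e\<close> in auto)
    then show ?case by auto
  qed
qed

end

section \<open>The coupling\<close>

lemma AM_GM_absorb:
  fixes t u P :: real
  assumes "0 \<le> t" "t \<le> 2 * u + P * sqrt t"
  shows "t \<le> 4 * u + P\<^sup>2"
proof -
  have "0 \<le> (sqrt t - P)\<^sup>2" by simp
  then have "2 * (P * sqrt t) \<le> t + P\<^sup>2" using assms(1) by (simp add: power2_diff mult.commute)
  then show ?thesis using assms(2) by linarith
qed

text \<open>With \<open>\<gamma>\<close> close to \<open>1/2 + \<beta>/2\<close>, the number \<open>u\<close> of vertical steps from \<open>B\<close> is at most of order \<open>N powr \<gamma>\<close>. As \<open>h - u\<close> is a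
random walk at time \<open>h + u\<close>, it is of order \<open>sqrt (h + u)\<close>, so \<open>h\<close> is of the same order as the bound for \<open>u\<close> and differs from the
occupation time by at most \<open>N powr (\<gamma> / 2)\<close>. Exchanging \<open>N - h\<close> for \<open>N\<close> in the vertical walk thus costs \<open>N powr (\<gamma> / 2)\<close>, and
exchanging \<open>h\<close> for the occupation time in the horizontal walk costs \<open>N powr (\<gamma> / 4)\<close>, each up to a small power. The distance to the
Wiener processes is at most of the same order.\<close>

lemma comb_strong_approximation:
  fixes g :: "nat \<times> nat \<Rightarrow> int" and w1 w2 :: "real \<Rightarrow> real" and B :: "int set" and e K \<beta> :: real
  assumes g: "\<And>j. g j \<in> {-1, 1}" and e: "0 < e" "e \<le> 1/12" and \<beta>: "0 < \<beta>" "\<beta> < 1" and K: "1 \<le> K"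
    and mod: "\<And>r. r \<in> {0, 1, 2} \<Longrightarrow> modulus_bound e K (\<lambda>_ k. g (r, k))"
    and occ: "\<And>n. 1 \<le> n \<Longrightarrow> real (card {k. k < n \<and> walk (\<lambda>k. g (1, k)) k \<in> B}) \<le> K * real n powr (1/2 + \<beta>/2 + 3 * e)"
    and w1: "\<And>n. \<bar>real_of_int (walk (\<lambda>k. g (0, k)) n) - w1 (real n)\<bar> \<le> K * real n powr (1/4 + 3/2 * e)"
    and w2: "\<And>n. \<bar>real_of_int (walk (\<lambda>k. g (1, k)) n) - w2 (real n)\<bar> \<le> K * real n powr (1/4 + 3/2 * e)"
    and N: "1 \<le> N"
  defines "c \<equiv> row_path B g"
  shows "\<bar>real_of_int (fst (c N)) - w1 (real (vert_occupation B c (vert_steps c N)))\<bar> \<le> 4 * K\<^sup>2 * real N powr (1/8 + \<beta>/8 + 3 * e)"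
    and "\<bar>real_of_int (snd (c N)) - w2 (real N)\<bar> \<le> 4 * K\<^sup>2 * real N powr (1/4 + \<beta>/4 + 3 * e)"
proof -
  define X where "X = walk (\<lambda>k. g (0, k))"
  define Y where "Y = walk (\<lambda>k. g (1, k))"
  define R where "R = walk (\<lambda>k. g (2, k))"
  define \<nu> where "\<nu> = real N"
  define \<gamma> where "\<gamma> = 1/2 + \<beta>/2 + 3 * e"
  obtain h u where hu: "row_counts B g N = (h, u)" by (cases "row_counts B g N")
  define v where "v = N - h"
  define D where "D = vert_occupation B c (vert_steps c N)"
  have "1 \<le> \<nu>" using N by (simp add: \<nu>_def)
  have nle: "\<nu> powr p \<le> \<nu> powr q" if "p \<le> q" for p q using \<open>1 \<le> \<nu>\<close> that by (rule powr_mono[rotated])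
  have n1: "1 \<le> \<nu> powr p" if "0 \<le> p" for p using \<open>1 \<le> \<nu>\<close> that by (rule ge_one_powr_ge_zero)
  have KK: "K \<le> K\<^sup>2" using K by (simp add: self_le_power)
  have le: "h + u \<le> N" using comb_counts_le[of B "\<lambda>k. g (1, k)" "\<lambda>k. g (2, k)" N] hu by simp
  have mb: "\<bar>real_of_int (walk (\<lambda>k. g (r, k)) i) - real_of_int (walk (\<lambda>k. g (r, k)) j)\<bar> \<le> K * \<nu> powr e * sqrt \<bar>real i - real j\<bar>"
    if "r \<in> {0, 1, 2}" "i \<le> N" "j \<le> N" for r i j
    unfolding \<nu>_def using modulus_boundD[OF mod[OF that(1)] N, of 0 i j] that N by simp
  have c: "c N = (X h, Y v)" using hu by (simp add: c_def row_path_def comb_path_def X_def Y_def v_def)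
  have D: "\<bar>real D - real u\<bar> \<le> 1" "D \<le> N"
    using vert_occupation_comb_path[of "\<lambda>k. g (1, k)" B "\<lambda>k. g (0, k)" "\<lambda>k. g (2, k)" N, OF g] hu
    by (simp_all add: D_def c_def row_path_def)
  have u: "real u \<le> K * \<nu> powr \<gamma>"
  proof -
    have "u = card {k. k < N - h \<and> Y k \<in> B}"
      using comb_counts_vertical[of B "\<lambda>k. g (1, k)" "\<lambda>k. g (2, k)" N] hu by (simp add: Y_def)
    also have "\<dots> \<le> card {k. k < N \<and> Y k \<in> B}" by (rule card_mono) auto
    finally have "real u \<le> real (card {k. k < N \<and> Y k \<in> B})" by simp
    also have "\<dots> \<le> K * \<nu> powr \<gamma>" using occ[OF N] by (simp add: Y_def \<nu>_def \<gamma>_def)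
    finally show ?thesis .
  qed
  define t where "t = real (h + u)"
  have bal: "\<bar>real h - real u\<bar> \<le> K * \<nu> powr e * sqrt t"
  proof -
    have "R (h + u) = int h - int u"
      using comb_counts_balance[of "\<lambda>k. g (2, k)" B "\<lambda>k. g (1, k)" N] g hu by (simp add: R_def)
    then have "\<bar>real h - real u\<bar> = \<bar>real_of_int (R (h + u)) - real_of_int (R 0)\<bar>" by (simp add: R_def)
    also have "\<dots> \<le> K * \<nu> powr e * sqrt \<bar>real (h + u) - real 0\<bar>"
      unfolding R_def using le by (intro mb) auto
    finally show ?thesis by (simp add: t_def)
  qed
  have t: "t \<le> 5 * K\<^sup>2 * \<nu> powr \<gamma>"
  proof -
    have "t \<le> 2 * real u + K * \<nu> powr e * sqrt t" using bal by (simp add: t_def abs_le_iff)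
    then have "t \<le> 4 * real u + (K * \<nu> powr e)\<^sup>2" by (intro AM_GM_absorb) (auto simp: t_def)
    also have "(K * \<nu> powr e)\<^sup>2 = K\<^sup>2 * \<nu> powr (2 * e)" using \<open>1 \<le> \<nu>\<close> by (simp add: power_mult_distrib powr_power mult.commute)
    also have "4 * real u + K\<^sup>2 * \<nu> powr (2 * e) \<le> 4 * (K\<^sup>2 * \<nu> powr \<gamma>) + K\<^sup>2 * \<nu> powr \<gamma>"
    proof (intro add_mono mult_left_mono nle)
      have "K * \<nu> powr \<gamma> \<le> K\<^sup>2 * \<nu> powr \<gamma>" by (intro mult_right_mono KK) simp
      with u show "real u \<le> K\<^sup>2 * \<nu> powr \<gamma>" by simp
    qed (use e \<beta> in \<open>auto simp: \<gamma>_def\<close>)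
    also have "\<dots> = 5 * K\<^sup>2 * \<nu> powr \<gamma>" by simp
    finally show ?thesis .
  qed
  have st: "sqrt t \<le> 3 * K * \<nu> powr (\<gamma> / 2)"
  proof -
    have sq: "(\<nu> powr (\<gamma> / 2))\<^sup>2 = \<nu> powr \<gamma>" using \<open>1 \<le> \<nu>\<close> by (simp add: powr_power)
    have "5 * K\<^sup>2 * \<nu> powr \<gamma> \<le> 9 * K\<^sup>2 * \<nu> powr \<gamma>" by (intro mult_right_mono) auto
    with t have "t \<le> 9 * K\<^sup>2 * \<nu> powr \<gamma>" by (rule order_trans)
    also have "\<dots> = (3 * K * \<nu> powr (\<gamma> / 2))\<^sup>2" by (simp add: power_mult_distrib sq)
    finally show ?thesis using K by (intro real_le_lsqrt) auto
  qed
  show "\<bar>real_of_int (snd (c N)) - w2 (real N)\<bar> \<le> 4 * K\<^sup>2 * real N powr (1/4 + \<beta>/4 + 3 * e)"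
  proof -
    have "\<bar>real_of_int (Y v) - real_of_int (Y N)\<bar> \<le> K * \<nu> powr e * sqrt \<bar>real v - real N\<bar>"
      unfolding Y_def by (intro mb) (auto simp: v_def)
    also have "\<dots> \<le> K * \<nu> powr e * sqrt t"
      using le K by (intro mult_left_mono real_sqrt_le_mono) (auto simp: t_def v_def)
    also have "\<dots> \<le> K * \<nu> powr e * (3 * K * \<nu> powr (\<gamma> / 2))"
      using st K by (intro mult_left_mono) auto
    also have "\<dots> = 3 * K\<^sup>2 * \<nu> powr (e + \<gamma> / 2)" by (simp add: power2_eq_square powr_add)
    also have "\<dots> \<le> 3 * K\<^sup>2 * \<nu> powr (1/4 + \<beta>/4 + 3 * e)"
      using e by (intro mult_left_mono nle) (auto simp: \<gamma>_def)
    finally have 1: "\<bar>real_of_int (Y v) - real_of_int (Y N)\<bar> \<le> 3 * K\<^sup>2 * \<nu> powr (1/4 + \<beta>/4 + 3 * e)" .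
    have "\<bar>real_of_int (Y N) - w2 (real N)\<bar> \<le> K * \<nu> powr (1/4 + 3/2 * e)"
      using w2[of N] by (simp add: Y_def \<nu>_def)
    also have "\<dots> \<le> K\<^sup>2 * \<nu> powr (1/4 + \<beta>/4 + 3 * e)"
      using KK e \<beta> by (intro mult_mono nle) auto
    finally have 2: "\<bar>real_of_int (Y N) - w2 (real N)\<bar> \<le> K\<^sup>2 * \<nu> powr (1/4 + \<beta>/4 + 3 * e)" .
    have "\<bar>real_of_int (Y v) - w2 (real N)\<bar> \<le> 3 * K\<^sup>2 * \<nu> powr (1/4 + \<beta>/4 + 3 * e) + K\<^sup>2 * \<nu> powr (1/4 + \<beta>/4 + 3 * e)"
      using 1 2 by linarith
    then show ?thesis by (simp add: c \<nu>_def)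
  qed
  show "\<bar>real_of_int (fst (c N)) - w1 (real (vert_occupation B c (vert_steps c N)))\<bar> \<le> 4 * K\<^sup>2 * real N powr (1/8 + \<beta>/8 + 3 * e)"
  proof -
    let ?r = "\<nu> powr (1/8 + \<beta>/8 + 3 * e)"
    have hD: "\<bar>real h - real D\<bar> \<le> 4 * K\<^sup>2 * \<nu> powr (e + \<gamma> / 2)"
    proof -
      have "\<bar>real h - real D\<bar> \<le> K * \<nu> powr e * sqrt t + 1" using bal D(1) by linarith
      also have "\<dots> \<le> K * \<nu> powr e * (3 * K * \<nu> powr (\<gamma> / 2)) + K\<^sup>2 * \<nu> powr (e + \<gamma> / 2)"
      proof (rule add_mono)
        show "K * \<nu> powr e * sqrt t \<le> K * \<nu> powr e * (3 * K * \<nu> powr (\<gamma> / 2))"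
          using st K by (intro mult_left_mono) auto
        have "1 * 1 \<le> K\<^sup>2 * \<nu> powr (e + \<gamma> / 2)"
          using K e \<beta> by (intro mult_mono n1) (auto simp: \<gamma>_def)
        then show "1 \<le> K\<^sup>2 * \<nu> powr (e + \<gamma> / 2)" by simp
      qed
      finally show ?thesis by (simp add: power2_eq_square powr_add)
    qed
    have "\<bar>real_of_int (X h) - real_of_int (X D)\<bar> \<le> K * \<nu> powr e * sqrt \<bar>real h - real D\<bar>"
      unfolding X_def using le D(2) by (intro mb) auto
    also have "\<dots> \<le> K * \<nu> powr e * sqrt (4 * K\<^sup>2 * \<nu> powr (e + \<gamma> / 2))"
      using hD K by (intro mult_left_mono real_sqrt_le_mono) auto
    also have "sqrt (4 * K\<^sup>2 * \<nu> powr (e + \<gamma> / 2)) = 2 * K * \<nu> powr (e / 2 + \<gamma> / 4)"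
      using K \<open>1 \<le> \<nu>\<close>
      by (simp add: real_sqrt_mult powr_half_sqrt[symmetric] powr_powr add_divide_distrib)
    also have "K * \<nu> powr e * (2 * K * \<nu> powr (e / 2 + \<gamma> / 4)) = 2 * K\<^sup>2 * \<nu> powr (e + (e / 2 + \<gamma> / 4))"
      unfolding powr_add[of \<nu> e "e / 2 + \<gamma> / 4"] by (simp add: power2_eq_square)
    also have "\<dots> \<le> 2 * K\<^sup>2 * ?r"
      using e by (intro mult_left_mono nle) (auto simp: \<gamma>_def add_divide_distrib)
    finally have 1: "\<bar>real_of_int (X h) - real_of_int (X D)\<bar> \<le> 2 * K\<^sup>2 * ?r" .
    have "\<bar>real_of_int (X D) - w1 (real D)\<bar> \<le> K * real D powr (1/4 + 3/2 * e)"
      using w1[of D] by (simp add: X_def)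
    also have "real D powr (1/4 + 3/2 * e) \<le> (2 * K * \<nu> powr \<gamma>) powr (1/4 + 3/2 * e)"
    proof (rule powr_mono2)
      have "1 * 1 \<le> K * \<nu> powr \<gamma>" using K e \<beta> by (intro mult_mono n1) (auto simp: \<gamma>_def)
      then show "real D \<le> 2 * K * \<nu> powr \<gamma>" using u D(1) by linarith
    qed (use e in auto)
    also have "\<dots> = (2 * K) powr (1/4 + 3/2 * e) * \<nu> powr (\<gamma> * (1/4 + 3/2 * e))"
      using K by (simp add: powr_mult powr_powr)
    also have "\<dots> \<le> (2 * K) powr 1 * ?r"
    proof (intro mult_mono nle powr_mono)
      have "\<gamma> \<le> 5/4" using e \<beta> by (simp add: \<gamma>_def)
      then have "\<gamma> * e \<le> 5/4 * e" using e by (intro mult_right_mono) auto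
      then show "\<gamma> * (1/4 + 3/2 * e) \<le> 1/8 + \<beta>/8 + 3 * e"
        using e by (simp add: \<gamma>_def algebra_simps)
    qed (use K e in auto)
    finally have "\<bar>real_of_int (X D) - w1 (real D)\<bar> \<le> K * ((2 * K) powr 1 * ?r)" using K by simp
    also have "\<dots> = 2 * K\<^sup>2 * ?r" using K by (simp add: power2_eq_square)
    finally have "\<bar>real_of_int (X h) - w1 (real D)\<bar> \<le> 2 * K\<^sup>2 * ?r + 2 * K\<^sup>2 * ?r"
      using 1 by linarith
    then show ?thesis by (simp add: c D_def \<nu>_def)
  qed
qed

definition coin_space :: "(nat \<Rightarrow> real) measure" where
  "coin_space = Pi\<^sub>M UNIV (\<lambda>_. measure_pmf (pmf_of_set {-1, 1}))"

text \<open>Every real number other than 1 counts as -1, so that the coins are signs at every sample point and not only almost surely.\<close>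

definition coin :: "nat \<Rightarrow> (nat \<Rightarrow> real) \<Rightarrow> int" where
  "coin i \<omega> = (if \<omega> i = 1 then 1 else -1)"

lemma prob_space_coin_space: "prob_space coin_space"
  unfolding coin_space_def by (intro prob_space_PiM measure_pmf.prob_space_axioms)

lemma fair_signs_coin: "prob_space.fair_signs coin_space coin UNIV"
proof -
  interpret prob_space coin_space by (rule prob_space_coin_space)
  let ?p = "pmf_of_set {-1, 1::real}"
  interpret P: product_prob_space "\<lambda>_::nat. measure_pmf ?p" UNIV by unfold_locales
  have sp: "space coin_space = UNIV" by (simp add: coin_space_def space_PiM)
  have half: "measure_pmf.prob ?p {1} = 1/2" by (simp add: measure_pmf_single)
  then have half': "measure_pmf.prob ?p (- {1}) = 1/2"
    using measure_pmf.prob_compl[of "{1}" ?p] by (simp add: Compl_eq_Diff_UNIV)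
  show ?thesis
    unfolding fair_signs_def
  proof (intro conjI ballI allI impI)
    show "random_variable (count_space UNIV) (coin i)" for i
    proof -
      have "(\<lambda>\<omega>. \<omega> i) \<in> measurable coin_space (measure_pmf ?p)"
        unfolding coin_space_def by (rule measurable_component_singleton) simp
      from measurable_compose[OF this, of "\<lambda>x. if x = 1 then 1 else -1 :: int" "count_space UNIV"]
      show ?thesis by (simp add: coin_def[abs_def])
    qed
    show "coin i \<in> space coin_space \<rightarrow> {-1, 1}" for i by (auto simp: coin_def)
    fix J :: "nat set" and y :: "nat \<Rightarrow> int" assume J: "finite J" "y \<in> J \<rightarrow> {-1, 1}"
    define A where "A i = (if y i = 1 then {1} else - {1::real})" for i
    have "{\<omega> \<in> space coin_space. \<forall>j\<in>J. coin j \<omega> = y j} = {\<omega> \<in> space coin_space. \<forall>j\<in>J. \<omega> j \<in> A j}"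
      using J(2) by (intro Collect_cong conj_cong refl ball_cong) (auto simp: coin_def A_def Pi_iff split: if_splits)
    also have "emeasure coin_space \<dots> = (\<Prod>i\<in>J. emeasure (measure_pmf ?p) (A i))"
      unfolding coin_space_def using J by (intro P.emeasure_PiM_Collect) auto
    also have "\<dots> = (\<Prod>i\<in>J. ennreal (1/2))"
    proof (rule prod.cong[OF refl])
      fix i
      have "measure_pmf.prob ?p (A i) = 1/2" using half half' by (auto simp: A_def)
      then show "emeasure (measure_pmf ?p) (A i) = ennreal (1/2)"
        by (simp only: measure_pmf.emeasure_eq_measure)
    qed
    also have "\<dots> = ennreal ((1/2) ^ card J)"
      unfolding prod_constant by (rule ennreal_power) simp
    finally show "\<P>(\<omega> in coin_space. \<forall>j\<in>J. coin j \<omega> = y j) = (1/2) ^ card J"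
      by (simp add: measure_def)
  qed
qed

context prob_space begin

text \<open>Each path is a measurable function of the restriction of the signs to its own index set, and these restrictions are independent.\<close>

lemma indep_processes_brownian:
  fixes Z :: "'i \<Rightarrow> 'a \<Rightarrow> int"
  assumes Z: "fair_signs Z UNIV" and inj: "inj f" "inj g" and disj: "range f \<inter> range g = {}"
  shows "indep_processes (\<lambda>t \<omega>. brownian (\<lambda>p. Z (f p) \<omega>) t) (\<lambda>t \<omega>. brownian (\<lambda>p. Z (g p) \<omega>) t)"
proof -
  define W where "W f x = (\<lambda>t\<in>{0..}. brownian (\<lambda>p. x (f p)) t)" for f :: "nat \<times> nat \<Rightarrow> 'i" and x
  have W: "W f \<in> measurable (Pi\<^sub>M (range f) (\<lambda>_. count_space UNIV)) (\<Pi>\<^sub>M t\<in>{0..}. borel)" for f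
  proof -
    have "(\<lambda>x. \<lambda>p\<in>UNIV. x (f p)) \<in> measurable (Pi\<^sub>M (range f) (\<lambda>_. count_space UNIV)) (Pi\<^sub>M UNIV (\<lambda>_. count_space (UNIV::int set)))"
      by (intro measurable_restrict measurable_component_singleton) auto
    then have r: "(\<lambda>x p. x (f p)) \<in> measurable (Pi\<^sub>M (range f) (\<lambda>_. count_space UNIV)) (Pi\<^sub>M UNIV (\<lambda>_. count_space (UNIV::int set)))"
      by (simp add: restrict_def)
    show ?thesis
      unfolding W_def by (intro measurable_restrict measurable_compose[OF r measurable_brownian])
  qed
  have "indep_var (\<Pi>\<^sub>M t\<in>{0..}. borel) (W f \<circ> (\<lambda>\<omega>. restrict (\<lambda>i. Z i \<omega>) (range f)))
      (\<Pi>\<^sub>M t\<in>{0..}. borel) (W g \<circ> (\<lambda>\<omega>. restrict (\<lambda>i. Z i \<omega>) (range g)))"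
    by (rule indep_var_compose[OF indep_var_restrict[OF fair_signs_indep[OF Z] disj] W W]) auto
  moreover have "W f \<circ> (\<lambda>\<omega>. restrict (\<lambda>i. Z i \<omega>) (range f)) = (\<lambda>\<omega>. \<lambda>t\<in>{0..}. brownian (\<lambda>p. Z (f p) \<omega>) t)" for f
    by (simp add: W_def fun_eq_iff)
  ultimately show ?thesis unfolding indep_processes_def by simp
qed

end

theorem theorem4p2:
  fixes \<beta> c :: real and B :: "int set"
  assumes "0 < \<beta>" and "\<beta> < 1" and "c > 0"
    and "(\<lambda>n::nat. real (card (B \<inter> {- int n..int n}))) \<sim>[at_top] (\<lambda>n. c * real n powr \<beta>)"
  shows "\<exists>(M :: (nat \<Rightarrow> real) measure) C W1 W2.
    prob_space M \<and>
    prob_space.comb_walk M B C \<and>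
    prob_space.wiener_process M W1 \<and>
    prob_space.wiener_process M W2 \<and>
    prob_space.indep_processes M W1 W2 \<and>
    (\<forall>\<epsilon>>0.
      (AE \<omega> in M.
        (\<lambda>N::nat. let path = (\<lambda>k. C k \<omega>) in
           \<bar>real_of_int (fst (C N \<omega>))
             - W1 (real (vert_occupation B path (vert_steps path N))) \<omega>\<bar>)
        \<in> O(\<lambda>N. real N powr (1/8 + \<beta>/8 + \<epsilon>))) \<and>
      (AE \<omega> in M.
        (\<lambda>N::nat. \<bar>real_of_int (snd (C N \<omega>)) - W2 (real N) \<omega>\<bar>)
        \<in> O(\<lambda>N. real N powr (1/4 + \<beta>/4 + \<epsilon>))))"
proof -
  interpret prob_space coin_space by (rule prob_space_coin_space)
  \<comment> \<open>the families 0, 1, 2 drive the horizontal walk, the vertical walk and the direction coins; in each of the first two, row 0 is the walk itself and the other rows serve its refinement\<close>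
  define Z where "Z p rk = coin (prod_encode (p, prod_encode rk))" for p rk
  define G where "G = (\<lambda>(p, k). Z p (0, k))"
  have Z: "fair_signs (Z p) UNIV" for p
    unfolding Z_def[abs_def] by (rule fair_signs_reindex[OF fair_signs_coin]) (auto simp: inj_on_def)
  have G: "fair_signs G UNIV"
  proof -
    have "fair_signs (\<lambda>q. coin (prod_encode (fst q, prod_encode (0, snd q)))) UNIV"
      by (rule fair_signs_reindex[OF fair_signs_coin]) (auto simp: inj_on_def)
    moreover have "(\<lambda>q. coin (prod_encode (fst q, prod_encode (0, snd q)))) = G"
      by (auto simp: G_def Z_def fun_eq_iff)
    ultimately show ?thesis by simp
  qed
  define W1 where "W1 t \<omega> = brownian (\<lambda>rk. Z 0 rk \<omega>) t" for t \<omega>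
  define W2 where "W2 t \<omega> = brownian (\<lambda>rk. Z 1 rk \<omega>) t" for t \<omega>
  define C where "C N \<omega> = row_path B (\<lambda>j. G j \<omega>) N" for N \<omega>
  have walk: "comb_walk B C" unfolding C_def[abs_def] by (rule comb_walk_row_path[OF G])
  have wiener: "wiener_process W1" "wiener_process W2"
    unfolding W1_def[abs_def] W2_def[abs_def] by (rule wiener_process_brownian[OF Z])+
  have indep: "indep_processes W1 W2"
    unfolding W1_def[abs_def] W2_def[abs_def] Z_def
    by (rule indep_processes_brownian[OF fair_signs_coin]) (auto simp: inj_on_def)
  have rate: "(AE \<omega> in coin_space.
        (\<lambda>N::nat. let path = (\<lambda>k. C k \<omega>) in
           \<bar>real_of_int (fst (C N \<omega>)) - W1 (real (vert_occupation B path (vert_steps path N))) \<omega>\<bar>)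
        \<in> O(\<lambda>N. real N powr (1/8 + \<beta>/8 + \<epsilon>))) \<and>
      (AE \<omega> in coin_space.
        (\<lambda>N::nat. \<bar>real_of_int (snd (C N \<omega>)) - W2 (real N) \<omega>\<bar>)
        \<in> O(\<lambda>N. real N powr (1/4 + \<beta>/4 + \<epsilon>)))" if "0 < \<epsilon>" for \<epsilon>
  proof -
    define e where "e = min (\<epsilon> / 3) (1/12)"
    have e: "0 < e" "e \<le> 1/12" "3 * e \<le> \<epsilon>" using that by (auto simp: e_def)
    have row: "fair_signs (\<lambda>k. G (r, k)) UNIV" for r
      by (rule fair_signs_reindex[OF G]) (auto simp: inj_on_def)
    have mod: "AE \<omega> in coin_space. \<exists>K\<ge>1. modulus_bound e K (\<lambda>_ k. G (r, k) \<omega>)" for r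
      unfolding modulus_bound_def by (rule fair_walks_modulus[OF row e(1)])
    have sgn: "AE \<omega> in coin_space. \<forall>p rk. Z p rk \<omega> \<in> {-1, 1}"
      using fair_signs_range[OF Z UNIV_I] by (intro AE_I2) blast
    have "AE \<omega> in coin_space. \<exists>A. \<forall>N\<ge>1. let path = (\<lambda>k. C k \<omega>) in
        \<bar>real_of_int (fst (C N \<omega>)) - W1 (real (vert_occupation B path (vert_steps path N))) \<omega>\<bar> \<le> A * real N powr (1/8 + \<beta>/8 + 3 * e) \<and>
        \<bar>real_of_int (snd (C N \<omega>)) - W2 (real N) \<omega>\<bar> \<le> A * real N powr (1/4 + \<beta>/4 + 3 * e)"
      using mod[of 0] mod[of 1] mod[of 2] AE_modulus_bounds[OF Z e(1), of 0] AE_modulus_bounds[OF Z e(1), of 1]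
        AE_occupation_bound[OF row assms(1,2) e(1) assms(4), of 1] sgn
    proof eventually_elim
      case (elim \<omega>)
      let ?g = "\<lambda>j. G j \<omega>"
      have sg: "Z p rk \<omega> \<in> {-1, 1}" for p rk using elim(7) by blast
      have sG: "?g j \<in> {-1, 1}" for j using sg by (auto simp: G_def split: prod.split)
      obtain K0 K1 K2 where K: "1 \<le> K0" "modulus_bound e K0 (\<lambda>_ k. G (0, k) \<omega>)"
        "1 \<le> K1" "modulus_bound e K1 (\<lambda>_ k. G (1, k) \<omega>)" "1 \<le> K2" "modulus_bound e K2 (\<lambda>_ k. G (2, k) \<omega>)"
        using elim(1-3) by blast
      obtain K3 where K3: "1 \<le> K3" "\<And>n. 1 \<le> n \<Longrightarrow> real (card {k. k < n \<and> walk (\<lambda>k. G (1, k) \<omega>) k \<in> B}) \<le> K3 * real n powr (1/2 + \<beta>/2 + 3 * e)"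
        using elim(6) by blast
      have near: "\<exists>A\<ge>0. \<forall>n. \<bar>real_of_int (walk (\<lambda>k. G (p, k) \<omega>) n) - brownian (\<lambda>rk. Z p rk \<omega>) (real n)\<bar> \<le> A * real n powr (1/4 + 3/2 * e)"
        if m: "\<exists>K\<ge>1. modulus_bound e K (level (\<lambda>rk. Z p rk \<omega>)) \<and> modulus_bound e K (\<lambda>m k. Z p (2 * m + 1, k) \<omega>)" for p
      proof -
        obtain K where K: "1 \<le> K" "modulus_bound e K (level (\<lambda>rk. Z p rk \<omega>))" "modulus_bound e K (\<lambda>m k. Z p (2 * m + 1, k) \<omega>)"
          using m by blast
        show ?thesis
          using walk_near_brownian[of "\<lambda>rk. Z p rk \<omega>", OF sg e(1,2) K] by (auto simp: G_def)
      qed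
      obtain A1 A2 where A: "0 \<le> A1" "\<And>n. \<bar>real_of_int (walk (\<lambda>k. G (0, k) \<omega>) n) - W1 (real n) \<omega>\<bar> \<le> A1 * real n powr (1/4 + 3/2 * e)"
        "0 \<le> A2" "\<And>n. \<bar>real_of_int (walk (\<lambda>k. G (1, k) \<omega>) n) - W2 (real n) \<omega>\<bar> \<le> A2 * real n powr (1/4 + 3/2 * e)"
        using near[OF elim(4)] near[OF elim(5)] unfolding W1_def W2_def by blast
      define K where "K = K0 + K1 + K2 + K3 + A1 + A2"
      have Kge: "K0 \<le> K" "K1 \<le> K" "K2 \<le> K" "K3 \<le> K" "A1 \<le> K" "A2 \<le> K" "1 \<le> K"
        using K K3(1) A(1,3) by (auto simp: K_def)
      have up: "a \<le> K * real n powr q" if "a \<le> b * real n powr q" "b \<le> K" for a b n q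
        using that by (meson mult_right_mono order_trans powr_ge_zero)
      have Kmod: "modulus_bound e K (\<lambda>_ k. G (r, k) \<omega>)" if "r \<in> {0, 1, 2}" for r
        using that modulus_bound_mono[OF K(2) Kge(1)] modulus_bound_mono[OF K(4) Kge(2)] modulus_bound_mono[OF K(6) Kge(3)] by auto
      have path: "(\<lambda>k. C k \<omega>) = row_path B ?g" by (simp add: C_def fun_eq_iff)
      note main = comb_strong_approximation[of ?g e \<beta> K B "\<lambda>t. W1 t \<omega>" "\<lambda>t. W2 t \<omega>", OF sG e(1,2) assms(1,2) Kge(7) Kmod
          up[OF K3(2) Kge(4)] up[OF A(2) Kge(5)] up[OF A(4) Kge(6)]]
      show ?case
        unfolding Let_def path
        by (intro exI[of _ "4 * K\<^sup>2"] allI impI conjI) (auto simp: C_def intro: main)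
    qed
    note bd = this
    have mono: "(\<lambda>N. real N powr (p + 3 * e)) \<in> O(\<lambda>N. real N powr (p + \<epsilon>))" for p
    proof (rule bigoI[of _ 1])
      show "\<forall>\<^sub>F N in sequentially. norm (real N powr (p + 3 * e)) \<le> 1 * norm (real N powr (p + \<epsilon>))"
        using eventually_ge_at_top[of 1] by eventually_elim (use e(3) in \<open>auto intro: powr_mono\<close>)
    qed
    have bigo: "f \<in> O(\<lambda>N. real N powr (p + \<epsilon>))" if "\<forall>N\<ge>1. \<bar>f N\<bar> \<le> A * real N powr (p + 3 * e)" for f :: "nat \<Rightarrow> real" and A p
    proof -
      have "f \<in> O(\<lambda>N. real N powr (p + 3 * e))"
        using that by (intro bigoI[of _ A]) (auto simp: eventually_sequentially)
      then show ?thesis using mono by (rule landau_o.big_trans)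
    qed
    show ?thesis
    proof (intro conjI)
      show "AE \<omega> in coin_space.
        (\<lambda>N::nat. let path = (\<lambda>k. C k \<omega>) in
           \<bar>real_of_int (fst (C N \<omega>)) - W1 (real (vert_occupation B path (vert_steps path N))) \<omega>\<bar>)
        \<in> O(\<lambda>N. real N powr (1/8 + \<beta>/8 + \<epsilon>))"
        using bd
      proof eventually_elim
        case (elim \<omega>)
        then obtain A where "\<forall>N\<ge>1. \<bar>let path = (\<lambda>k. C k \<omega>) in
           \<bar>real_of_int (fst (C N \<omega>)) - W1 (real (vert_occupation B path (vert_steps path N))) \<omega>\<bar>\<bar> \<le> A * real N powr (1/8 + \<beta>/8 + 3 * e)"
          by (auto simp: Let_def)
        then show ?case by (rule bigo)
      qed
      show "AE \<omega> in coin_space. (\<lambda>N::nat. \<bar>real_of_int (snd (C N \<omega>)) - W2 (real N) \<omega>\<bar>)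
        \<in> O(\<lambda>N. real N powr (1/4 + \<beta>/4 + \<epsilon>))"
        using bd
      proof eventually_elim
        case (elim \<omega>)
        then obtain A where "\<forall>N\<ge>1. \<bar>\<bar>real_of_int (snd (C N \<omega>)) - W2 (real N) \<omega>\<bar>\<bar> \<le> A * real N powr (1/4 + \<beta>/4 + 3 * e)"
          by (auto simp: Let_def)
        then show ?case by (rule bigo)
      qed
    qed
  qed
  show ?thesis
    using prob_space_coin_space walk wiener indep rate by blast
qed

end
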